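(* Let $\mathcal{S}$ be a thick generalized quadrangle of order $(s,s^2)$ such that (i) $\mathcal{S}$ has a line $L$ all of whose points are translation points; (ii) $\mathcal{S}$ has a subquadrangle $\mathcal{S}'$ of order $s$ containing $L$; (iii) every subtended ovoid in $\mathcal{S}'$ is doubly subtended. Let $\mathcal{A}$ and $\mathcal{E}$ be the geometries defined below, and let $\gamma:\mathcal{A}\to\mathcal{E}$ be a $2$-cover of $\mathcal{E}$, with induced automorphism $\overline{\alpha}$ of $\mathcal{S}'$. If $\overline{\alpha}$ fixes the line $L$, then there exist exactly two automorphisms $\widetilde{\alpha}$ of $\mathcal{S}$ which extend $\overline{\alpha}$ (i.e. whose restriction to $\mathcal{S}'$ is $\overline{\alpha}$).
   Context: A symmetry about a line $M$ of a generalized quadrangle (GQ) of order $(s,t)$ is an automorphism fixing every line concurrent with $M$ (including $M$); $M$ is an axis of symmetry if the group of symmetries about $M$ has order $s$. A point is a translation point if every line through it is an axis of symmetry. Here $\mathcal{S}'$ is a full subquadrangle and a geometrical hyperplane of $\mathcal{S}$ (every line of $\mathcal{S}$ either is a line of $\mathcal{S}'$ or meets $\mathcal{S}'$ in exactly one point). For a point $x$ of $\mathcal{S}$ not in $\mathcal{S}'$, $\mathcal{O}_x = x^\perp\cap\mathcal{S}'$ (points collinear with $x$ in $\mathcal{S}'$) is an ovoid of $\mathcal{S}'$, called subtended (by $x$); it is doubly subtended if exactly two points of $\mathcal{S}\setminus\mathcal{S}'$ subtend it. For a line $N$ of $\mathcal{S}$ not in $\mathcal{S}'$, the rosette $R_N$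 is the set of ovoids $\mathcal{O}_y$ with $y$ a point of $N$ not in $\mathcal{S}'$. The geometry $\mathcal{A}$ has as points and lines the points and lines of $\mathcal{S}$ not in $\mathcal{S}'$, with induced incidence; the geometry $\mathcal{E}$ has as points the subtended ovoids and as lines the rosettes, incidence being containment. A morphism of point-line geometries maps points to points, lines to lines and preserves incidence; a cover is a morphism inducing, for each point $x$, a bijection between lines through $x$ and lines through its image, and for each line a bijection between its points and the points of its image; a $2$-cover is a cover all of whose point- and line-fibres have size $2$. Given a cover $\gamma:\mathcal{A}\to\mathcal{E}$, for each line $R$ of $\mathcal{E}$ all lines of $\gamma^{-1}(R)$ pass through one common point $u$ of $\mathcal{S}'$; sending $u$ to the common point of the ovoids of the rosette $R$ gives a well-defined permutation of the points of $\mathcal{S}'$ which is the point map of an automorphism $\overline{\alpha}$ of $\mathcal{S}'$ (the automorphism induced by $\gamma$). *)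

theory Defs
  imports Main "HOL-Library.FuncSet"
begin

section \<open>Point-line geometries\<close>

record ('p, 'l) geometry =
  pts :: "'p set"
  lns :: "'l set"
  inc :: "'p \<Rightarrow> 'l \<Rightarrow> bool"

definition pts_on :: "('p, 'l) geometry \<Rightarrow> 'l \<Rightarrow> 'p set" where
  "pts_on G N = {x \<in> pts G. inc G x N}"

definition lns_through :: "('p, 'l) geometry \<Rightarrow> 'p \<Rightarrow> 'l set" where
  "lns_through G x = {N \<in> lns G. inc G x N}"

text \<open>Both relations are reflexive on the carriers of geometries without isolated elements:
  a point is collinear with itself and a line is concurrent with itself.\<close>

definition collinear :: "('p, 'l) geometry \<Rightarrow> 'p \<Rightarrow> 'p \<Rightarrow> bool" where
  "collinear G x y \<longleftrightarrow> (\<exists>N \<in> lns G. inc G x N \<and> inc G y N)"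

definition concurrent :: "('p, 'l) geometry \<Rightarrow> 'l \<Rightarrow> 'l \<Rightarrow> bool" where
  "concurrent G M N \<longleftrightarrow> (\<exists>x \<in> pts G. inc G x M \<and> inc G x N)"

definition perp :: "('p, 'l) geometry \<Rightarrow> 'p \<Rightarrow> 'p set" where
  "perp G x = {y \<in> pts G. collinear G x y}"

text \<open>Maps between geometries are pairs of a point map and a line map. Automorphisms are
  extensional (\<open>undefined\<close> off the carriers), so that distinct pairs
  are distinct as maps of the geometry and automorphisms can be counted with \<open>card\<close>.\<close>

definition automorphisms :: "('p, 'l) geometry \<Rightarrow> (('p \<Rightarrow> 'p) \<times> ('l \<Rightarrow> 'l)) set" where
  "automorphisms G = {\<phi>.
     fst \<phi> \<in> extensional (pts G) \<and> bij_betw (fst \<phi>) (pts G) (pts G) \<and>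
     snd \<phi> \<in> extensional (lns G) \<and> bij_betw (snd \<phi>) (lns G) (lns G) \<and>
     (\<forall>x \<in> pts G. \<forall>N \<in> lns G. inc G (fst \<phi> x) (snd \<phi> N) \<longleftrightarrow> inc G x N)}"

definition morphism ::
    "('p, 'l) geometry \<Rightarrow> ('q, 'm) geometry \<Rightarrow> ('p \<Rightarrow> 'q) \<times> ('l \<Rightarrow> 'm) \<Rightarrow> bool" where
  "morphism G H \<gamma> \<longleftrightarrow>
     fst \<gamma> ` pts G \<subseteq> pts H \<and> snd \<gamma> ` lns G \<subseteq> lns H \<and>
     (\<forall>x \<in> pts G. \<forall>N \<in> lns G. inc G x N \<longrightarrow> inc H (fst \<gamma> x) (snd \<gamma> N))"

definition cover ::
    "('p, 'l) geometry \<Rightarrow> ('q, 'm) geometry \<Rightarrow> ('p \<Rightarrow> 'q) \<times> ('l \<Rightarrow> 'm) \<Rightarrow> bool" where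
  "cover G H \<gamma> \<longleftrightarrow> morphism G H \<gamma> \<and>
     (\<forall>x \<in> pts G. bij_betw (snd \<gamma>) (lns_through G x) (lns_through H (fst \<gamma> x))) \<and>
     (\<forall>N \<in> lns G. bij_betw (fst \<gamma>) (pts_on G N) (pts_on H (snd \<gamma> N)))"

definition two_cover ::
    "('p, 'l) geometry \<Rightarrow> ('q, 'm) geometry \<Rightarrow> ('p \<Rightarrow> 'q) \<times> ('l \<Rightarrow> 'm) \<Rightarrow> bool" where
  "two_cover G H \<gamma> \<longleftrightarrow> cover G H \<gamma> \<and>
     (\<forall>y \<in> pts H. card {x \<in> pts G. fst \<gamma> x = y} = 2) \<and>
     (\<forall>R \<in> lns H. card {N \<in> lns G. snd \<gamma> N = R} = 2)"

section \<open>Generalized quadrangles\<close>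

definition generalized_quadrangle :: "('p, 'l) geometry \<Rightarrow> nat \<Rightarrow> nat \<Rightarrow> bool" where
  "generalized_quadrangle G s t \<longleftrightarrow>
     1 \<le> s \<and> 1 \<le> t \<and> pts G \<noteq> {} \<and> lns G \<noteq> {} \<and>
     (\<forall>x \<in> pts G. card (lns_through G x) = t + 1) \<and>
     (\<forall>N \<in> lns G. card (pts_on G N) = s + 1) \<and>
     (\<forall>x \<in> pts G. \<forall>y \<in> pts G. \<forall>M \<in> lns G. \<forall>N \<in> lns G.
        x \<noteq> y \<and> inc G x M \<and> inc G y M \<and> inc G x N \<and> inc G y N \<longrightarrow> M = N) \<and>
     (\<forall>x \<in> pts G. \<forall>N \<in> lns G. \<not> inc G x N \<longrightarrow>
        (\<exists>!(y, M). y \<in> pts G \<and> M \<in> lns G \<and> inc G x M \<and> inc G y M \<and> inc G y N))"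

definition thick_gq :: "('p, 'l) geometry \<Rightarrow> nat \<Rightarrow> nat \<Rightarrow> bool" where
  "thick_gq G s t \<longleftrightarrow> generalized_quadrangle G s t \<and> 2 \<le> s \<and> 2 \<le> t"

definition subquadrangle ::
    "('p, 'l) geometry \<Rightarrow> ('p, 'l) geometry \<Rightarrow> nat \<Rightarrow> nat \<Rightarrow> bool" where
  "subquadrangle S' S s' t' \<longleftrightarrow>
     generalized_quadrangle S' s' t' \<and> pts S' \<subseteq> pts S \<and> lns S' \<subseteq> lns S \<and>
     (\<forall>x \<in> pts S'. \<forall>N \<in> lns S'. inc S' x N \<longleftrightarrow> inc S x N)"

definition symmetries :: "('p, 'l) geometry \<Rightarrow> 'l \<Rightarrow> (('p \<Rightarrow> 'p) \<times> ('l \<Rightarrow> 'l)) set" where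
  "symmetries G M = {\<phi> \<in> automorphisms G. \<forall>N \<in> lns G. concurrent G M N \<longrightarrow> snd \<phi> N = N}"

text \<open>The parameter \<open>s\<close> is the first parameter of the order \<open>(s, t)\<close> of the quadrangle.\<close>

definition axis_of_symmetry :: "('p, 'l) geometry \<Rightarrow> nat \<Rightarrow> 'l \<Rightarrow> bool" where
  "axis_of_symmetry G s M \<longleftrightarrow> M \<in> lns G \<and> card (symmetries G M) = s"

definition translation_point :: "('p, 'l) geometry \<Rightarrow> nat \<Rightarrow> 'p \<Rightarrow> bool" where
  "translation_point G s x \<longleftrightarrow>
     x \<in> pts G \<and> (\<forall>M \<in> lns_through G x. axis_of_symmetry G s M)"

section \<open>Subtended ovoids and rosettes\<close>

definition subtended :: "('p, 'l) geometry \<Rightarrow> ('p, 'l) geometry \<Rightarrow> 'p \<Rightarrow> 'p set" where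
  "subtended S S' x = perp S x \<inter> pts S'"

definition subtended_ovoids :: "('p, 'l) geometry \<Rightarrow> ('p, 'l) geometry \<Rightarrow> 'p set set" where
  "subtended_ovoids S S' = subtended S S' ` (pts S - pts S')"

definition doubly_subtended :: "('p, 'l) geometry \<Rightarrow> ('p, 'l) geometry \<Rightarrow> 'p set \<Rightarrow> bool" where
  "doubly_subtended S S' Ov \<longleftrightarrow> card {x \<in> pts S - pts S'. subtended S S' x = Ov} = 2"

definition rosette :: "('p, 'l) geometry \<Rightarrow> ('p, 'l) geometry \<Rightarrow> 'l \<Rightarrow> 'p set set" where
  "rosette S S' N = subtended S S' ` (pts_on S N - pts S')"

definition geom_A :: "('p, 'l) geometry \<Rightarrow> ('p, 'l) geometry \<Rightarrow> ('p, 'l) geometry" where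
  "geom_A S S' = \<lparr>pts = pts S - pts S', lns = lns S - lns S', inc = inc S\<rparr>"

definition geom_E :: "('p, 'l) geometry \<Rightarrow> ('p, 'l) geometry \<Rightarrow> ('p set, 'p set set) geometry" where
  "geom_E S S' = \<lparr>pts = subtended_ovoids S S', lns = rosette S S' ` (lns S - lns S'),
                  inc = (\<lambda>Ov R. Ov \<in> R)\<rparr>"

text \<open>\<open>\<alpha>\<close> is the automorphism of \<open>S'\<close> induced by \<open>\<gamma>\<close>: whenever \<open>u\<close> is the common point in \<open>S'\<close> of
  the lines in the fibre of a line \<open>R\<close> of \<open>geom_E\<close>, and \<open>v\<close> is the common point of the ovoids in
  \<open>R\<close>, then \<open>\<alpha>\<close> maps \<open>u\<close> to \<open>v\<close>. That \<open>u\<close> and \<open>v\<close> exist and are unique for every \<open>R\<close>, and that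
  every point of \<open>S'\<close> occurs as such a \<open>u\<close>, is not part of the definition but a property of
  2-covers \<open>\<gamma>\<close>; it makes \<open>\<alpha>\<close> unique.\<close>

definition induced_automorphism ::
    "('p, 'l) geometry \<Rightarrow> ('p, 'l) geometry \<Rightarrow> ('p \<Rightarrow> 'p set) \<times> ('l \<Rightarrow> 'p set set) \<Rightarrow>
     ('p \<Rightarrow> 'p) \<times> ('l \<Rightarrow> 'l) \<Rightarrow> bool" where
  "induced_automorphism S S' \<gamma> \<alpha> \<longleftrightarrow>
     \<alpha> \<in> automorphisms S' \<and>
     (\<forall>R \<in> lns (geom_E S S'). \<forall>u \<in> pts S'. \<forall>v \<in> pts S'.
        (\<forall>N \<in> lns (geom_A S S'). snd \<gamma> N = R \<longrightarrow> inc S u N) \<and> (\<forall>Ov \<in> R. v \<in> Ov)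
        \<longrightarrow> fst \<alpha> u = v)"

definition extensions ::
    "('p, 'l) geometry \<Rightarrow> ('p, 'l) geometry \<Rightarrow> ('p \<Rightarrow> 'p) \<times> ('l \<Rightarrow> 'l) \<Rightarrow>
     (('p \<Rightarrow> 'p) \<times> ('l \<Rightarrow> 'l)) set" where
  "extensions S S' \<alpha> = {\<beta> \<in> automorphisms S.
     (restrict (fst \<beta>) (pts S'), restrict (snd \<beta>) (lns S')) = \<alpha>}"

end

theory Submission imports Defs "HOL-Combinatorics.Permutations" begin

text \<open>
  Call the other point that subtends the same ovoid as \<open>x\<close> the twin of \<open>x\<close>. Since triads of a
  quadrangle of order \<open>(s, s\<^sup>2)\<close> have exactly \<open>s + 1\<close> centres, exchanging twins is an automorphism
  fixing the subquadrangle pointwise, and by connectedness it is the only non-trivial one; so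
  the number of extensions is 0 or 2. By local injectivity, two points in a fibre of the cover have all their
  common neighbours in the subquadrangle, so they are twins. It follows that the induced map \<open>a\<close> sends the ovoid of
  \<open>x\<close> to the ovoid \<open>\<gamma>(x)\<close>, and extending \<open>a\<close> amounts to choosing one of two candidates over each
  point so that collinearity is preserved.

  Fix \<open>p\<close> on \<open>L\<close>; then \<open>p\<close> and \<open>a p\<close> are translation points. A choice of
  candidates on one line \<open>N\<close> through \<open>p\<close> determines a choice at every point not collinear with
  \<open>p\<close>, and the crux is that two such lines \<open>N\<close>, \<open>M\<close> determine the same choice up to a global
  exchange of twins. Translations act on the lines through \<open>p\<close> like symmetries about \<open>L\<close>, which \<open>a\<close>
  conjugates into symmetries about \<open>L\<close>. Hence the translations about \<open>p\<close> that have a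
  partner about \<open>a p\<close> compatible with given choices on \<open>N\<close> and \<open>M\<close> form a group. The two
  possible choices on \<open>M\<close> give two groups that cover the whole translation group, so one of them
  is everything. The partner is uniquely determined, because two candidates would share more than \<open>s + 1\<close>
  neighbours of \<open>a p\<close>.
\<close>

section \<open>Generalized quadrangles as set systems\<close>

text \<open>The obstacle is that \<open>a\<close> lives on the subquadrangle, so a translation of
  the big quadrangle cannot be conjugated by it. A symmetry about a line of the subquadrangle can:
  its conjugate is known there, and an axis supplies an ambient symmetry inducing it. As
  \<open>L\<close> is fixed, symmetries about \<open>L\<close> are matched with symmetries about
  \<open>L\<close> again. A partner of a translation about \<open>p\<close> is found by prescribing
  its value at one point opposite \<open>a p\<close>. For the partner to be unique, its behaviour
  must be recorded at \<open>s + 2\<close> neighbours, one more than a triad has centres. The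
  subquadrangle offers \<open>s + 1\<close> lines through \<open>p\<close>, but \<open>L\<close> is
  lost, since a translation need not act on \<open>L\<close> like a symmetry about \<open>L\<close>.
  The missing two records come from one pair of twins, whose choices imply each other. Everything
  else is local: no point outside the subquadrangle is collinear with both of two twins, so
  collinearity with an image already chosen decides between the two candidates.\<close>

definition col :: "'p set set \<Rightarrow> 'p \<Rightarrow> 'p \<Rightarrow> bool" where
  "col B x y \<longleftrightarrow> (\<exists>l\<in>B. x \<in> l \<and> y \<in> l)"

definition join :: "'p set set \<Rightarrow> 'p \<Rightarrow> 'p \<Rightarrow> 'p set" where
  "join B x y = (THE l. l \<in> B \<and> x \<in> l \<and> y \<in> l)"

text \<open>The trace of a pair of points. Membership in the carrier is implied by
  \<open>col\<close> as soon as the lines lie in it.\<close>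

definition nbrs :: "'p set set \<Rightarrow> 'p \<Rightarrow> 'p \<Rightarrow> 'p set" where
  "nbrs B x y = {z. col B x z \<and> col B y z}"

lemma col_sym: "col B x y \<longleftrightarrow> col B y x"
  unfolding col_def by auto

text \<open>Lines are represented by their point sets, so that the lines of a subquadrangle are
  literally lines of the ambient quadrangle and maps act on lines by taking images.\<close>

locale quad =
  fixes P :: "'p set" and B :: "'p set set" and s t :: nat
  assumes fin: "finite P"
    and s2: "2 \<le> s" and t2: "2 \<le> t"
    and line_ex: "B \<noteq> {}"
    and line_sub: "l \<in> B \<Longrightarrow> l \<subseteq> P"
    and line_card: "l \<in> B \<Longrightarrow> card l = s + 1"
    and pt_card: "x \<in> P \<Longrightarrow> card {l \<in> B. x \<in> l} = t + 1"
    and line_eq: "\<lbrakk>l \<in> B; m \<in> B; x \<in> l; x \<in> m; y \<in> l; y \<in> m; x \<noteq> y\<rbrakk> \<Longrightarrow> l = m"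
    and proj_ex: "\<lbrakk>x \<in> P; l \<in> B; x \<notin> l\<rbrakk> \<Longrightarrow> \<exists>y\<in>l. col B x y"
    and proj_eq: "\<lbrakk>x \<in> P; l \<in> B; x \<notin> l; y \<in> l; z \<in> l; col B x y; col B x z\<rbrakk> \<Longrightarrow> y = z"
begin

abbreviation adj :: "'p \<Rightarrow> 'p \<Rightarrow> bool" (infix "\<sim>" 50) where "x \<sim> y \<equiv> col B x y"

lemma colI: "l \<in> B \<Longrightarrow> x \<in> l \<Longrightarrow> y \<in> l \<Longrightarrow> x \<sim> y"
  unfolding col_def by auto

lemma finB: "finite B"
  using fin line_sub by (meson finite_Pow_iff PowI finite_subset subsetI)

lemma fin_line: "l \<in> B \<Longrightarrow> finite l"
  using fin line_sub finite_subset by blast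

lemma col_in: "x \<sim> y \<Longrightarrow> x \<in> P" "x \<sim> y \<Longrightarrow> y \<in> P"
  unfolding col_def using line_sub by blast+

lemma line_through: assumes "x \<in> P" shows "\<exists>l\<in>B. x \<in> l"
proof -
  have "{l \<in> B. x \<in> l} \<noteq> {}" using pt_card[OF assms] by (metis card.empty add_eq_0_iff_both_eq_0 zero_neq_one)
  then show ?thesis by blast
qed

lemma col_refl: "x \<in> P \<Longrightarrow> x \<sim> x"
  using line_through unfolding col_def by blast

lemma join_eq: "\<lbrakk>l \<in> B; x \<in> l; y \<in> l; x \<noteq> y\<rbrakk> \<Longrightarrow> join B x y = l"
  unfolding join_def by (rule the_equality) (use line_eq in blast)+

lemma join: assumes "x \<sim> y" "x \<noteq> y"
  shows "join B x y \<in> B" "x \<in> join B x y" "y \<in> join B x y"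
proof -
  obtain l where "l \<in> B" "x \<in> l" "y \<in> l" using assms(1) unfolding col_def by blast
  then show "join B x y \<in> B" "x \<in> join B x y" "y \<in> join B x y" using join_eq assms(2) by auto
qed

text \<open>The absence of triangles, in the form in which \<open>proj_eq\<close> is mostly
  applied.\<close>

lemma triangle: assumes "l \<in> B" "x \<in> l" "y \<in> l" "x \<noteq> y" "z \<sim> x" "z \<sim> y" shows "z \<in> l"
  using proj_eq assms col_in by blast

lemma lines_meet: "\<lbrakk>l \<in> B; m \<in> B; l \<noteq> m; x \<in> l; x \<in> m; y \<in> l; y \<in> m\<rbrakk> \<Longrightarrow> x = y"
  using line_eq by blast

section \<open>Common neighbours, opposite points and triads: their numbers\<close>

lemma nbrs_in: "nbrs B x y \<subseteq> P"
  unfolding nbrs_def using col_in by blast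

lemma fin_nbrs: "finite (nbrs B x y)"
  using nbrs_in fin finite_subset by blast

lemma nbrs_indep: assumes "\<not> x \<sim> y" "u \<in> nbrs B x y" "v \<in> nbrs B x y" "u \<noteq> v" shows "\<not> u \<sim> v"
proof
  assume "u \<sim> v"
  then have j: "join B u v \<in> B" "u \<in> join B u v" "v \<in> join B u v" using join assms(4) by blast+
  have "x \<in> join B u v" "y \<in> join B u v"
    using triangle[OF j assms(4)] assms(2,3) unfolding nbrs_def by blast+
  then show False using j(1) assms(1) colI by blast
qed

lemma nbrs_neq: assumes "\<not> x \<sim> y" "u \<in> nbrs B x y" shows "u \<noteq> x" "u \<noteq> y"
  using assms unfolding nbrs_def using col_sym by fast+

text \<open>Each line through \<open>x\<close> carries exactly one point collinear with
  \<open>y\<close>, so common neighbours correspond to lines through \<open>x\<close>.\<close>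

lemma card_nbrs: assumes "x \<in> P" "y \<in> P" "\<not> x \<sim> y" shows "card (nbrs B x y) = t + 1"
proof -
  have "bij_betw (\<lambda>u. join B x u) (nbrs B x y) {l \<in> B. x \<in> l}"
    unfolding bij_betw_def
  proof
    show "inj_on (join B x) (nbrs B x y)"
    proof (rule inj_onI)
      fix u v assume uv: "u \<in> nbrs B x y" "v \<in> nbrs B x y" "join B x u = join B x v"
      have ne: "x \<noteq> u" "x \<noteq> v" using nbrs_neq assms(3) uv by blast+
      have "x \<sim> u" "x \<sim> v" using uv unfolding nbrs_def by auto
      then have "u \<sim> v" using join[of x u] join[of x v] ne uv(3) colI by metis
      then show "u = v" using nbrs_indep uv assms(3) by blast
    qed
    show "join B x ` nbrs B x y = {l \<in> B. x \<in> l}"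
    proof (intro equalityI subsetI)
      fix l assume "l \<in> join B x ` nbrs B x y"
      then obtain u where u: "u \<in> nbrs B x y" "l = join B x u" by blast
      then have "x \<sim> u" "x \<noteq> u" using nbrs_neq assms(3) unfolding nbrs_def by auto
      then show "l \<in> {l \<in> B. x \<in> l}" using join u by auto
    next
      fix l assume l: "l \<in> {l \<in> B. x \<in> l}"
      then have "y \<notin> l" using assms(3) colI by blast
      then obtain u where u: "u \<in> l" "y \<sim> u" using proj_ex l assms(2) by blast
      then have "u \<in> nbrs B x y" using l colI unfolding nbrs_def by blast
      moreover have "x \<noteq> u" using u assms(3) by (auto simp: col_sym)
      ultimately show "l \<in> join B x ` nbrs B x y" using join_eq[of l x u] l u by blast
    qed
  qed
  then show ?thesis using pt_card[OF assms(1)] bij_betw_same_card by metis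
qed

lemma card_line_minus: "l \<in> B \<Longrightarrow> x \<in> l \<Longrightarrow> card (l - {x}) = s"
  using line_card fin_line by auto

lemma card_on_lines:
  assumes "w \<in> P" "Ls \<subseteq> {l \<in> B. w \<in> l}"
  shows "card {z. z \<noteq> w \<and> (\<exists>l\<in>Ls. z \<in> l)} = card Ls * s"
proof -
  have "{z. z \<noteq> w \<and> (\<exists>l\<in>Ls. z \<in> l)} = (\<Union>l\<in>Ls. l - {w})" by blast
  also have "card \<dots> = (\<Sum>l\<in>Ls. card (l - {w}))"
  proof (rule card_UN_disjoint)
    show "finite Ls" using finite_subset[OF assms(2)] finB by simp
    show "\<forall>l\<in>Ls. finite (l - {w})" using assms(2) fin_line by blast
    show "\<forall>i\<in>Ls. \<forall>j\<in>Ls. i \<noteq> j \<longrightarrow> (i - {w}) \<inter> (j - {w}) = {}"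
      using assms(2) line_eq by blast
  qed
  also have "\<dots> = (\<Sum>l\<in>Ls. s)"
    using assms(2) card_line_minus by (intro sum.cong) auto
  finally show ?thesis by simp
qed

lemma card_col: assumes "w \<in> P" shows "card {z. z \<noteq> w \<and> w \<sim> z} = (t + 1) * s"
proof -
  have "{z. z \<noteq> w \<and> w \<sim> z} = {z. z \<noteq> w \<and> (\<exists>l\<in>{l\<in>B. w \<in> l}. z \<in> l)}"
    unfolding col_def by blast
  then show ?thesis using card_on_lines[OF assms subset_refl] pt_card[OF assms] by simp
qed

text \<open>For non-collinear \<open>x\<close>, \<open>y\<close> and a common neighbour \<open>w\<close>, the neighbours of \<open>w\<close> collinear
  with neither lie on the remaining \<open>t - 1\<close> lines through \<open>w\<close>.\<close>

lemma card_triads_through: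
  assumes "x \<in> P" "y \<in> P" "\<not> x \<sim> y" "w \<in> nbrs B x y"
  shows "card {z. w \<sim> z \<and> \<not> x \<sim> z \<and> \<not> y \<sim> z} = (t - 1) * s"
proof -
  have w: "w \<in> P" "x \<sim> w" "y \<sim> w" "x \<noteq> w" "y \<noteq> w" using assms nbrs_in nbrs_neq unfolding nbrs_def by blast+
  let ?Ls = "{l \<in> B. w \<in> l} - {join B x w, join B y w}"
  have j: "join B x w \<in> B" "w \<in> join B x w" "x \<in> join B x w" "join B y w \<in> B" "w \<in> join B y w" "y \<in> join B y w"
    using join w by auto
  have ne: "join B x w \<noteq> join B y w" using j assms(3) colI by metis
  have "card ?Ls = t + 1 - 2"
    using j ne pt_card[OF w(1)] finB by (subst card_Diff_subset) auto
  moreover have "{z. w \<sim> z \<and> \<not> x \<sim> z \<and> \<not> y \<sim> z} = {z. z \<noteq> w \<and> (\<exists>l\<in>?Ls. z \<in> l)}"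
  proof (intro equalityI subsetI)
    fix z assume z: "z \<in> {z. w \<sim> z \<and> \<not> x \<sim> z \<and> \<not> y \<sim> z}"
    then obtain l where l: "l \<in> B" "w \<in> l" "z \<in> l" unfolding col_def by blast
    have "l \<noteq> join B x w" "l \<noteq> join B y w" using l z j colI by blast+
    moreover have "z \<noteq> w" using z w by blast
    ultimately show "z \<in> {z. z \<noteq> w \<and> (\<exists>l\<in>?Ls. z \<in> l)}" using l by blast
  next
    fix z assume "z \<in> {z. z \<noteq> w \<and> (\<exists>l\<in>?Ls. z \<in> l)}"
    then obtain l where l: "z \<noteq> w" "l \<in> B" "w \<in> l" "z \<in> l" "l \<noteq> join B x w" "l \<noteq> join B y w" by blast
    have "\<not> x \<sim> z" using triangle[OF l(2,3,4), of x] l w join_eq[of l x w] by blast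
    moreover have "\<not> y \<sim> z" using triangle[OF l(2,3,4), of y] l w join_eq[of l y w] by blast
    ultimately show "z \<in> {z. w \<sim> z \<and> \<not> x \<sim> z \<and> \<not> y \<sim> z}" using l colI by blast
  qed
  ultimately show ?thesis using card_on_lines[OF w(1), of ?Ls] by auto
qed

text \<open>Double counting of collinear pairs \<open>(w, z)\<close> with \<open>w\<close> a
  neighbour of \<open>x\<close> and \<open>z\<close> opposite \<open>x\<close>: each
  \<open>z\<close> has \<open>t + 1\<close> such \<open>w\<close>, and each of the
  \<open>(t + 1) * s\<close> points \<open>w\<close> has \<open>t * s\<close> such
  \<open>z\<close>.\<close>

lemma card_nonnbrs: assumes "x \<in> P" shows "card {z \<in> P. \<not> x \<sim> z} = s * s * t"
proof -
  let ?W = "{w. w \<noteq> x \<and> x \<sim> w}" and ?Z = "{z \<in> P. \<not> x \<sim> z}"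
  have fW: "finite ?W" using fin col_in(2) by (rule_tac finite_subset[of _ P]) auto
  have "(\<Sum>z\<in>?Z. card {w \<in> ?W. w \<sim> z}) = (\<Sum>w\<in>?W. card {z \<in> ?Z. w \<sim> z})"
    using sum_multicount_gen[of ?Z ?W "\<lambda>z w. w \<sim> z" "\<lambda>w. card {z \<in> ?Z. w \<sim> z}"] fin fW by auto
  moreover have "card {w \<in> ?W. w \<sim> z} = t + 1" if "z \<in> ?Z" for z
  proof -
    have "{w \<in> ?W. w \<sim> z} = nbrs B x z"
      using that unfolding nbrs_def by (auto simp: col_sym)
    then show ?thesis using card_nbrs assms that by auto
  qed
  moreover have "card {z \<in> ?Z. w \<sim> z} = t * s" if w: "w \<in> ?W" for w
  proof -
    have wP: "w \<in> P" using w col_in by blast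
    have j: "join B x w \<in> B" "w \<in> join B x w" "x \<in> join B x w" using join w by auto
    let ?Ls = "{l \<in> B. w \<in> l} - {join B x w}"
    have "{z \<in> ?Z. w \<sim> z} = {z. z \<noteq> w \<and> (\<exists>l\<in>?Ls. z \<in> l)}"
    proof (intro equalityI subsetI)
      fix z assume z: "z \<in> {z \<in> ?Z. w \<sim> z}"
      then obtain l where l: "l \<in> B" "w \<in> l" "z \<in> l" unfolding col_def by blast
      have "l \<noteq> join B x w" using l z j colI by blast
      moreover have "z \<noteq> w" using z w by blast
      ultimately show "z \<in> {z. z \<noteq> w \<and> (\<exists>l\<in>?Ls. z \<in> l)}" using l by blast
    next
      fix z assume "z \<in> {z. z \<noteq> w \<and> (\<exists>l\<in>?Ls. z \<in> l)}"
      then obtain l where l: "z \<noteq> w" "l \<in> B" "w \<in> l" "z \<in> l" "l \<noteq> join B x w" by blast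
      have "\<not> x \<sim> z" using triangle[OF l(2,3,4), of x] l w join_eq[of l x w] by blast
      then show "z \<in> {z \<in> ?Z. w \<sim> z}" using l colI line_sub by blast
    qed
    moreover have "card ?Ls = t" using j pt_card[OF wP] finB by auto
    ultimately show ?thesis using card_on_lines[OF wP, of ?Ls] by auto
  qed
  ultimately have "card ?Z * (t + 1) = (t + 1) * s * (t * s)"
    using card_col[OF assms] by simp
  then have "(t + 1) * card ?Z = (t + 1) * (s * s * t)" by (simp add: algebra_simps)
  then show ?thesis by (metis mult_cancel1 add_is_0 one_neq_zero)
qed

text \<open>From the \<open>s * s * t\<close> points opposite \<open>x\<close> one removes the
  neighbours of \<open>y\<close> (with \<open>y\<close> itself) that are not common neighbours.
  Stating it over the integers avoids truncated subtraction.\<close>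

lemma card_triads:
  assumes "x \<in> P" "y \<in> P" "\<not> x \<sim> y"
  shows "int (card {z \<in> P. \<not> x \<sim> z \<and> \<not> y \<sim> z}) = int s * int s * int t - int s * int t - int s + int t"
proof -
  let ?N = "{z \<in> P. \<not> x \<sim> z}" and ?D = "{z. y \<sim> z}"
  have fD: "finite ?D" using fin col_in(2) by (rule_tac finite_subset[of _ P]) auto
  have D: "card ?D = 1 + (t + 1) * s"
  proof -
    have "?D = insert y {z. z \<noteq> y \<and> y \<sim> z}" using col_refl assms by auto
    then show ?thesis using card_col[OF assms(2)] fD by (simp add: finite_subset)
  qed
  have "card (?D - nbrs B x y) = card ?D - card (nbrs B x y)"
    using fD by (intro card_Diff_subset) (auto simp: nbrs_def fin_nbrs[unfolded nbrs_def])
  then have a: "int (card (?D - nbrs B x y)) = int (1 + (t + 1) * s - (t + 1))"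
    using D card_nbrs[OF assms] s2 by auto
  have "?D - nbrs B x y \<subseteq> ?N" using col_in unfolding nbrs_def by blast
  then have "card (?N - (?D - nbrs B x y)) = card ?N - card (?D - nbrs B x y)" 
    "card (?D - nbrs B x y) \<le> card ?N"
    using fin fD by (auto intro!: card_Diff_subset card_mono)
  moreover have "?N - (?D - nbrs B x y) = {z \<in> P. \<not> x \<sim> z \<and> \<not> y \<sim> z}"
    unfolding nbrs_def by blast
  ultimately have "int (card {z \<in> P. \<not> x \<sim> z \<and> \<not> y \<sim> z}) = int (card ?N) - int (card (?D - nbrs B x y))"
    by simp
  moreover have "int (1 + (t + 1) * s - (t + 1)) = 1 + (int t + 1) * int s - (int t + 1)"
  proof -
    have "(t + 1) * 1 \<le> (t + 1) * s" using s2 by (intro mult_le_mono) auto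
    then have "t + 1 \<le> 1 + (t + 1) * s" unfolding mult_1_right by (rule trans_le_add2)
    then show ?thesis by (subst of_nat_diff) (auto simp: algebra_simps)
  qed
  ultimately show ?thesis using a card_nonnbrs[OF assms(1)] by (simp add: algebra_simps)
qed

end

text \<open>The square counts ordered pairs \<open>(v, w)\<close> related to \<open>z\<close>;
  exchanging the sums counts by pairs first.\<close>

lemma sum_square_card:
  assumes "finite Z" "finite C"
  shows "(\<Sum>z\<in>Z. (card {w\<in>C. R w z})^2) = (\<Sum>v\<in>C. \<Sum>w\<in>C. card {z\<in>Z. R v z \<and> R w z})"
proof -
  have e: "card {w\<in>C. R w z} = (\<Sum>w\<in>C. of_bool (R w z))" for z
    using assms by (simp add: Int_def)
  have f: "card {z\<in>Z. R v z \<and> R w z} = (\<Sum>z\<in>Z. of_bool (R v z) * of_bool (R w z))" for v w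
    using assms by (simp add: Int_def of_bool_conj[symmetric])
  show ?thesis unfolding e f power2_eq_square sum_product
    by (subst sum.swap) (rule sum.cong[OF refl], subst sum.swap, rule refl)
qed

section \<open>Quadrangles of order \<open>(s, s^2)\<close>: centres of triads\<close>

locale quad_sq = quad P B s "s^2" for P :: "'p set" and B s
begin

text \<open>Second moment argument: the numbers of centres of the triads on \<open>x\<close>, \<open>y\<close> have variance zero.\<close>

theorem card_centres:
  assumes "x \<in> P" "y \<in> P" "z \<in> P" "\<not> x \<sim> y" "\<not> x \<sim> z" "\<not> y \<sim> z"
  shows "card {w \<in> nbrs B x y. w \<sim> z} = s + 1"
proof -
  let ?C = "nbrs B x y" and ?Z = "{z \<in> P. \<not> x \<sim> z \<and> \<not> y \<sim> z}" and ?t = "s^2"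
  define f where "f z = card {w\<in>?C. w \<sim> z}" for z
  have fC: "finite ?C" by (rule fin_nbrs)
  have fZ: "finite ?Z" using fin by simp
  have cC: "card ?C = ?t + 1" using card_nbrs assms by blast
  have one: "card {z\<in>?Z. w \<sim> z} = (?t - 1) * s" if "w \<in> ?C" for w
  proof -
    have "{z\<in>?Z. w \<sim> z} = {z. w \<sim> z \<and> \<not> x \<sim> z \<and> \<not> y \<sim> z}" using col_in by blast
    then show ?thesis using card_triads_through[OF assms(1,2,4) that] by simp
  qed
  \<comment> \<open>\<open>v\<close> and \<open>w\<close> are not collinear; their
    \<open>t + 1\<close> common neighbours are \<open>x\<close>, \<open>y\<close> and the points
    counted here.\<close>
  have two: "card {z\<in>?Z. v \<sim> z \<and> w \<sim> z} = ?t - 1" if vw: "v \<in> ?C" "w \<in> ?C" "v \<noteq> w" for v w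
  proof -
    have nc: "\<not> v \<sim> w" using nbrs_indep assms(4) vw by blast
    have xy: "{x, y} \<subseteq> nbrs B v w" using vw unfolding nbrs_def by (auto simp: col_sym)
    have "x \<noteq> y" using assms col_refl by blast
    have "{z\<in>?Z. v \<sim> z \<and> w \<sim> z} = nbrs B v w - {x, y}"
    proof (intro equalityI subsetI)
      fix z assume "z \<in> {z\<in>?Z. v \<sim> z \<and> w \<sim> z}"
      then show "z \<in> nbrs B v w - {x, y}" using assms col_refl unfolding nbrs_def by auto
    next
      fix z assume z: "z \<in> nbrs B v w - {x, y}"
      then have "\<not> x \<sim> z" "\<not> y \<sim> z" using nbrs_indep[OF nc, of _ z] xy by auto
      then show "z \<in> {z\<in>?Z. v \<sim> z \<and> w \<sim> z}" using z nbrs_in unfolding nbrs_def by blast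
    qed
    moreover have "card (nbrs B v w) = ?t + 1" using card_nbrs nc vw nbrs_in by blast
    ultimately show ?thesis using xy \<open>x \<noteq> y\<close> fin_nbrs by (simp add: card_Diff_subset)
  qed
  have S1: "(\<Sum>z\<in>?Z. f z) = (?t + 1) * ((?t - 1) * s)"
  proof -
    have "(\<Sum>z\<in>?Z. f z) = (\<Sum>w\<in>?C. card {z\<in>?Z. w \<sim> z})"
      unfolding f_def using sum_multicount_gen[of ?Z ?C "\<lambda>z w. w \<sim> z" "\<lambda>w. card {z \<in> ?Z. w \<sim> z}"] fZ fC by auto
    then show ?thesis using one cC by simp
  qed
  have S2: "(\<Sum>z\<in>?Z. (f z)^2) = (?t + 1) * ((?t - 1) * s + ?t * (?t - 1))"
  proof -
    have "(\<Sum>w\<in>?C. card {z\<in>?Z. v \<sim> z \<and> w \<sim> z}) = (?t - 1) * s + ?t * (?t - 1)" if v: "v \<in> ?C" for v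
    proof -
      have "(\<Sum>w\<in>?C. card {z\<in>?Z. v \<sim> z \<and> w \<sim> z})
          = card {z\<in>?Z. v \<sim> z \<and> v \<sim> z} + (\<Sum>w\<in>?C-{v}. card {z\<in>?Z. v \<sim> z \<and> w \<sim> z})"
        by (rule sum.remove[OF fC v])
      also have "\<dots> = (?t - 1) * s + (\<Sum>w\<in>?C-{v}. ?t - 1)"
      proof -
        have "(\<Sum>w\<in>?C-{v}. card {z\<in>?Z. v \<sim> z \<and> w \<sim> z}) = (\<Sum>w\<in>?C-{v}. ?t - 1)"
          by (rule sum.cong[OF refl], rule two[OF v]) auto
        then show ?thesis using one[OF v] by simp
      qed
      finally show ?thesis using cC v fC by simp
    qed
    then show ?thesis unfolding f_def sum_square_card[OF fZ fC] using cC by simp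
  qed
  have tpos: "1 \<le> ?t" using t2 by simp
  have i1: "(\<Sum>z\<in>?Z. int (f z)) = (int ?t + 1) * ((int ?t - 1) * int s)"
    unfolding of_nat_sum[symmetric] S1 using tpos by (simp only: of_nat_diff of_nat_mult of_nat_add of_nat_1)
  have i2: "(\<Sum>z\<in>?Z. (int (f z))^2) = (int ?t + 1) * ((int ?t - 1) * int s + int ?t * (int ?t - 1))"
    unfolding of_nat_power[symmetric] of_nat_sum[symmetric] S2 using tpos by (simp only: of_nat_diff of_nat_mult of_nat_add of_nat_1)
  have "(\<Sum>z\<in>?Z. (int (f z) - (int s + 1))^2)
      = (\<Sum>z\<in>?Z. (int (f z))^2 - 2 * (int s + 1) * int (f z) + (int s + 1)^2)"
    by (intro sum.cong refl) (simp add: power2_eq_square algebra_simps)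
  also have "\<dots> = (\<Sum>z\<in>?Z. (int (f z))^2) - 2 * (int s + 1) * (\<Sum>z\<in>?Z. int (f z)) + int (card ?Z) * (int s + 1)^2"
    by (simp add: sum.distrib sum_subtractf sum_distrib_left)
  \<comment> \<open>The polynomial vanishes because \<open>?t\<close> is \<open>s^2\<close>.\<close>
  also have "\<dots> = 0"
    unfolding i1 i2 card_triads[OF assms(1,2,4)] by (simp add: power2_eq_square algebra_simps)
  finally have "(\<Sum>z\<in>?Z. (int (f z) - (int s + 1))^2) = 0" .
  then have "\<forall>z\<in>?Z. (int (f z) - (int s + 1))^2 = 0"
    using sum_nonneg_eq_0_iff[OF fZ, of "\<lambda>z. (int (f z) - (int s + 1))^2"] by auto
  then have "int (f z) - (int s + 1) = 0" using assms by auto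
  then show ?thesis unfolding f_def by linarith
qed

end

section \<open>Automorphisms and symmetries\<close>

context quad
begin

text \<open>\<open>permutes\<close> makes the map the identity off \<open>P\<close>, so
  automorphisms compose and invert as plain functions. The action on lines is recovered in
  \<open>aut_line\<close>.\<close>

definition aut :: "('p \<Rightarrow> 'p) \<Rightarrow> bool" where
  "aut f \<longleftrightarrow> f permutes P \<and> (\<forall>x y. x \<sim> y \<longrightarrow> f x \<sim> f y)"

lemma aut_bij: "aut f \<Longrightarrow> bij f" "aut f \<Longrightarrow> inj f" "aut f \<Longrightarrow> f permutes P"
  unfolding aut_def by (auto simp: permutes_bij permutes_inj)

lemma aut_in: "aut f \<Longrightarrow> f x \<in> P \<longleftrightarrow> x \<in> P"
  unfolding aut_def by (simp add: permutes_in_image)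

lemma aut_eq: "aut f \<Longrightarrow> f x = f y \<longleftrightarrow> x = y"
  using aut_bij(2) by (simp add: inj_eq)

text \<open>By finiteness, preserving collinearity in one direction suffices.\<close>

lemma aut_col: assumes "aut f" shows "f x \<sim> f y \<longleftrightarrow> x \<sim> y"
proof
  let ?R = "{(x, y). x \<sim> y}"
  have "?R \<subseteq> P \<times> P" using col_in by blast
  then have fR: "finite ?R" using fin finite_subset by blast
  have "map_prod f f ` ?R \<subseteq> ?R" using assms unfolding aut_def by auto
  moreover have "inj_on (map_prod f f) ?R"
    using aut_bij(2)[OF assms] prod.inj_map[of f f] inj_on_subset by blast
  ultimately have R: "map_prod f f ` ?R = ?R" using endo_inj_surj fR by blast
  assume "f x \<sim> f y"
  then have "(f x, f y) \<in> map_prod f f ` ?R" using R by blast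
  then show "x \<sim> y" using aut_eq[OF assms] by auto
next
  show "x \<sim> y \<Longrightarrow> f x \<sim> f y" using assms unfolding aut_def by blast
qed

lemma aut_comp: "aut f \<Longrightarrow> aut g \<Longrightarrow> aut (f \<circ> g)"
  unfolding aut_def by (auto intro: permutes_compose)

lemma aut_id: "aut id"
  unfolding aut_def by (auto intro: permutes_id)

lemma aut_inv_simp: "aut f \<Longrightarrow> f (inv f x) = x" "aut f \<Longrightarrow> inv f (f x) = x"
  using permutes_inverses unfolding aut_def by metis+

lemma aut_inv: assumes "aut f" shows "aut (inv f)"
  unfolding aut_def
proof (intro conjI allI impI)
  show "inv f permutes P" using assms permutes_inv unfolding aut_def by blast
  fix x y assume "x \<sim> y"
  then show "inv f x \<sim> inv f y" using aut_col[OF assms, of "inv f x" "inv f y"] aut_inv_simp[OF assms] by simp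
qed

lemma line_two: assumes "l \<in> B" obtains x y where "x \<in> l" "y \<in> l" "x \<noteq> y"
proof -
  have "\<not> card l \<le> Suc 0" using line_card[OF assms] s2 by simp
  then show ?thesis using that by (metis assms card_le_Suc0_iff_eq fin_line)
qed

lemma line_other: assumes "l \<in> B" obtains y where "y \<in> l" "y \<noteq> x"
  using line_two[OF assms] by metis

text \<open>The images of two points of \<open>l\<close> span a line, the triangle property puts all
  other images on it, and the cardinalities agree.\<close>

lemma aut_line: assumes "aut f" "l \<in> B" shows "f ` l \<in> B"
proof -
  obtain x y where xy: "x \<in> l" "y \<in> l" "x \<noteq> y" using line_two[OF assms(2)] .
  have "f x \<sim> f y" using colI assms xy aut_col by blast
  moreover have ne: "f x \<noteq> f y" using xy assms aut_eq by blast
  ultimately have j: "join B (f x) (f y) \<in> B" "f x \<in> join B (f x) (f y)" "f y \<in> join B (f x) (f y)" using join by auto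
  have "f ` l \<subseteq> join B (f x) (f y)"
  proof
    fix v assume "v \<in> f ` l"
    then obtain u where u: "u \<in> l" "v = f u" by blast
    have "v \<sim> f x" "v \<sim> f y" using u xy assms aut_col colI by blast+
    then show "v \<in> join B (f x) (f y)" using triangle[OF j ne] by blast
  qed
  moreover have "card (f ` l) = card (join B (f x) (f y))"
    using line_card[OF j(1)] line_card[OF assms(2)] card_image[of f l] aut_bij(2)[OF assms(1)] inj_on_subset by auto
  ultimately show ?thesis using j(1) fin_line card_subset_eq by metis
qed

text \<open>Mapping each line meeting \<open>M\<close> into itself is enough, since finite lines are
  then mapped onto themselves.\<close>

definition symm :: "'p set \<Rightarrow> ('p \<Rightarrow> 'p) \<Rightarrow> bool" where
  "symm M \<theta> \<longleftrightarrow> aut \<theta> \<and> (\<forall>l\<in>B. l \<inter> M \<noteq> {} \<longrightarrow> (\<forall>x\<in>l. \<theta> x \<in> l))"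

lemma symm_aut: "symm M \<theta> \<Longrightarrow> aut \<theta>"
  unfolding symm_def by blast

lemma symm_line: "symm M \<theta> \<Longrightarrow> l \<in> B \<Longrightarrow> y \<in> l \<Longrightarrow> y \<in> M \<Longrightarrow> x \<in> l \<Longrightarrow> \<theta> x \<in> l"
  unfolding symm_def by blast

lemma symm_comp: "symm M f \<Longrightarrow> symm M g \<Longrightarrow> symm M (f \<circ> g)"
  unfolding symm_def using aut_comp by auto

lemma symm_inv: assumes "symm M f" shows "symm M (inv f)"
  unfolding symm_def
proof (intro conjI ballI impI)
  show "aut (inv f)" using assms symm_aut aut_inv by blast
  fix l x assume l: "l \<in> B" "l \<inter> M \<noteq> {}" "x \<in> l"
  have "f ` l \<subseteq> l" using assms l unfolding symm_def by blast
  moreover have "inj_on f l" using assms symm_aut aut_bij(2) inj_on_subset by blast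
  ultimately have "f ` l = l" using endo_inj_surj fin_line l by blast
  then obtain y where "y \<in> l" "x = f y" using l by blast
  then show "inv f x \<in> l" using aut_inv_simp symm_aut assms by metis
qed

section \<open>Rigidity and commutation of symmetries\<close>

lemma other_line: assumes "x \<in> P" obtains m where "m \<in> B" "x \<in> m" "m \<noteq> l" "m \<noteq> k"
proof -
  have "card {m \<in> B. x \<in> m} > card {l, k}"
    using pt_card[OF assms] t2 card_insert_le_m1[of 2 "{k}" l] by (simp add: card_insert_if)
  then have "\<not> {m \<in> B. x \<in> m} \<subseteq> {l, k}" using card_mono[of "{l, k}"] by (metis finite.emptyI finite_insert not_le)
  then show ?thesis using that by blast
qed

lemma meet_line: assumes "k \<in> P" "M \<in> B" "k \<notin> M"
  shows "\<exists>l y. l \<in> B \<and> k \<in> l \<and> y \<in> l \<and> y \<in> M \<and>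
    (\<forall>m z. m \<in> B \<longrightarrow> k \<in> m \<longrightarrow> z \<in> m \<longrightarrow> z \<in> M \<longrightarrow> m = l)"
proof -
  obtain y where y: "y \<in> M" "k \<sim> y" using proj_ex assms by blast
  then obtain l where l: "l \<in> B" "k \<in> l" "y \<in> l" unfolding col_def by blast
  show ?thesis
  proof (intro exI conjI allI impI)
    show "l \<in> B" "k \<in> l" "y \<in> l" "y \<in> M" by fact+
    fix m z assume m: "m \<in> B" "k \<in> m" "z \<in> m" "z \<in> M"
    then have "z = y" using proj_eq[OF assms] y colI by blast
    moreover have "k \<noteq> y" using y assms by blast
    ultimately show "m = l" using line_eq[OF m(1) l(1)] m l by blast
  qed
qed

text \<open>The image of a point \<open>z\<close> lies on the line through \<open>z\<close> meeting \<open>M\<close> and is collinear with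
  every fixed point that is collinear with \<open>z\<close>.\<close>

lemma fix_all:
  assumes M: "M \<in> B" and col: "\<And>x y. x \<sim> y \<Longrightarrow> \<theta> x \<sim> \<theta> y"
    and lines: "\<And>l x y. l \<in> B \<Longrightarrow> y \<in> l \<Longrightarrow> y \<in> M \<Longrightarrow> x \<in> l \<Longrightarrow> \<theta> x \<in> l"
    and k: "k \<in> P" "k \<notin> M" "\<theta> k = k" and z: "z \<in> P"
  shows "\<theta> z = z"
proof -
  have step1: "\<theta> w = w" if h: "h \<in> P" "h \<notin> M" "\<theta> h = h" and w: "w \<in> P" "w \<notin> M" "w \<sim> h"
    and off: "\<And>l y. l \<in> B \<Longrightarrow> h \<in> l \<Longrightarrow> y \<in> l \<Longrightarrow> y \<in> M \<Longrightarrow> w \<notin> l" for h w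
  proof -
    obtain l y where l: "l \<in> B" "w \<in> l" "y \<in> l" "y \<in> M" using meet_line[OF w(1) M w(2)] by blast
    then have "h \<notin> l" using off by blast
    moreover have "\<theta> w \<in> l" using lines l by blast
    moreover have "h \<sim> \<theta> w" using col[OF w(3)] h col_sym by metis
    ultimately show ?thesis using proj_eq[OF h(1) l(1)] l(2) w(3) col_sym by metis
  qed
  have step2: "\<theta> w = w" if h: "h \<in> P" "h \<notin> M" "\<theta> h = h" and w: "w \<in> P" "w \<notin> M" "\<not> w \<sim> h" for h w
  proof -
    obtain l y where l: "l \<in> B" "h \<in> l" "y \<in> l" "y \<in> M"
      and lu: "\<forall>m z. m \<in> B \<longrightarrow> h \<in> m \<longrightarrow> z \<in> m \<longrightarrow> z \<in> M \<longrightarrow> m = l" using meet_line[OF h(1) M h(2)] by blast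
    obtain k y' where k: "k \<in> B" "w \<in> k" "y' \<in> k" "y' \<in> M"
      and ku: "\<forall>m z. m \<in> B \<longrightarrow> w \<in> m \<longrightarrow> z \<in> m \<longrightarrow> z \<in> M \<longrightarrow> m = k" using meet_line[OF w(1) M w(2)] by blast
    have hk: "h \<notin> k" using k w colI by blast
    then obtain v where v: "v \<in> k" "h \<sim> v" using proj_ex h k by blast
    have "v \<noteq> h" using v hk by blast
    \<comment> \<open>This line avoids both the line from \<open>h\<close> to \<open>M\<close> and
      the line from \<open>h\<close> to the line \<open>k\<close>. Its point \<open>u\<close>
      collinear with \<open>w\<close> is then off \<open>l\<close> and off \<open>k\<close>, so
      \<open>step1\<close> carries fixedness from \<open>h\<close> to \<open>u\<close> and from
      \<open>u\<close> to \<open>w\<close>.\<close>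
    obtain m where m: "m \<in> B" "h \<in> m" "m \<noteq> l" "m \<noteq> join B h v" using other_line[OF h(1)] .
    have "w \<notin> m" using m w colI by blast
    then obtain u where u: "u \<in> m" "w \<sim> u" using proj_ex w m by blast
    have "u \<noteq> h" using u w col_sym by metis
    have uM: "u \<notin> M" using lu m u by blast
    have ul: "u \<notin> l" using m u l line_eq \<open>u \<noteq> h\<close> by blast
    have "u \<notin> k"
    proof
      assume uk: "u \<in> k"
      have "u \<sim> h" "v \<sim> h" using m u v colI col_sym by metis+
      then have "u = v" using proj_eq[OF h(1) k(1) hk uk v(1)] col_sym by metis
      then show False using m u join_eq[of m h v] \<open>v \<noteq> h\<close> by blast
    qed
    have uP: "u \<in> P" using u col_in by blast
    have "\<theta> u = u" using step1[OF h uP uM] m u colI ul lu by blast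
    then show ?thesis using step1[OF uP uM _ w(1,2) u(2)] \<open>u \<notin> k\<close> ku by metis
  qed
  have off: "\<theta> w = w" if w: "w \<in> P" "w \<notin> M" for w
  proof -
    obtain l y where l: "l \<in> B" "k \<in> l" "y \<in> l" "y \<in> M"
      and lu: "\<forall>m z. m \<in> B \<longrightarrow> k \<in> m \<longrightarrow> z \<in> m \<longrightarrow> z \<in> M \<longrightarrow> m = l" using meet_line[OF k(1) M k(2)] by blast
    consider "\<not> w \<sim> k" | "w \<sim> k" "w \<notin> l" | "w = k" | "w \<in> l" "w \<noteq> k" by blast
    then show ?thesis
    proof cases
      case 1 then show ?thesis using step2 k w by blast
    next
      case 2 then show ?thesis using step1[OF k w] lu by blast
    next
      case 3 then show ?thesis using k by blast
    next
      case 4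
      \<comment> \<open>A detour: a point \<open>u\<close> on another line through \<open>k\<close>
        is fixed by \<open>step1\<close> and is not collinear with \<open>w\<close>, so
        \<open>step2\<close> applies.\<close>
      obtain m where m: "m \<in> B" "k \<in> m" "m \<noteq> l" using other_line[OF k(1)] .
      obtain u where u: "u \<in> m" "u \<noteq> k" using line_other[OF m(1)] .
      have uP: "u \<in> P" using u m line_sub by blast
      have uM: "u \<notin> M" using lu m u by blast
      have ul: "u \<notin> l" using m u l line_eq by blast
      have "\<theta> u = u" using step1[OF k uP uM] m u colI ul lu by blast
      moreover have "\<not> w \<sim> u"
      proof
        assume "w \<sim> u"
        moreover have "k \<sim> u" using m u colI by blast
        ultimately have "u \<in> l" using triangle[OF l(1), of w k u] 4 l col_sym by metis
        then show False using ul by blast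
      qed
      ultimately show ?thesis using step2[OF uP uM _ w] by blast
    qed
  qed
  show ?thesis
  proof (cases "z \<in> M")
    case True
    obtain m where m: "m \<in> B" "z \<in> m" "m \<noteq> M" using other_line[OF z] .
    have "\<theta> z \<in> m" "\<theta> z \<in> M" using lines m True M by blast+
    then show ?thesis using m True M line_eq by blast
  qed (use off z in blast)
qed

text \<open>Symmetries about \<open>M\<close> act freely off \<open>M\<close>. This lets a symmetry
  be identified from its value at a single point, as in \<open>symm_agree\<close>.\<close>

lemma symm_fix: assumes "M \<in> B" "symm M \<theta>" "k \<in> P" "k \<notin> M" "\<theta> k = k" shows "\<theta> = id"
proof
  fix z
  show "\<theta> z = id z"
  proof (cases "z \<in> P")
    case True
    have "\<theta> z = z" 
      using fix_all[OF assms(1), of \<theta> k z] aut_col[OF symm_aut[OF assms(2)]] symm_line[OF assms(2)] assms(3-5) True by blast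
    then show ?thesis by simp
  next
    case False then show ?thesis using assms(2) symm_aut aut_bij(3) permutes_not_in by fastforce
  qed
qed

lemma symm_agree: assumes "M \<in> B" "symm M f" "symm M g" "k \<in> P" "k \<notin> M" "f k = g k" shows "f = g"
proof -
  have "inv g \<circ> f = id" using symm_fix[OF assms(1) symm_comp[OF symm_inv[OF assms(3)] assms(2)] assms(4,5)]
      assms(6) aut_inv_simp(2)[OF symm_aut[OF assms(3)]] by simp
  then have "inv g (f x) = x" for x by (metis comp_apply id_apply)
  then have "f x = g x" for x using aut_inv_simp(1)[OF symm_aut[OF assms(3)]] by metis
  then show ?thesis by blast
qed

lemma symm_line_iff: assumes "symm M f" "l \<in> B" "y \<in> l" "y \<in> M" shows "f x \<in> l \<longleftrightarrow> x \<in> l"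
  using symm_line[OF assms] symm_line[OF symm_inv[OF assms(1)] assms(2-4)] 
    aut_inv_simp(2)[OF symm_aut[OF assms(1)]] by metis

text \<open>The commutator is a symmetry about both lines.\<close>

lemma symm_commute:
  assumes M: "M \<in> B" "N \<in> B" "M \<noteq> N" "p \<in> M" "p \<in> N" and f: "symm M f" and g: "symm N g"
  shows "f \<circ> g = g \<circ> f"
proof -
  have conj: "symm M (g \<circ> f \<circ> inv g)" 
    if MN: "M \<in> B" "N \<in> B" "p \<in> M" "p \<in> N" and f: "symm M f" and g: "symm N g" for M N f g
    unfolding symm_def
  proof (intro conjI ballI impI)
    have ag: "aut g" using g symm_aut by blast
    show "aut (g \<circ> f \<circ> inv g)" by (intro aut_comp aut_inv symm_aut[OF f] ag)
    fix l x assume l: "l \<in> B" "l \<inter> M \<noteq> {}" "x \<in> l"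
    have gM: "inv g y \<in> M" if "y \<in> M" for y using symm_line[OF symm_inv[OF g] MN(1) MN(3) MN(4) that] .
    have il: "inv g ` l \<in> B" using aut_line[OF aut_inv[OF ag] l(1)] .
    obtain y where "y \<in> l" "y \<in> M" using l by blast
    then have "f (inv g x) \<in> inv g ` l" using symm_line[OF f il] gM l(3) by blast
    then show "(g \<circ> f \<circ> inv g) x \<in> l" using aut_inv_simp(1)[OF ag] by auto
  qed
  have pP: "p \<in> P" using M line_sub by blast
  have "card {z \<in> P. \<not> p \<sim> z} \<noteq> 0" using card_nonnbrs[OF pP] s2 t2 by simp
  then have "{z \<in> P. \<not> p \<sim> z} \<noteq> {}" by (metis card.empty)
  then obtain x where x: "x \<in> P" "\<not> p \<sim> x" by blast
  have xMN: "x \<notin> M" "x \<notin> N" using x M colI by blast+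
  let ?c = "f \<circ> (g \<circ> inv f \<circ> inv g)"
  have c: "?c = (f \<circ> g \<circ> inv f) \<circ> inv g" by auto
  have cM: "symm M ?c" using symm_comp[OF f conj[OF M(1,2,4,5) symm_inv[OF f] g]] .
  have cN: "symm N ?c" unfolding c using symm_comp[OF conj[OF M(2,1,5,4) g f] symm_inv[OF g]] .
  obtain l y where l: "l \<in> B" "x \<in> l" "y \<in> l" "y \<in> M" using meet_line[OF x(1) M(1) xMN(1)] by blast
  obtain k y' where k: "k \<in> B" "x \<in> k" "y' \<in> k" "y' \<in> N" using meet_line[OF x(1) M(2) xMN(2)] by blast
  \<comment> \<open>A single line meeting \<open>M\<close> and \<open>N\<close> away from
    \<open>p\<close> would form a triangle with them. Hence \<open>x\<close> is the only point
    common to the preserved lines \<open>l\<close> and \<open>k\<close>.\<close>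
  have "l \<noteq> k"
  proof
    assume "l = k"
    moreover have "p \<notin> l" using l x colI by blast
    ultimately have "y = y'" using proj_eq[OF pP l(1)] l k M colI by blast
    then have "y = p" using lines_meet[OF M(1,2,3)] l k M by blast
    then show False using l \<open>p \<notin> l\<close> by blast
  qed
  moreover have "?c x \<in> l" using symm_line[OF cM l(1,3,4,2)] .
  moreover have "?c x \<in> k" using symm_line[OF cN k(1,3,4,2)] .
  ultimately have "?c x = x" using lines_meet[OF l(1) k(1)] l k by blast
  then have "?c = id" using symm_fix[OF M(1) cM x(1) xMN(1)] by blast
  then have e: "f (g (inv f (inv g y))) = y" for y by (metis comp_apply id_apply)
  have "f (g y) = g (f y)" for y using e[of "g (f y)"] aut_inv_simp f g symm_aut by metis
  then show ?thesis by auto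
qed

text \<open>Transitivity on the points off \<open>M\<close> of each line meeting \<open>M\<close>
  replaces the group order; \<open>axis_of_symmetry_axis\<close> obtains it by counting.\<close>

definition axis :: "'p set \<Rightarrow> bool" where
  "axis M \<longleftrightarrow> M \<in> B \<and> (\<forall>l\<in>B. l \<noteq> M \<longrightarrow> l \<inter> M \<noteq> {} \<longrightarrow>
     (\<forall>x\<in>l - M. \<forall>y\<in>l - M. \<exists>\<theta>. symm M \<theta> \<and> \<theta> x = y))"

lemma axisE: assumes "axis M" "l \<in> B" "l \<noteq> M" "z \<in> l" "z \<in> M" "x \<in> l" "x \<notin> M" "y \<in> l" "y \<notin> M"
  obtains \<theta> where "symm M \<theta>" "\<theta> x = y"
  using assms unfolding axis_def by blast

end

section \<open>Translation points\<close>

context quad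
begin

text \<open>A point of \<open>M\<close> is the intersection of \<open>M\<close> with another line
  through it, and both lines are preserved.\<close>

lemma symm_on: assumes "symm M f" "M \<in> B" "x \<in> M" shows "f x = x"
proof -
  have xP: "x \<in> P" using assms line_sub by blast
  obtain m where m: "m \<in> B" "x \<in> m" "m \<noteq> M" using other_line[OF xP] .
  have "f x \<in> m" "f x \<in> M" using symm_line[OF assms(1) m(1,2) assms(3) m(2)]
      symm_line[OF assms(1,2,3,3,3)] by blast+
  then show ?thesis using m assms line_eq by blast
qed

lemma symm_off: assumes "symm M f" "M \<in> B" "x \<notin> M" shows "f x \<notin> M"
proof -
  obtain y where "y \<in> M" using line_two[OF assms(2)] by blast
  then show ?thesis using symm_line_iff[OF assms(1,2)] assms(3) by blast
qed

lemma symm_id: "symm M id"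
  unfolding symm_def using aut_id by auto

definition tpoint :: "'p \<Rightarrow> bool" where
  "tpoint p \<longleftrightarrow> p \<in> P \<and> (\<forall>M\<in>B. p \<in> M \<longrightarrow> axis M)"

text \<open>These maps play the role of the translation group about \<open>p\<close>; on each line through \<open>p\<close>
  other than \<open>L\<close> they act like symmetries about \<open>L\<close>.\<close>

definition transl :: "'p \<Rightarrow> 'p set \<Rightarrow> ('p \<Rightarrow> 'p) \<Rightarrow> bool" where
  "transl p L g \<longleftrightarrow> aut g \<and> (\<forall>N\<in>B. p \<in> N \<longrightarrow> (\<forall>x\<in>N. g x \<in> N)) \<and>
     (\<forall>N\<in>B. p \<in> N \<longrightarrow> N \<noteq> L \<longrightarrow> (\<exists>t. symm L t \<and> (\<forall>q\<in>N - {p}. g q = t q)))"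

lemma transl_aut: "transl p L g \<Longrightarrow> aut g"
  unfolding transl_def by blast

lemma transl_line: "transl p L g \<Longrightarrow> N \<in> B \<Longrightarrow> p \<in> N \<Longrightarrow> x \<in> N \<Longrightarrow> g x \<in> N"
  unfolding transl_def by blast

lemma transl_on: "transl p L g \<Longrightarrow> N \<in> B \<Longrightarrow> p \<in> N \<Longrightarrow> N \<noteq> L \<Longrightarrow> \<exists>t. symm L t \<and> (\<forall>q\<in>N - {p}. g q = t q)"
  unfolding transl_def by blast

lemma transl_fixes: assumes "transl p L g" "p \<in> P" shows "g p = p"
proof -
  obtain M where M: "M \<in> B" "p \<in> M" using line_through[OF assms(2)] by blast
  obtain m where m: "m \<in> B" "p \<in> m" "m \<noteq> M" using other_line[OF assms(2)] .
  have "g p \<in> m" "g p \<in> M" using transl_line[OF assms(1)] m M by blast+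
  then show ?thesis using m M line_eq by blast
qed

text \<open>The symmetry about \<open>L\<close> that \<open>g\<close> follows on \<open>N\<close> is
  determined by its value at \<open>n\<close>, by \<open>symm_agree\<close>.\<close>

lemma transl_acts:
  assumes "transl p L g" "L \<in> B" "p \<in> L" "N \<in> B" "p \<in> N" "N \<noteq> L" "n \<in> N" "n \<noteq> p" "symm L v" "g n = v n"
    and q: "q \<in> N" "q \<noteq> p"
  shows "g q = v q"
proof -
  obtain u where u: "symm L u" "\<forall>q\<in>N - {p}. g q = u q" using transl_on[OF assms(1,4-6)] by blast
  have "n \<notin> L" using assms lines_meet by blast
  moreover have "n \<in> P" using assms line_sub by blast
  moreover have "u n = v n" using u assms by auto
  ultimately have "u = v" using symm_agree[OF assms(2) u(1) assms(9)] by blast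
  then show ?thesis using u q by blast
qed

lemma transl_comp: assumes f: "transl p L f" and g: "transl p L g" and p: "p \<in> P" shows "transl p L (f \<circ> g)"
  unfolding transl_def
proof (intro conjI ballI impI)
  show "aut (f \<circ> g)" using aut_comp transl_aut f g by blast
  show "(f \<circ> g) x \<in> N" if "N \<in> B" "p \<in> N" "x \<in> N" for N x
    using transl_line[OF f] transl_line[OF g] that by simp
  fix N assume N: "N \<in> B" "p \<in> N" "N \<noteq> L"
  obtain t where t: "symm L t" "\<forall>q\<in>N - {p}. f q = t q" using transl_on[OF f N] by blast
  obtain u where u: "symm L u" "\<forall>q\<in>N - {p}. g q = u q" using transl_on[OF g N] by blast
  have "g q \<in> N - {p}" if "q \<in> N - {p}" for q
    using transl_line[OF g N(1,2)] that aut_eq[OF transl_aut[OF g], of q p] transl_fixes[OF g p] by auto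
  then have "\<forall>q\<in>N - {p}. (f \<circ> g) q = (t \<circ> u) q" using t u by auto
  then show "\<exists>t. symm L t \<and> (\<forall>q\<in>N - {p}. (f \<circ> g) q = t q)" using symm_comp[OF t(1) u(1)] by blast
qed

lemma transl_minus: assumes g: "transl p L g" and "p \<in> P" "N \<in> B" "p \<in> N"
  shows "g ` (N - {p}) = N - {p}"
proof (rule endo_inj_surj)
  show "finite (N - {p})" using fin_line assms by blast
  show "inj_on g (N - {p})" using aut_bij(2)[OF transl_aut[OF g]] inj_on_subset by blast
  show "g ` (N - {p}) \<subseteq> N - {p}"
  proof
    fix y assume "y \<in> g ` (N - {p})"
    then obtain x where x: "x \<in> N" "x \<noteq> p" "y = g x" by blast
    then show "y \<in> N - {p}"
      using transl_line[OF g assms(3,4) x(1)] aut_eq[OF transl_aut[OF g], of x p] transl_fixes[OF g assms(2)] by auto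
  qed
qed

lemma transl_inv: assumes g: "transl p L g" and p: "p \<in> P" shows "transl p L (inv g)"
  unfolding transl_def
proof (intro conjI ballI impI)
  have ag: "aut g" using transl_aut g by blast
  show "aut (inv g)" using aut_inv ag by blast
  show "inv g x \<in> N" if N: "N \<in> B" "p \<in> N" "x \<in> N" for N x
  proof (cases "x = p")
    case True
    then show ?thesis using transl_fixes[OF g p] aut_inv_simp(2)[OF ag] N by metis
  next
    case False
    then obtain y where "y \<in> N" "x = g y" using transl_minus[OF g p N(1,2)] N by blast
    then show ?thesis using aut_inv_simp(2)[OF ag] by simp
  qed
  fix N assume N: "N \<in> B" "p \<in> N" "N \<noteq> L"
  obtain t where t: "symm L t" "\<forall>q\<in>N - {p}. g q = t q"
    using transl_on[OF g N] by blast
  have "inv g q = inv t q" if "q \<in> N - {p}" for q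
  proof -
    obtain y where y: "y \<in> N - {p}" "q = g y" using transl_minus[OF g p N(1,2)] \<open>q \<in> N - {p}\<close> by blast
    then have "q = t y" using t by blast
    then show ?thesis using aut_inv_simp(2)[OF symm_aut[OF t(1)]] aut_inv_simp(2)[OF ag] y by metis
  qed
  then show "\<exists>t. symm L t \<and> (\<forall>q\<in>N - {p}. inv g q = t q)" using symm_inv[OF t(1)] by blast
qed

end

context quad_sq
begin

text \<open>A point lies on \<open>s^2 + 1 \<ge> 5\<close> lines. Listing the excluded lines bounds
  their number without any distinctness.\<close>

lemma new_line: assumes "x \<in> P" "length F \<le> 4"
  obtains m where "m \<in> B" "x \<in> m" "m \<notin> set F"
proof -
  have "2 * 2 \<le> s * s" using s2 mult_le_mono by blast
  then have "4 \<le> s^2" by (simp add: power2_eq_square)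
  then have "card {m \<in> B. x \<in> m} > card (set F)" using pt_card[OF assms(1)] assms(2) card_length[of F] by linarith
  then have "\<not> {m \<in> B. x \<in> m} \<subseteq> set F" using card_mono[of "set F"] by (metis List.finite_set not_le)
  then show ?thesis using that by blast
qed

text \<open>Two symmetries about \<open>L\<close> are matched on a line \<open>N\<close> by symmetries about two further lines
  through \<open>p\<close>, and those commute with each other and with the symmetries about \<open>L\<close>.\<close>

lemma symm_abelian:
  assumes tp: "tpoint p" and L: "L \<in> B" "p \<in> L" and f: "symm L f" and g: "symm L g"
  shows "f \<circ> g = g \<circ> f"
proof -
  have pP: "p \<in> P" using tp unfolding tpoint_def by blast
  obtain N where N: "N \<in> B" "p \<in> N" "N \<notin> {L}" using new_line[OF pP, of "[L]"] by auto
  obtain M where M: "M \<in> B" "p \<in> M" "M \<notin> {L, N}" using new_line[OF pP, of "[L, N]"] by auto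
  obtain K where K: "K \<in> B" "p \<in> K" "K \<notin> {L, N, M}" using new_line[OF pP, of "[L, N, M]"] by auto
  obtain n where n: "n \<in> N" "n \<noteq> p" using line_other[OF N(1)] .
  have nP: "n \<in> P" using n N line_sub by blast
  have offp: "x \<notin> R" if "x \<in> N" "x \<noteq> p" "R \<in> B" "p \<in> R" "R \<noteq> N" for x R
    using that lines_meet N by blast
  have on_N: "h n \<in> N" "h n \<noteq> p" if h: "symm L h" for h
  proof -
    show "h n \<in> N" using symm_line[OF h N(1,2) L(2) n(1)] .
    have "n \<notin> L" using offp n L N by blast
    then show "h n \<noteq> p" using symm_off[OF h L(1)] L by blast
  qed
  obtain \<theta> where th: "symm M \<theta>" "\<theta> n = f n"
    using axisE[of M N p n "f n"] tp M N n on_N[OF f] offp[of _ M] unfolding tpoint_def by blast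
  obtain \<psi> where ka: "symm K \<psi>" "\<psi> n = g n"
    using axisE[of K N p n "g n"] tp K N n on_N[OF g] offp[of _ K] unfolding tpoint_def by blast
  have ne: "M \<noteq> K" "M \<noteq> L" "K \<noteq> L" using M K by blast+
  have c1: "\<theta> (\<psi> x) = \<psi> (\<theta> x)" for x using fun_cong[OF symm_commute[OF M(1) K(1) ne(1) M(2) K(2) th(1) ka(1)], of x] by simp
  have c2: "\<theta> (g x) = g (\<theta> x)" for x using fun_cong[OF symm_commute[OF M(1) L(1) ne(2) M(2) L(2) th(1) g], of x] by simp
  have c3: "\<psi> (f x) = f (\<psi> x)" for x using fun_cong[OF symm_commute[OF K(1) L(1) ne(3) K(2) L(2) ka(1) f], of x] by simp
  \<comment> \<open>The chain is \<open>f (g n) = f (\<psi> n) = \<psi> (f n) = \<psi> (\<theta> n)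
    = \<theta> (\<psi> n) = \<theta> (g n) = g (\<theta> n) = g (f n)\<close>.\<close>
  have "(f \<circ> g) n = (g \<circ> f) n" using c1[of n] c2[of n] c3[of n] th ka by simp
  moreover have "n \<notin> L" using offp n L N by blast
  ultimately show ?thesis using symm_agree[OF L(1) symm_comp[OF f g] symm_comp[OF g f] nP] by blast
qed

text \<open>On \<open>M\<close> itself \<open>\<theta>\<close> is the identity. On another line
  \<open>N\<close>, write \<open>q = u n\<close> with \<open>u\<close> a symmetry about
  \<open>L\<close>: then \<open>\<theta> q = u (\<theta> n) = u (t n) = t q\<close>, where the last
  step is that symmetries about \<open>L\<close> commute with each other.\<close>

lemma symm_transl:
  assumes tp: "tpoint p" and L: "L \<in> B" "p \<in> L" and M: "M \<in> B" "p \<in> M" and th: "symm M \<theta>"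
  shows "transl p L \<theta>"
  unfolding transl_def
proof (intro conjI ballI impI)
  show "aut \<theta>" using symm_aut th by blast
  show "\<theta> x \<in> N" if "N \<in> B" "p \<in> N" "x \<in> N" for N x using symm_line[OF th that(1,2) M(2) that(3)] .
  fix N assume N: "N \<in> B" "p \<in> N" "N \<noteq> L"
  show "\<exists>t. symm L t \<and> (\<forall>q\<in>N - {p}. \<theta> q = t q)"
  proof (cases "M = L")
    case True then show ?thesis using th by blast
  next
    case neM: False
    show ?thesis
    proof (cases "N = M")
      case True then show ?thesis using symm_on[OF th M(1)] symm_id by (metis DiffD1 id_apply)
    next
      case False
      obtain n where n: "n \<in> N" "n \<noteq> p" using line_other[OF N(1)] .
      have off: "x \<notin> R" if "x \<in> N" "x \<noteq> p" "R \<in> B" "p \<in> R" "R \<noteq> N" for x R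
        using that lines_meet N by blast
      have "\<theta> n \<in> N" using symm_line[OF th N(1,2) M(2) n(1)] .
      moreover have "\<theta> n \<noteq> p" using symm_off[OF th M(1)] off[OF n M] False M by blast
      moreover have axL: "axis L" using tp L unfolding tpoint_def by blast
      ultimately obtain t where t: "symm L t" "t n = \<theta> n"
        using axisE[OF axL N(1,3,2) L(2), of n "\<theta> n"] off[OF _ _ L] n N by blast
      have "\<theta> q = t q" if q: "q \<in> N - {p}" for q
      proof -
        obtain u where u: "symm L u" "u n = q"
          using axisE[OF axL N(1,3,2) L(2), of n q] off[OF _ _ L] n q N by blast
        have "\<theta> q = u (\<theta> n)" using symm_commute[OF M(1) L(1) neM M(2) L(2) th u(1)] u by (metis comp_apply)
        also have "\<dots> = t (u n)" using symm_abelian[OF tp L u(1) t(1)] t by (metis comp_apply)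
        finally show ?thesis using u by simp
      qed
      then show ?thesis using t by blast
    qed
  qed
qed

text \<open>A collinear pair is moved by a symmetry about the line joining \<open>p\<close> to the
  point of their line collinear with \<open>p\<close>. A non-collinear pair has a common neighbour
  opposite \<open>p\<close> as intermediate point, since a triad has just
  \<open>s + 1 < s^2 + 1\<close> centres.\<close>

lemma transl_trans:
  assumes tp: "tpoint p" and L: "L \<in> B" "p \<in> L" and x: "x \<in> P" "\<not> p \<sim> x" and y: "y \<in> P" "\<not> p \<sim> y"
  shows "\<exists>g. transl p L g \<and> g x = y"
proof -
  have pP: "p \<in> P" using tp unfolding tpoint_def by blast
  have step: "\<exists>g. transl p L g \<and> g x = y" if x: "\<not> p \<sim> x" and y: "\<not> p \<sim> y" and xy: "x \<sim> y" for x y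
  proof -
    obtain l where l: "l \<in> B" "x \<in> l" "y \<in> l" using xy unfolding col_def by blast
    then obtain z where z: "z \<in> l" "p \<sim> z" using proj_ex[OF pP l(1)] colI x by blast
    then obtain M where M: "M \<in> B" "p \<in> M" "z \<in> M" unfolding col_def by blast
    have off: "x \<notin> M" "y \<notin> M" using x y M colI by blast+
    obtain \<theta> where "symm M \<theta>" "\<theta> x = y"
      using axisE[of M l z x y] tp M l z off unfolding tpoint_def by blast
    then show ?thesis using symm_transl[OF tp L M(1,2)] by blast
  qed
  show ?thesis
  proof (cases "x \<sim> y")
    case True then show ?thesis using step x y by blast
  next
    case False
    have "card {w \<in> nbrs B x y. w \<sim> p} = s + 1"
      using card_centres[OF x(1) y(1) pP False] x y col_sym by metis
    moreover have "s + 1 < s^2 + 1" using s2 by (simp add: power2_eq_square)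
    ultimately have "{w \<in> nbrs B x y. w \<sim> p} \<noteq> nbrs B x y" using card_nbrs[OF x(1) y(1) False] by auto
    then obtain w where w: "x \<sim> w" "w \<sim> y" "\<not> p \<sim> w" using col_sym unfolding nbrs_def by fast
    obtain g h where "transl p L g" "g x = w" "transl p L h" "h w = y" using step w x y by metis
    then show ?thesis using transl_comp[of p L h g] pP by (metis comp_apply)
  qed
qed

end

section \<open>Subquadrangles and subtended ovoids\<close>

locale subquad = quad_sq P B s for P :: "'p set" and B s +
  fixes P' :: "'p set" and B' :: "'p set set"
  assumes sub: "quad P' B' s s" and P'_sub: "P' \<subseteq> P" and B'_sub: "B' \<subseteq> B"
    and dbl: "x \<in> P - P' \<Longrightarrow> card {y \<in> P - P'. {u \<in> P'. col B y u} = {u \<in> P'. col B x u}} = 2"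
begin

lemma csym: "x \<sim> y \<Longrightarrow> y \<sim> x"
  unfolding col_def by blast

abbreviation "A \<equiv> P - P'"

definition Ov :: "'p \<Rightarrow> 'p set" where "Ov x = {u \<in> P'. x \<sim> u}"

definition tw :: "'p \<Rightarrow> 'p" where "tw x = (THE y. y \<in> A \<and> y \<noteq> x \<and> Ov y = Ov x)"

lemma Ov_iff: "u \<in> Ov x \<longleftrightarrow> u \<in> P' \<and> x \<sim> u"
  unfolding Ov_def by blast

lemma Ov_P': "Ov x \<subseteq> P'"
  unfolding Ov_def by blast

lemma fin_Ov: "finite (Ov x)"
  using Ov_P' P'_sub fin finite_subset by metis

lemma B'_P': "l \<in> B' \<Longrightarrow> l \<subseteq> P'"
  using quad.line_sub[OF sub] .

lemma B'_B: "l \<in> B' \<Longrightarrow> l \<in> B"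
  using B'_sub by blast

lemma P'_P: "u \<in> P' \<Longrightarrow> u \<in> P"
  using P'_sub by blast

lemma col'_col: "col B' u v \<Longrightarrow> u \<sim> v"
  using B'_B unfolding col_def by blast

text \<open>If \<open>u\<close> and \<open>v\<close> were not collinear in the subquadrangle,
  projecting \<open>v\<close> there onto a line \<open>m\<close> through \<open>u\<close> would give
  a triangle in the big quadrangle unless \<open>l = m\<close>, and \<open>m\<close> is in
  \<open>B'\<close>.\<close>

lemma line_in_B': assumes "l \<in> B" "u \<in> l" "v \<in> l" "u \<noteq> v" "u \<in> P'" "v \<in> P'" shows "l \<in> B'"
proof (cases "col B' u v")
  case True
  then obtain m where "m \<in> B'" "u \<in> m" "v \<in> m" unfolding col_def by blast
  then show ?thesis using line_eq[of l m u v] assms B'_B by blast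
next
  case False
  obtain m where m: "m \<in> B'" "u \<in> m" using quad.line_through[OF sub assms(5)] by blast
  have vm: "v \<notin> m" using m False quad.colI[OF sub] by blast
  obtain w where w: "w \<in> m" "col B' v w" using quad.proj_ex[OF sub assms(6) m(1) vm] by blast
  have wu: "w \<noteq> u" using w False col_sym by metis
  have "w \<sim> u" "w \<sim> v" using m w colI B'_B col'_col csym by metis+
  then have "w \<in> l" using triangle[OF assms(1-4)] by blast
  then show ?thesis using line_eq[of l m u w] m B'_B assms w wu by blast
qed

lemma line_sub_B': assumes "l \<in> B" "l \<subseteq> P'" shows "l \<in> B'"
proof -
  obtain x y where "x \<in> l" "y \<in> l" "x \<noteq> y" using line_two[OF assms(1)] .
  then show ?thesis using line_in_B' assms by blast
qed

lemma col_col': assumes "u \<in> P'" "v \<in> P'" shows "col B' u v \<longleftrightarrow> u \<sim> v"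
proof
  assume uv: "u \<sim> v"
  show "col B' u v"
  proof (cases "u = v")
    case True then show ?thesis using quad.col_refl[OF sub] assms by blast
  next
    case False
    then have "join B u v \<in> B'" using line_in_B' join uv assms by blast
    then show ?thesis using join uv False quad.colI[OF sub] by blast
  qed
qed (rule col'_col)

lemma line_A: assumes "l \<in> B" "x \<in> l" "x \<in> A" "u \<in> l" "v \<in> l" "u \<in> P'" "v \<in> P'" shows "u = v"
  using line_in_B'[of l u v] B'_P' assms by blast

lemma Ov_meets: assumes "x \<in> A" "l \<in> B'" shows "\<exists>u. l \<inter> Ov x = {u}"
proof -
  have xl: "x \<notin> l" using assms B'_P' by blast
  have "x \<in> P" using assms by blast
  then obtain u where u: "u \<in> l" "x \<sim> u" using proj_ex B'_B xl assms by blast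
  have "l \<inter> Ov x = {u}"
    using u proj_eq[OF \<open>x \<in> P\<close> B'_B[OF assms(2)] xl] B'_P'[OF assms(2)] unfolding Ov_def by blast
  then show ?thesis by blast
qed

text \<open>The usual count of an ovoid: apart from its point \<open>k\<close> on a line
  \<open>M\<close>, every ovoid point is collinear with exactly one of the \<open>s\<close> other
  points of \<open>M\<close>, and each of these is on \<open>s\<close> further lines carrying one
  ovoid point each.\<close>

lemma card_Ov: assumes "x \<in> A" shows "card (Ov x) = s^2 + 1"
proof -
  obtain M where M: "M \<in> B'" using quad.line_ex[OF sub] by blast
  obtain k where k: "M \<inter> Ov x = {k}" using Ov_meets assms M by blast
  let ?D = "Ov x - {k}"
  have offM: "v \<notin> M" if "v \<in> ?D" for v using that k by blast
  have "card ?D = (\<Sum>m\<in>M - {k}. card {v \<in> ?D. col B' v m})"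
  proof -
    have "(\<Sum>m\<in>M - {k}. card {v \<in> ?D. col B' v m}) = (\<Sum>v\<in>?D. card {m \<in> M - {k}. col B' v m})"
      using sum_multicount_gen[of "M - {k}" ?D "\<lambda>m v. col B' v m" "\<lambda>v. card {m \<in> M - {k}. col B' v m}"]
        fin_Ov fin_line[OF B'_B[OF M]] by auto
    also have "\<dots> = (\<Sum>v\<in>?D. 1)"
    proof (rule sum.cong[OF refl])
      fix v assume v: "v \<in> ?D"
      then have vP: "v \<in> P'" using Ov_P' by blast
      obtain m where m: "m \<in> M" "col B' v m" using quad.proj_ex[OF sub vP M offM[OF v]] by blast
      have "m \<noteq> k"
      proof
        assume "m = k"
        then obtain l where l: "l \<in> B'" "v \<in> l" "k \<in> l" using m unfolding col_def by blast
        have "v \<in> l \<inter> Ov x" "k \<in> l \<inter> Ov x" using l v k by blast+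
        moreover obtain u where "l \<inter> Ov x = {u}" using Ov_meets[OF assms l(1)] by blast
        ultimately have "v = k" by (metis singletonD)
        then show False using v by blast
      qed
      then have "{m \<in> M - {k}. col B' v m} = {m}"
        using m quad.proj_eq[OF sub vP M offM[OF v]] by blast
      then show "card {m \<in> M - {k}. col B' v m} = 1" by simp
    qed
    finally show ?thesis by simp
  qed
  also have "\<dots> = (\<Sum>m\<in>M - {k}. s)"
  proof (rule sum.cong[OF refl])
    fix m assume m: "m \<in> M - {k}"
    then have mP: "m \<in> P'" using B'_P' M by blast
    have mO: "m \<notin> Ov x" using m k by blast
    let ?Ls = "{l \<in> B'. m \<in> l} - {M}"
    have fL: "finite {l \<in> B'. m \<in> l}" using quad.finB[OF sub] by simp
    have "card ?Ls = s" using quad.pt_card[OF sub mP] M m fL by auto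
    have pick: "\<exists>v. l \<inter> Ov x = {v}" if "l \<in> ?Ls" for l using Ov_meets assms that by blast
    have "bij_betw (\<lambda>l. the_elem (l \<inter> Ov x)) ?Ls {v \<in> ?D. col B' v m}"
    proof (rule bij_betwI')
      fix l n assume l: "l \<in> ?Ls" and n: "n \<in> ?Ls"
      obtain v where v: "l \<inter> Ov x = {v}" using pick[OF l] by blast
      obtain w where w: "n \<inter> Ov x = {w}" using pick[OF n] by blast
      have "l = n" if "v = w"
      proof -
        have "v \<noteq> m" using v mO by blast
        moreover have "v \<in> l" "v \<in> n" using v w that by blast+
        ultimately show ?thesis using quad.line_eq[OF sub, of l n v m] l n by blast
      qed
      then show "(the_elem (l \<inter> Ov x) = the_elem (n \<inter> Ov x)) = (l = n)" using v w by auto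
    next
      fix l assume l: "l \<in> ?Ls"
      obtain v where v: "l \<inter> Ov x = {v}" using pick l by blast
      have "v \<noteq> k"
      proof
        assume "v = k"
        then have "l = M" using quad.line_eq[OF sub, of l M k m] l v k m M by blast
        then show False using l by blast
      qed
      then show "the_elem (l \<inter> Ov x) \<in> {v \<in> ?D. col B' v m}" using v l quad.colI[OF sub] by auto
    next
      fix v assume v: "v \<in> {v \<in> ?D. col B' v m}"
      then obtain l where l: "l \<in> B'" "v \<in> l" "m \<in> l" unfolding col_def by blast
      have "l \<in> ?Ls" using v offM l by blast
      moreover obtain w where w: "l \<inter> Ov x = {w}" using Ov_meets[OF assms l(1)] by blast
      moreover have "v \<in> l \<inter> Ov x" using v l by blast
      then have "v = the_elem (l \<inter> Ov x)" unfolding w by simp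
      ultimately show "\<exists>l\<in>?Ls. v = the_elem (l \<inter> Ov x)" by blast
    qed
    from bij_betw_same_card[OF this] show "card {v \<in> ?D. col B' v m} = s" using \<open>card ?Ls = s\<close> by (rule trans[OF sym])
  qed
  also have "\<dots> = s * s"
  proof -
    have "k \<in> M" using k by blast
    from card_line_minus[OF B'_B[OF M] this] show ?thesis by simp
  qed
  finally show ?thesis using k fin_Ov[of x] card.remove[of "Ov x" k] by (auto simp: power2_eq_square)
qed

text \<open>The \<open>s^2 + 1\<close> ovoid points give distinct lines through \<open>x\<close>,
  hence all of them. So the subquadrangle is a geometrical hyperplane.\<close>

lemma line_meets_P': assumes "x \<in> A" "l \<in> B" "x \<in> l" shows "\<exists>u. l \<inter> P' = {u}"
proof -
  have xP: "x \<in> P" using assms by blast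
  have "inj_on (join B x) (Ov x)"
  proof (rule inj_onI)
    fix u v assume uv: "u \<in> Ov x" "v \<in> Ov x" "join B x u = join B x v"
    then have "x \<sim> u" "x \<sim> v" "x \<noteq> u" "x \<noteq> v" using assms unfolding Ov_def by auto
    then show "u = v" using line_A[of "join B x u" x u v] join uv assms Ov_P' by blast
  qed
  then have "card (join B x ` Ov x) = s^2 + 1" using card_image card_Ov[OF assms(1)] by metis
  moreover have "join B x ` Ov x \<subseteq> {l \<in> B. x \<in> l}"
    using join assms(1) unfolding Ov_def by auto
  ultimately have "join B x ` Ov x = {l \<in> B. x \<in> l}"
    using card_subset_eq[of "{l \<in> B. x \<in> l}"] pt_card[OF xP] finB by auto
  then obtain u where u: "u \<in> Ov x" "l = join B x u" using assms by blast
  then have "u \<in> l" "u \<in> P'" using join[of x u] assms unfolding Ov_def by auto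
  then show ?thesis using line_A[OF assms(2,3,1)] by blast
qed

section \<open>Twins and tangent subtended ovoids\<close>

lemma tw: assumes "x \<in> A" shows "tw x \<in> A" "tw x \<noteq> x" "Ov (tw x) = Ov x"
  and tw_eq: "y \<in> A \<Longrightarrow> Ov y = Ov x \<Longrightarrow> y = x \<or> y = tw x"
proof -
  let ?F = "{y \<in> A. Ov y = Ov x}"
  have c2: "card ?F = 2" using dbl[OF assms] unfolding Ov_def .
  then obtain u v where uv: "?F = {u, v}" "u \<noteq> v" unfolding card_2_iff by blast
  have "x \<in> ?F" using assms by blast
  then have "x = u \<or> x = v" unfolding uv(1) by simp
  then obtain y where y: "?F = {x, y}" "x \<noteq> y" using uv insert_commute[of u v "{}"] by (elim disjE) metis+
  have m: "z \<in> A \<and> Ov z = Ov x \<longleftrightarrow> z = x \<or> z = y" for z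
    using eqset_imp_iff[OF y(1), of z] by simp
  have "tw x = y" unfolding tw_def
    by (rule the_equality) (use m y(2) in metis)+
  then show "tw x \<in> A" "tw x \<noteq> x" "Ov (tw x) = Ov x" "z \<in> A \<Longrightarrow> Ov z = Ov x \<Longrightarrow> z = x \<or> z = tw x" for z
    using m y(2) by metis+
qed

lemma tw_tw: assumes "x \<in> A" shows "tw (tw x) = x"
  using tw_eq[of "tw x" x] tw[OF assms] assms by metis

lemma tw_inj: "x \<in> A \<Longrightarrow> y \<in> A \<Longrightarrow> tw x = tw y \<Longrightarrow> x = y"
  using tw_tw by metis

lemma Ov_big: assumes "x \<in> A" "finite F" "card F \<le> 4" shows "\<exists>v\<in>Ov x. v \<notin> F"
proof -
  have "2 * 2 \<le> s * s" using s2 mult_le_mono by blast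
  then have "card (Ov x) > card F" using card_Ov[OF assms(1)] assms(3) by (simp add: power2_eq_square)
  then have "\<not> Ov x \<subseteq> F" using card_mono[of F] assms(2) by (metis not_le)
  then show ?thesis by blast
qed

text \<open>Common neighbours of two distinct collinear points lie on their line, which has a single
  point in \<open>P'\<close>, whereas twins share a whole ovoid.\<close>

lemma tw_not_col: assumes "x \<in> A" shows "\<not> x \<sim> tw x"
proof
  assume c: "x \<sim> tw x"
  have ne: "x \<noteq> tw x" using tw[OF assms] by metis
  have j: "join B x (tw x) \<in> B" "x \<in> join B x (tw x)" "tw x \<in> join B x (tw x)" using join[OF c ne] .
  obtain u where u: "join B x (tw x) \<inter> P' = {u}" using line_meets_P'[OF assms j(1,2)] by blast
  obtain v where v: "v \<in> Ov x" "v \<noteq> u" using Ov_big[OF assms, of "{u}"] by auto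
  then have "v \<in> Ov (tw x)" using tw[OF assms] by blast
  then have "v \<in> join B x (tw x)" using triangle[OF j ne] v csym unfolding Ov_def by blast
  then show False using u v Ov_P' by blast
qed

text \<open>The ovoid consists of common neighbours, and both sets have \<open>s^2 + 1\<close>
  elements.\<close>

lemma nbrs_tw: assumes "x \<in> A" shows "nbrs B x (tw x) = Ov x"
proof -
  have "Ov x \<subseteq> nbrs B x (tw x)" using tw(3)[OF assms] unfolding Ov_def nbrs_def by blast
  moreover have "card (nbrs B x (tw x)) = card (Ov x)"
    using card_nbrs[OF _ _ tw_not_col[OF assms]] tw(1)[OF assms] assms card_Ov[OF assms] by auto
  ultimately show ?thesis using card_subset_eq[OF fin_nbrs] by metis
qed

text \<open>All common neighbours of twins lie in \<open>P'\<close>. This is what makes a choice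
  between twins by collinearity unambiguous.\<close>

lemma col_tw_False: assumes "y \<in> A" "x \<in> A" "x \<sim> y" "x \<sim> tw y" shows False
proof -
  have "x \<in> nbrs B y (tw y)" using assms csym unfolding nbrs_def by blast
  then show False using nbrs_tw assms Ov_P' by blast
qed

lemma Ov_Int: assumes "x \<in> A" "y \<in> A" "x \<sim> y" "x \<noteq> y" "u \<in> join B x y" "u \<in> P'"
  shows "Ov x \<inter> Ov y = {u}"
proof -
  note j = join[OF assms(3,4)]
  have "v \<in> join B x y" if "v \<in> Ov x \<inter> Ov y" for v
    using triangle[OF j assms(4), of v] that csym unfolding Ov_def by blast
  moreover have "u \<in> Ov x \<inter> Ov y" using colI[OF j(1)] j assms unfolding Ov_def by blast
  ultimately show ?thesis using line_A[OF j(1,2) assms(1)] Ov_P' assms by blast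
qed

lemma Ov_Int_ex: assumes "x \<in> A" "y \<in> A" "x \<sim> y" "x \<noteq> y"
  obtains u where "u \<in> join B x y" "Ov x \<inter> Ov y = {u}"
proof -
  obtain u where "join B x y \<inter> P' = {u}" using line_meets_P'[OF assms(1)] join[OF assms(3,4)] by blast
  then show ?thesis using that Ov_Int[OF assms, of u] by blast
qed

text \<open>If \<open>x\<close> were collinear with neither \<open>y\<close> nor
  \<open>tw y\<close>, the three would form a triad whose \<open>s + 1\<close> centres are exactly
  the common points of the two ovoids.\<close>

lemma tangent:
  assumes "x \<in> A" "y \<in> A" "card (Ov x \<inter> Ov y) = 1"
  shows "x \<noteq> y" "x \<noteq> tw y" "x \<sim> y \<or> x \<sim> tw y"
proof -
  have O1: "card (Ov z) \<noteq> 1" if "z \<in> A" for z using card_Ov[OF that] s2 by simp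
  show xy: "x \<noteq> y" using assms O1 by auto
  show xty: "x \<noteq> tw y" using assms O1[of y] tw(3)[of y] by auto
  show "x \<sim> y \<or> x \<sim> tw y"
  proof (rule ccontr)
    assume "\<not> ?thesis"
    then have n: "\<not> y \<sim> x" "\<not> tw y \<sim> x" using csym by metis+
    have "card {w \<in> nbrs B y (tw y). w \<sim> x} = s + 1"
      by (rule card_centres) (use assms tw(1)[of y] tw_not_col[of y] n in auto)
    moreover have "{w \<in> nbrs B y (tw y). w \<sim> x} = Ov x \<inter> Ov y"
      unfolding nbrs_tw[OF assms(2)] using csym unfolding Ov_def by blast
    ultimately show False using assms(3) s2 by simp
  qed
qed

text \<open>The ovoids of \<open>tw x\<close> and \<open>y\<close> still meet in one point, so
  \<open>tw x\<close> is collinear with \<open>y\<close> or \<open>tw y\<close>; the former would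
  make \<open>y\<close> collinear with both \<open>x\<close> and \<open>tw x\<close>.\<close>

lemma tw_col: assumes "x \<in> A" "y \<in> A" "x \<sim> y" shows "tw x \<sim> tw y"
proof (cases "x = y")
  case True then show ?thesis using col_refl tw(1) assms by blast
next
  case False
  obtain u where "Ov x \<inter> Ov y = {u}" using Ov_Int_ex[OF assms False] .
  then have "card (Ov (tw x) \<inter> Ov y) = 1" using tw(3) assms by simp
  then have "tw x \<sim> y \<or> tw x \<sim> tw y" using tangent(3)[of "tw x" y] tw(1) assms by blast
  moreover have "\<not> tw x \<sim> y" using col_tw_False[of x y] assms csym by metis
  ultimately show ?thesis by blast
qed

lemma aut_P': assumes "aut f" "\<And>u. u \<in> P' \<Longrightarrow> f u \<in> P'" shows "f ` P' = P'"
proof (rule endo_inj_surj)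
  show "finite P'" using finite_subset[OF P'_sub fin] .
  show "f ` P' \<subseteq> P'" using assms(2) by blast
  show "inj_on f P'" using inj_on_subset[OF aut_bij(2)[OF assms(1)]] by simp
qed

lemma aut_Ov: assumes "aut f" "\<And>u. u \<in> P' \<Longrightarrow> f u \<in> P'" "x \<in> P" shows "Ov (f x) = f ` Ov x"
proof -
  have im: "f ` P' = P'" by (rule aut_P'[OF assms(1,2)])
  show ?thesis
  proof (intro equalityI subsetI)
    fix u assume u: "u \<in> Ov (f x)"
    then obtain v where v: "v \<in> P'" "u = f v" using im Ov_P' by blast
    then have "x \<sim> v" using u aut_col[OF assms(1), of x v] by (simp add: Ov_iff)
    then show "u \<in> f ` Ov x" using v by (simp add: Ov_iff)
  next
    fix u assume "u \<in> f ` Ov x"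
    then show "u \<in> Ov (f x)" using im by (auto simp: Ov_iff aut_col[OF assms(1)])
  qed
qed

lemma symm_P': assumes "M \<in> B'" "symm M f" "u \<in> P'" shows "f u \<in> P'"
proof (cases "u \<in> M")
  case True then show ?thesis using symm_on assms B'_B by metis
next
  case False
  obtain y where y: "y \<in> M" "col B' u y" using quad.proj_ex[OF sub assms(3,1) False] by blast
  then obtain l where "l \<in> B'" "u \<in> l" "y \<in> l" unfolding col_def by blast
  then show ?thesis using symm_line[OF assms(2), of l y u] B'_B B'_P' y by blast
qed

lemma symm_Ov: assumes "M \<in> B'" "symm M f" "x \<in> P" shows "Ov (f x) = f ` Ov x"
  using aut_Ov[OF symm_aut[OF assms(2)] symm_P'[OF assms(1,2)] assms(3)] .

lemma aut_A: assumes "aut f" "\<And>u. u \<in> P' \<Longrightarrow> f u \<in> P'" "x \<in> A" shows "f x \<in> A"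
proof -
  have im: "f ` P' = P'" by (rule aut_P'[OF assms(1,2)])
  have "f x \<notin> f ` P'" using assms(3) aut_eq[OF assms(1)] by auto
  then show ?thesis using im assms(3) aut_in[OF assms(1), of x] by simp
qed

lemma A_nbr: assumes "x \<in> A" "l \<in> B" "x \<in> l" obtains y where "y \<in> l" "y \<in> A" "y \<noteq> x"
proof -
  obtain u where u: "l \<inter> P' = {u}" using line_meets_P' assms by blast
  have "card l > card {x, u}" using line_card[OF assms(2)] s2 by (simp add: card_insert_if)
  then have "\<not> l \<subseteq> {x, u}" using card_mono[of "{x, u}" l] by (meson finite.emptyI finite_insert not_le)
  then show ?thesis using that u line_sub[OF assms(2)] by blast
qed

end

section \<open>Lifting an ovoid-preserving automorphism pointwise\<close>

text \<open>The cover enters through \<open>a_Ov\<close>: the automorphism maps subtended ovoids to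
  subtended ovoids. Since \<open>L\<close> is preserved, \<open>a p\<close> lies on \<open>L\<close>
  again.\<close>

locale ovoid_auto = subquad P B s P' B'
  for P :: "'p set" and B s P' B' +
  fixes a :: "'p \<Rightarrow> 'p" and L :: "'p set" and p :: 'p
  assumes a: "quad.aut P' B' a"
    and a_Ov: "x \<in> A \<Longrightarrow> \<exists>z\<in>A. Ov z = a ` Ov x"
    and L: "L \<in> B'" "p \<in> L" "a ` L = L"
    and tp: "tpoint p" "tpoint (a p)"
begin

lemma a_in: "a u \<in> P' \<longleftrightarrow> u \<in> P'"
  using quad.aut_in[OF sub a] .

lemma a_eq: "a u = a v \<longleftrightarrow> u = v"
  using quad.aut_eq[OF sub a] .

lemma a_col: "u \<in> P' \<Longrightarrow> v \<in> P' \<Longrightarrow> a u \<sim> a v \<longleftrightarrow> u \<sim> v"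
  using quad.aut_col[OF sub a, of u v] col_col' a_in by simp

lemma a_line: "l \<in> B' \<Longrightarrow> a ` l \<in> B'"
  using quad.aut_line[OF sub a] .

lemma pP': "p \<in> P'" and rP': "a p \<in> P'"
  using L B'_P' a_in by blast+

lemma pP: "p \<in> P" and rP: "a p \<in> P"
  using pP' rP' P'_P by auto

lemma LB: "L \<in> B" "a p \<in> L"
  using L B'_B by blast+

lemma a_L: "a u \<in> L \<longleftrightarrow> u \<in> L"
proof
  assume "a u \<in> L"
  then have "a u \<in> a ` L" using L by simp
  then show "u \<in> L" using a_eq by auto
qed (use L in blast)

definition over :: "'p \<Rightarrow> 'p \<Rightarrow> bool" where
  "over x z \<longleftrightarrow> x \<in> A \<and> z \<in> A \<and> Ov z = a ` Ov x"

text \<open>Frames will mix points inside and outside the subquadrangle. Inside, \<open>a\<close>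
  leaves one candidate, outside there are two; \<open>corr\<close> handles both uniformly.\<close>

definition corr :: "'p \<Rightarrow> 'p \<Rightarrow> bool" where
  "corr x z \<longleftrightarrow> over x z \<or> x \<in> P' \<and> z = a x"

lemma over_A: "over x z \<Longrightarrow> x \<in> A" "over x z \<Longrightarrow> z \<in> A"
  unfolding over_def by auto

lemma over_P: "over x z \<Longrightarrow> x \<in> P" "over x z \<Longrightarrow> z \<in> P"
  unfolding over_def by auto

lemma over_ex: "x \<in> A \<Longrightarrow> \<exists>z. over x z"
  using a_Ov unfolding over_def by blast

lemma over_two: "over x z \<Longrightarrow> over x w \<Longrightarrow> w = z \<or> w = tw z"
  using tw_eq unfolding over_def by metis

lemma over_tw: assumes "over x z" shows "over x (tw z)" "over (tw x) z" "over (tw x) (tw z)"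
  using assms tw(1,3)[of z] tw(1,3)[of x] unfolding over_def by simp_all

lemma over_inj: assumes "over x z" "over y z" shows "y = x \<or> y = tw x"
proof -
  have "a ` Ov x = a ` Ov y" using assms unfolding over_def by metis
  moreover have "inj a" using a_eq by (simp add: inj_def)
  ultimately have "Ov x = Ov y" using inj_image_eq_iff by metis
  then show ?thesis using tw_eq[of x y] assms unfolding over_def by simp
qed

lemma over_Ov: assumes "over x z" "u \<in> P'" shows "z \<sim> a u \<longleftrightarrow> x \<sim> u"
proof -
  have "z \<sim> a u \<longleftrightarrow> a u \<in> a ` Ov x" using assms Ov_iff[of "a u" z] a_in[of u] unfolding over_def by simp
  also have "\<dots> \<longleftrightarrow> u \<in> Ov x" using a_eq by auto
  finally show ?thesis using assms Ov_iff by simp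
qed

lemma over_Int: assumes "over x z" "over y w" shows "Ov z \<inter> Ov w = a ` (Ov x \<inter> Ov y)"
proof -
  have "inj a" using a_eq by (simp add: inj_def)
  then show ?thesis using assms image_Int[of a] unfolding over_def by simp
qed

text \<open>Collinear points have ovoids meeting in one point, \<open>a\<close> preserves this, and
  \<open>tangent\<close> turns it back into collinearity up to a twin.\<close>

lemma over_col: assumes "over x z" "over y w" "x \<sim> y" "x \<noteq> y"
  shows "z \<sim> w \<or> z \<sim> tw w" "z \<noteq> w" "z \<noteq> tw w"
proof -
  obtain u where "Ov x \<inter> Ov y = {u}" using Ov_Int_ex[OF over_A(1)[OF assms(1)] over_A(1)[OF assms(2)] assms(3,4)] .
  then have "card (Ov z \<inter> Ov w) = 1" using over_Int[OF assms(1,2)] by simp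
  from tangent[OF over_A(2)[OF assms(1)] over_A(2)[OF assms(2)] this]
  show "z \<sim> w \<or> z \<sim> tw w" "z \<noteq> w" "z \<noteq> tw w" by auto
qed

lemma over_lift: assumes "over x z" "y \<in> A" "x \<sim> y" "x \<noteq> y"
  obtains w where "over y w" "z \<sim> w" "z \<noteq> w"
proof -
  obtain w where w: "over y w" using over_ex[OF assms(2)] by blast
  show ?thesis
    using over_col[OF assms(1) w assms(3,4)] that[OF w] that[OF over_tw(1)[OF w]] by blast
qed

text \<open>The point of a line in \<open>P'\<close> is the common point of the ovoids of two of its
  other points, and \<open>a\<close> carries that intersection along.\<close>

lemma over_join: assumes "over x z" "over y w" "x \<sim> y" "x \<noteq> y" "z \<sim> w" "u \<in> join B x y" "u \<in> P'"
  shows "a u \<in> join B z w"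
proof -
  have "Ov x \<inter> Ov y = {u}" using Ov_Int[OF over_A(1)[OF assms(1)] over_A(1)[OF assms(2)] assms(3,4,6,7)] .
  then have e: "Ov z \<inter> Ov w = {a u}" using over_Int[OF assms(1,2)] by simp
  have "z \<noteq> w" using over_col(2)[OF assms(1-4)] .
  then obtain v where "v \<in> join B z w" "Ov z \<inter> Ov w = {v}"
    using Ov_Int_ex[OF over_A(2)[OF assms(1)] over_A(2)[OF assms(2)] assms(5)] by blast
  then show ?thesis using e by simp
qed

lemma radial: assumes "b \<in> P'" "n \<in> A" "b \<sim> n"
  shows "join B b n \<in> B" "b \<in> join B b n" "n \<in> join B b n"
    and "q \<in> join B b n \<Longrightarrow> q \<noteq> b \<Longrightarrow> q \<in> A"
    and "q \<in> join B b n \<Longrightarrow> q \<noteq> b \<Longrightarrow> join B b q = join B b n"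
proof -
  have ne: "b \<noteq> n" using assms by blast
  show j: "join B b n \<in> B" "b \<in> join B b n" "n \<in> join B b n" using join[OF assms(3) ne] .
  show "q \<in> A" if "q \<in> join B b n" "q \<noteq> b"
    using line_A[OF j(1,3) assms(2) that(1) j(2) _ assms(1)] that line_sub[OF j(1)] by blast
  show "join B b q = join B b n" if "q \<in> join B b n" "q \<noteq> b" using join_eq[OF j(1,2) that(1)] that by blast
qed

lemma over_r: assumes "over n k" "p \<sim> n" shows "a p \<sim> k"
  using over_Ov[OF assms(1) pP'] assms(2) col_sym by metis

lemma over_not_r: assumes "over n k" "\<not> p \<sim> n" shows "\<not> a p \<sim> k"
  using over_Ov[OF assms(1) pP'] assms(2) col_sym by metis

lemma lift_on: assumes n: "over n k" "p \<sim> n" and m: "m \<in> join B p n" "m \<noteq> p"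
  obtains m' where "m' \<in> join B (a p) k" "over m m'"
proof (cases "m = n")
  case True
  have "k \<in> join B (a p) k" using radial(3)[OF rP' over_A(2)[OF n(1)] over_r[OF n]] .
  then show ?thesis using that n True by blast
next
  case False
  note jn = radial[OF pP' over_A(1)[OF n(1)] n(2)]
  note jk = radial[OF rP' over_A(2)[OF n(1)] over_r[OF n]]
  have nm: "n \<sim> m" "n \<noteq> m" using colI[OF jn(1,3) m(1)] False by auto
  have mA: "m \<in> A" using jn(4)[OF m] .
  obtain w where w: "over m w" "k \<sim> w" "k \<noteq> w" using over_lift[OF n(1) mA nm] .
  have "p \<in> join B n m" using join_eq[OF jn(1,3) m(1) nm(2)] jn by simp
  then have "a p \<in> join B k w" using over_join[OF n(1) w(1) nm w(2) _ pP'] by blast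
  moreover have "a p \<noteq> k" using rP' over_A(2)[OF n(1)] by blast
  ultimately have "join B (a p) k = join B k w" using join_eq[of "join B k w" "a p" k] join[OF w(2,3)] by blast
  then show ?thesis using that w join[OF w(2,3)] by simp
qed

text \<open>Distinct candidates over a point are twins, hence not collinear. So an image is pinned
  down once it must lie on a given line.\<close>

lemma corr_line_unique: assumes "corr m k" "corr m j" "k \<sim> j" shows "k = j"
proof (cases "m \<in> P'")
  case True
  then have "k = a m" "j = a m" using assms unfolding corr_def over_def by auto
  then show ?thesis by simp
next
  case False
  then have o: "over m k" "over m j" using assms unfolding corr_def by auto
  then show ?thesis using over_two[OF o] tw_not_col[OF over_A(2)[OF o(1)]] assms(3) by metis
qed

lemma over_corr: "over m k \<Longrightarrow> corr m k"
  unfolding corr_def by blast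

text \<open>On the line through \<open>p\<close> and \<open>n\<close>, the pair \<open>(n, k)\<close> selects the candidates that lie on the line
  through \<open>a p\<close> and \<open>k\<close>; of the two candidates over \<open>x\<close>, \<open>z\<close> is the one collinear with a
  selected one.\<close>

definition follows :: "'p \<Rightarrow> 'p \<Rightarrow> 'p \<Rightarrow> 'p \<Rightarrow> bool" where
  "follows n k x z \<longleftrightarrow> over x z \<and>
     (\<exists>m m'. m \<in> join B p n \<and> m \<sim> x \<and> m' \<in> join B (a p) k \<and> m' \<sim> z \<and> over m m')"

lemma follows_over: "follows n k x z \<Longrightarrow> over x z"
  unfolding follows_def by blast

lemma proj_radial: assumes "b \<in> P'" "n \<in> A" "b \<sim> n" "x \<in> P" "\<not> b \<sim> x"
  obtains m where "m \<in> join B b n" "m \<sim> x" "m \<in> A"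
    and "\<And>q. q \<in> join B b n \<Longrightarrow> q \<sim> x \<Longrightarrow> q = m"
proof -
  note jn = radial[OF assms(1-3)]
  have xN: "x \<notin> join B b n" using colI[OF jn(1,2)] assms(5) by blast
  obtain m where m: "m \<in> join B b n" "x \<sim> m" using proj_ex[OF assms(4) jn(1) xN] by blast
  have "m \<noteq> b" using m assms(5) csym by blast
  then have "m \<in> A" using jn(4) m by blast
  moreover have "q = m" if "q \<in> join B b n" "q \<sim> x" for q
    using proj_eq[OF assms(4) jn(1) xN that(1) m(1) csym[OF that(2)] m(2)] .
  ultimately show ?thesis using that m csym by blast
qed

lemma follows_ex: assumes n: "over n k" "p \<sim> n" and x: "x \<in> A" "\<not> p \<sim> x"
  obtains z where "follows n k x z"
proof -
  have xP: "x \<in> P" using x by blast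
  obtain m where m: "m \<in> join B p n" "m \<sim> x" "m \<in> A" using proj_radial[OF pP' over_A(1)[OF n(1)] n(2) xP x(2)] by metis
  have "m \<noteq> p" using m pP' by blast
  then obtain m' where m': "m' \<in> join B (a p) k" "over m m'" using lift_on[OF n m(1)] by blast
  have "m \<noteq> x" using m x radial(1,2)[OF pP' over_A(1)[OF n(1)] n(2)] colI by blast
  then obtain z where "over x z" "m' \<sim> z" using over_lift[OF m'(2) x(1) m(2)] by blast
  then show ?thesis using that m m' unfolding follows_def by blast
qed

lemma follows_unique:
  assumes n: "over n k" "p \<sim> n" and x: "\<not> p \<sim> x" and z: "follows n k x z" and w: "follows n k x w"
  shows "z = w"
proof -
  obtain m m' where m: "m \<in> join B p n" "m \<sim> x" "m' \<in> join B (a p) k" "m' \<sim> z" "over m m'"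
    using z unfolding follows_def by blast
  obtain h h' where h: "h \<in> join B p n" "h \<sim> x" "h' \<in> join B (a p) k" "h' \<sim> w" "over h h'"
    using w unfolding follows_def by blast
  have xP: "x \<in> P" using over_P follows_over z by blast
  have "m = h" using proj_radial[OF pP' over_A(1)[OF n(1)] n(2) xP x] m h by metis
  moreover have "m' \<sim> h'" using colI[OF radial(1)[OF rP' over_A(2)[OF n(1)] over_r[OF n]] m(3) h(3)] .
  ultimately have "m' = h'" using corr_line_unique over_corr m h by blast
  moreover have "z = w \<or> z = tw w" using over_two follows_over z w by blast
  ultimately show ?thesis
    using col_tw_False[OF over_A(2)[OF follows_over[OF w]] over_A(2)[OF h(5)] h(4)] m(4) by blast
qed

lemma join_tw: assumes "b \<in> P'" "n \<in> A" "b \<sim> n" "m \<in> join B b n" "m \<noteq> b"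
  shows "tw m \<in> join B b (tw n)"
proof -
  note jn = radial[OF assms(1-3)]
  have mA: "m \<in> A" using jn(4) assms by blast
  have b: "b \<sim> tw q" if "q \<in> A" "b \<sim> q" for q
  proof -
    have "b \<in> Ov q" using that assms(1) csym unfolding Ov_iff by blast
    then have "b \<in> Ov (tw q)" using tw(3)[OF that(1)] by simp
    then show ?thesis using csym unfolding Ov_iff by blast
  qed
  note jt = radial[OF assms(1) tw(1)[OF assms(2)] b[OF assms(2,3)]]
  have "tw m \<sim> tw n" using tw_col[OF mA assms(2) colI[OF jn(1) assms(4) jn(3)]] .
  moreover have "tw m \<sim> b" using b[OF mA] colI[OF jn(1,2) assms(4)] csym by blast
  moreover have "b \<noteq> tw n" using assms(1) tw(1)[OF assms(2)] by blast
  ultimately show ?thesis using triangle[OF jt(1-3)] by blast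
qed

lemma follows_tw: assumes n: "over n k" "p \<sim> n" and x: "follows n k x z"
  shows "follows n (tw k) x (tw z)" "follows (tw n) (tw k) (tw x) (tw z)"
proof -
  obtain m m' where m: "m \<in> join B p n" "m \<sim> x" "m' \<in> join B (a p) k" "m' \<sim> z" "over m m'"
    using x unfolding follows_def by blast
  have D: "over x z" using follows_over[OF x] .
  have ne: "m \<noteq> p" "m' \<noteq> a p" using over_A[OF m(5)] pP' rP' by blast+
  have 1: "tw m' \<in> join B (a p) (tw k)" using join_tw[OF rP' over_A(2)[OF n(1)] over_r[OF n] m(3) ne(2)] .
  have 2: "tw m \<in> join B p (tw n)" using join_tw[OF pP' over_A(1)[OF n(1)] n(2) m(1) ne(1)] .
  have 3: "tw m' \<sim> tw z" using tw_col over_A m D by blast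
  have 4: "tw m \<sim> tw x" using tw_col over_A m D by blast
  show "follows n (tw k) x (tw z)" unfolding follows_def using m 1 3 over_tw[OF D] over_tw[OF m(5)] by blast
  show "follows (tw n) (tw k) (tw x) (tw z)" unfolding follows_def using m 1 2 3 4 over_tw[OF D] over_tw[OF m(5)] by blast
qed

lemma follows_inj:
  assumes n: "over n k" "p \<sim> n" and x: "\<not> p \<sim> x" and xz: "follows n k x z" and yz: "follows n k y z"
  shows "x = y"
proof -
  obtain m m' where m: "m \<in> join B p n" "m \<sim> x" "m' \<in> join B (a p) k" "m' \<sim> z" "over m m'"
    using xz unfolding follows_def by blast
  obtain h h' where h: "h \<in> join B p n" "h \<sim> y" "h' \<in> join B (a p) k" "h' \<sim> z" "over h h'"
    using yz unfolding follows_def by blast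
  have xP: "x \<in> P" "z \<in> P" using over_P follows_over xz by blast+
  have rz: "\<not> a p \<sim> z" using over_not_r[OF follows_over[OF xz] x] .
  have "m' = h'" using proj_radial[OF rP' over_A(2)[OF n(1)] over_r[OF n] xP(2) rz] m h by metis
  then have "h = m \<or> h = tw m" using over_inj m h by blast
  moreover have "m \<sim> h" using colI[OF radial(1)[OF pP' over_A(1)[OF n(1)] n(2)] m(1) h(1)] .
  ultimately have "h = m" using tw_not_col[OF over_A(1)[OF m(5)]] by blast
  moreover have "y = x \<or> y = tw x" using over_inj follows_over xz yz by blast
  ultimately show ?thesis
    using col_tw_False[OF over_A(1)[OF follows_over[OF xz]] over_A(1)[OF m(5)] m(2)] h(2) by blast
qed

lemma p_tw: "x \<in> A \<Longrightarrow> p \<sim> tw x \<longleftrightarrow> p \<sim> x"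
  using tw(3)[of x] Ov_iff[of p] pP' csym by metis

text \<open>By injectivity \<open>tw x\<close> cannot also go to \<open>z\<close>, so it goes to
  \<open>tw z\<close>; exchanging twins in all four places gives the claim. Thus the pairs
  \<open>(n, k)\<close> and \<open>(tw n, tw k)\<close> impose the same rule and can both enter a
  frame.\<close>

lemma follows_tw2:
  assumes n: "over n k" "p \<sim> n" and x: "\<not> p \<sim> x" and xz: "follows n k x z"
  shows "follows (tw n) (tw k) x z"
proof -
  have D: "over x z" using follows_over[OF xz] .
  have xA: "x \<in> A" "tw x \<in> A" using over_A[OF D] tw(1) by blast+
  have ptx: "\<not> p \<sim> tw x" using p_tw xA x by blast
  obtain w where w: "follows n k (tw x) w" using follows_ex[OF n xA(2) ptx] .
  have "w \<noteq> z"
  proof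
    assume "w = z"
    then have "x = tw x" using follows_inj[OF n x xz, of "tw x"] w by blast
    then show False using tw(2)[OF xA(1)] by simp
  qed
  moreover have "w = z \<or> w = tw z" using over_two[OF over_tw(2)[OF D] follows_over[OF w]] .
  ultimately have "follows n k (tw x) (tw z)" using w by blast
  from follows_tw(2)[OF n this] show ?thesis using tw_tw[OF xA(1)] tw_tw[OF over_A(2)[OF D]] by simp
qed

end

section \<open>Base pairs and frames\<close>

context ovoid_auto
begin

text \<open>The conjugate of \<open>t\<close> by \<open>a\<close> makes sense on the subquadrangle,
  so the ambient \<open>t'\<close> is tied to it through its restriction to
  \<open>P'\<close>.\<close>

definition conjug :: "'p set \<Rightarrow> ('p \<Rightarrow> 'p) \<Rightarrow> ('p \<Rightarrow> 'p) \<Rightarrow> bool" where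
  "conjug M t t' \<longleftrightarrow> symm M t \<and> symm (a ` M) t' \<and> (\<forall>u\<in>P'. t' (a u) = a (t u))"

lemma inv_a: "inv a (a u) = u" "a (inv a u) = u"
  using quad.aut_inv_simp[OF sub a] by auto

lemma inv_a_in: "inv a u \<in> P' \<longleftrightarrow> u \<in> P'"
  using a_in[of "inv a u"] inv_a by simp

lemma inv_a_col: "u \<in> P' \<Longrightarrow> v \<in> P' \<Longrightarrow> inv a u \<sim> inv a v \<longleftrightarrow> u \<sim> v"
  using a_col[of "inv a u" "inv a v"] inv_a inv_a_in by simp

text \<open>Both sides of \<open>t' \<circ> a = a \<circ> t\<close> induce symmetries of the subquadrangle about the same line, so
  it is enough to match them at one point.\<close>

lemma conjug_ex: assumes M: "M \<in> B'" and ax: "axis (a ` M)" and t: "symm M t"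
  obtains t' where "conjug M t t'"
proof -
  obtain u0 where u0: "u0 \<in> M" using quad.line_two[OF sub M] by blast
  have u0P: "u0 \<in> P'" using u0 B'_P' M by blast
  obtain l where l: "l \<in> B'" "u0 \<in> l" "l \<noteq> M" using quad.other_line[OF sub u0P] by metis
  obtain k where k: "k \<in> l" "k \<noteq> u0" using quad.line_other[OF sub l(1)] by metis
  have kM: "k \<notin> M" using k l u0 line_eq[of l M k u0] B'_B M by blast
  have kP: "k \<in> P'" using k l B'_P' by blast
  have tk: "t k \<in> l" "t k \<notin> M" using symm_line[OF t B'_B[OF l(1)] l(2) u0 k(1)] symm_off[OF t B'_B[OF M] kM] by auto
  have off: "a v \<in> a ` M \<longleftrightarrow> v \<in> M" for v using a_eq by auto
  have "a ` l \<noteq> a ` M" using k(1) kM off by blast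
  then obtain t' where t': "symm (a ` M) t'" "t' (a k) = a (t k)"
    using axisE[OF ax B'_B[OF a_line[OF l(1)]], of "a u0" "a k" "a (t k)"] u0 l k tk kM off by blast
  have aM: "a ` M \<in> B'" using a_line M by blast
  \<comment> \<open>The discrepancy between \<open>t'\<close> and the conjugate of \<open>t\<close>,
    read in the subquadrangle. It preserves the lines of \<open>B'\<close> meeting \<open>M\<close>
    and, by the choice of \<open>t'\<close>, fixes \<open>k\<close>; rigidity in the subquadrangle
    then makes it trivial on \<open>P'\<close>.\<close>
  define \<psi> where "\<psi> u = inv a (inv t' (a (t u)))" for u
  have st: "symm (a ` M) (inv t')" using symm_inv[OF t'(1)] .
  have in1: "a (t u) \<in> P'" if "u \<in> P'" for u using symm_P'[OF M t that] a_in by simp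
  have in2: "inv t' v \<in> P'" if "v \<in> P'" for v using symm_P'[OF aM st that] .
  have col: "\<psi> u \<sim> \<psi> v" if uv: "u \<in> P'" "v \<in> P'" "u \<sim> v" for u v
    unfolding \<psi>_def
    using uv inv_a_col[OF in2[OF in1[OF uv(1)]] in2[OF in1[OF uv(2)]]] aut_col[OF symm_aut[OF st]]
      a_col[OF symm_P'[OF M t uv(1)] symm_P'[OF M t uv(2)]] aut_col[OF symm_aut[OF t]] by simp
  have line: "\<psi> x \<in> m" if m: "m \<in> B'" "y \<in> m" "y \<in> M" "x \<in> m" for m y x
  proof -
    have "t x \<in> m" using symm_line[OF t B'_B[OF m(1)] m(2,3,4)] .
    then have "inv t' (a (t x)) \<in> a ` m"
      using symm_line[OF st B'_B[OF a_line[OF m(1)]], of "a y"] m by blast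
    then show ?thesis unfolding \<psi>_def using inv_a by auto
  qed
  have fixed: "\<psi> k = k" unfolding \<psi>_def using t'(2) aut_inv_simp(2)[OF symm_aut[OF t'(1)]] inv_a by metis
  have id: "\<psi> u = u" if u: "u \<in> P'" for u
  proof (rule quad.fix_all[OF sub M, where \<theta> = \<psi> and k = k])
    show "col B' (\<psi> x) (\<psi> y)" if "col B' x y" for x y
    proof -
      have "x \<in> P'" "y \<in> P'" using quad.col_in[OF sub] that by blast+
      then show ?thesis using col_col' col that in1 in2 inv_a_in unfolding \<psi>_def by simp
    qed
  qed (use line kP kM fixed u in blast)+
  have "t' (a u) = a (t u)" if u: "u \<in> P'" for u
  proof -
    have "inv a (inv t' (a (t u))) = u" using id[OF u] unfolding \<psi>_def .
    then have "inv t' (a (t u)) = a u" using inv_a by metis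
    then show ?thesis using aut_inv_simp(1)[OF symm_aut[OF t'(1)]] by metis
  qed
  then show ?thesis using that t t' unfolding conjug_def by blast
qed

lemma conjug_over: assumes "M \<in> B'" "conjug M t t'" "over x z" shows "over (t x) (t' z)"
proof -
  have t: "symm M t" "symm (a ` M) t'" using assms unfolding conjug_def by auto
  note aM = a_line[OF assms(1)]
  have "Ov (t' z) = t' ` Ov z" using symm_Ov[OF aM t(2) over_P(2)[OF assms(3)]] .
  also have "\<dots> = t' ` a ` Ov x" using assms(3) unfolding over_def by simp
  also have "\<dots> = a ` t ` Ov x"
    unfolding image_image by (rule image_cong[OF refl]) (use assms(2) Ov_P' in \<open>auto simp: conjug_def\<close>)
  also have "t ` Ov x = Ov (t x)" using symm_Ov[OF assms(1) t(1) over_P(1)[OF assms(3)]] by simp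
  finally have "Ov (t' z) = a ` Ov (t x)" .
  moreover have "t x \<in> A" using aut_A[OF symm_aut[OF t(1)] symm_P'[OF assms(1) t(1)] over_A(1)[OF assms(3)]] .
  moreover have "t' z \<in> A" using aut_A[OF symm_aut[OF t(2)] symm_P'[OF aM t(2)] over_A(2)[OF assms(3)]] .
  ultimately show ?thesis unfolding over_def by blast
qed

lemma conjug_corr: assumes "M \<in> B'" "conjug M t t'" "corr x z" shows "corr (t x) (t' z)"
  using assms(3) unfolding corr_def
proof
  assume "over x z"
  then show "over (t x) (t' z) \<or> t x \<in> P' \<and> t' z = a (t x)" using conjug_over assms by blast
next
  assume "x \<in> P' \<and> z = a x"
  then show "over (t x) (t' z) \<or> t x \<in> P' \<and> t' z = a (t x)"
    using assms symm_P'[OF assms(1)] unfolding conjug_def by blast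
qed

lemma conjug_inv: assumes M: "M \<in> B'" and c: "conjug M t t'" shows "conjug M (inv t) (inv t')"
proof -
  have t: "symm M t" "symm (a ` M) t'" "\<And>u. u \<in> P' \<Longrightarrow> t' (a u) = a (t u)" using c unfolding conjug_def by auto
  have "inv t' (a u) = a (inv t u)" if u: "u \<in> P'" for u
  proof -
    have "inv t u \<in> P'" using symm_P'[OF M symm_inv[OF t(1)] u] .
    then have "t' (a (inv t u)) = a u" using t(3) aut_inv_simp(1)[OF symm_aut[OF t(1)]] by simp
    then show ?thesis using aut_inv_simp(2)[OF symm_aut[OF t(2)]] by metis
  qed
  then show ?thesis using symm_inv t unfolding conjug_def by blast
qed

text \<open>Points of \<open>L\<close> are excluded because \<open>transl\<close> matches its maps
  with symmetries about \<open>L\<close> on the other lines through \<open>p\<close>, and these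
  symmetries are what \<open>a\<close> can conjugate.\<close>

definition base :: "'p \<Rightarrow> 'p \<Rightarrow> bool" where
  "base n k \<longleftrightarrow> p \<sim> n \<and> n \<notin> L \<and> corr n k"

abbreviation "trl \<equiv> transl p L"
abbreviation "trr \<equiv> transl (a p) L"

lemma baseD: assumes "base n k"
  shows "join B p n \<in> B" "p \<in> join B p n" "n \<in> join B p n" "n \<noteq> p" "join B p n \<noteq> L"
    "join B (a p) k \<in> B" "a p \<in> join B (a p) k" "k \<in> join B (a p) k" "k \<noteq> a p" "join B (a p) k \<noteq> L"
proof -
  have n: "p \<sim> n" "n \<notin> L" "corr n k" using assms unfolding base_def by auto
  show ne: "n \<noteq> p" using n L by blast
  show j: "join B p n \<in> B" "p \<in> join B p n" "n \<in> join B p n" using join[OF n(1)] ne by auto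
  show "join B p n \<noteq> L" using j n by blast
  have k: "a p \<sim> k \<and> k \<notin> L"
  proof (cases "over n k")
    case True
    then show ?thesis using over_r[OF True n(1)] over_A[OF True] B'_P'[OF L(1)] by blast
  next
    case False
    then have "n \<in> P'" "k = a n" using n unfolding corr_def by auto
    then show ?thesis using a_col[OF pP' \<open>n \<in> P'\<close>] n a_L by simp
  qed
  show ne': "k \<noteq> a p" using k LB by blast
  show j': "join B (a p) k \<in> B" "a p \<in> join B (a p) k" "k \<in> join B (a p) k" using join[of "a p" k] k ne' by auto
  show "join B (a p) k \<noteq> L" using j' k by blast
qed

text \<open>If \<open>(g, h)\<close> respects the correspondence at one base pair, then on the two lines it acts by a
  conjugate pair of symmetries. This makes the pairs respecting a given base pair a group.\<close>

lemma base_conjug: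
  assumes b: "base n k" and g: "trl g" and h: "trr h" and c: "corr (g n) (h k)"
  obtains t t' where "conjug L t t'" "\<And>q. q \<in> join B p n \<Longrightarrow> q \<noteq> p \<Longrightarrow> g q = t q"
    "\<And>q. q \<in> join B (a p) k \<Longrightarrow> q \<noteq> a p \<Longrightarrow> h q = t' q"
proof -
  note j = baseD[OF b]
  obtain t where t: "symm L t" "\<forall>q\<in>join B p n - {p}. g q = t q" using transl_on[OF g j(1,2,5)] by blast
  have "axis (a ` L)" using tp(2) LB L(3) unfolding tpoint_def by simp
  then obtain t' where t': "conjug L t t'" using conjug_ex[OF L(1) _ t(1)] by blast
  have st': "symm L t'" using t' L(3) unfolding conjug_def by simp
  have "corr n k" using b unfolding base_def by blast
  then have "corr (t n) (t' k)" using conjug_corr[OF L(1) t'] by blast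
  moreover have "g n = t n" using t j by blast
  moreover have "h k \<in> join B (a p) k" using transl_line[OF h j(6,7,8)] .
  moreover have "t' k \<in> join B (a p) k" using symm_line[OF st' j(6,7) LB(2) j(8)] .
  \<comment> \<open>Both points correspond to \<open>g n = t n\<close> and lie on one line through
    \<open>a p\<close>.\<close>
  ultimately have "h k = t' k" using corr_line_unique[OF c] colI[OF j(6)] by simp
  then have "h q = t' q" if "q \<in> join B (a p) k" "q \<noteq> a p" for q
    using transl_acts[OF h LB j(6,7,10,8,9) st' _ that] by blast
  then show ?thesis using that[OF t'] t by blast
qed

lemma corr_comp:
  assumes b: "base n k" and g: "trl g" "trr h" "corr (g n) (h k)" and f: "trl f" "trr e" "corr (f n) (e k)"
  shows "corr ((f \<circ> g) n) ((e \<circ> h) k)"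
proof -
  note j = baseD[OF b]
  obtain t t' where t: "conjug L t t'" "\<And>q. q \<in> join B p n \<Longrightarrow> q \<noteq> p \<Longrightarrow> f q = t q"
    "\<And>q. q \<in> join B (a p) k \<Longrightarrow> q \<noteq> a p \<Longrightarrow> e q = t' q" using base_conjug[OF b f] by blast
  have "g n \<in> join B p n" "g n \<noteq> p"
    using transl_minus[OF g(1) pP j(1,2)] j by blast+
  moreover have "h k \<in> join B (a p) k" "h k \<noteq> a p"
    using transl_minus[OF g(2) rP j(6,7)] j by blast+
  ultimately have "f (g n) = t (g n)" "e (h k) = t' (h k)" using t by blast+
  then show ?thesis using conjug_corr[OF L(1) t(1) g(3)] by simp
qed

lemma corr_inv:
  assumes b: "base n k" and g: "trl g" "trr h" "corr (g n) (h k)"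
  shows "corr (inv g n) (inv h k)"
proof -
  note j = baseD[OF b]
  obtain t t' where t: "conjug L t t'" "\<And>q. q \<in> join B p n \<Longrightarrow> q \<noteq> p \<Longrightarrow> g q = t q"
    "\<And>q. q \<in> join B (a p) k \<Longrightarrow> q \<noteq> a p \<Longrightarrow> h q = t' q" using base_conjug[OF b g] by blast
  have st: "symm L t" "symm (a ` L) t'" using t unfolding conjug_def by auto
  obtain q where q: "q \<in> join B p n - {p}" "n = g q" using transl_minus[OF g(1) pP j(1,2)] j by blast
  obtain q' where q': "q' \<in> join B (a p) k - {a p}" "k = h q'" using transl_minus[OF g(2) rP j(6,7)] j by blast
  have "inv g n = q" "inv h k = q'" using q q' aut_inv_simp(2)[OF transl_aut] g by auto
  moreover have "n = t q" "k = t' q'" using q q' t by auto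
  then have "q = inv t n" "q' = inv t' k" using aut_inv_simp(2)[OF symm_aut] st by auto
  moreover have "corr n k" using b unfolding base_def by blast
  ultimately show ?thesis using conjug_corr[OF L(1) conjug_inv[OF L(1) t(1)]] by simp
qed

text \<open>One partner \<open>h\<close> has to serve all pairs in \<open>S\<close> at once; this is
  what allows \<open>frame_unique\<close> to transfer information from one pair to another.\<close>

definition tracked :: "('p \<times> 'p) set \<Rightarrow> ('p \<Rightarrow> 'p) set" where
  "tracked S = {g. trl g \<and> (\<exists>h. trr h \<and> (\<forall>(n, k)\<in>S. corr (g n) (h k)))}"

lemma tracked_comp: assumes "\<forall>(n, k)\<in>S. base n k" "f \<in> tracked S" "g \<in> tracked S" shows "f \<circ> g \<in> tracked S"
proof -
  obtain h where g: "trl g" "trr h" "\<forall>(n, k)\<in>S. corr (g n) (h k)" using assms(3) unfolding tracked_def by blast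
  obtain e where f: "trl f" "trr e" "\<forall>(n, k)\<in>S. corr (f n) (e k)" using assms(2) unfolding tracked_def by blast
  have "trl (f \<circ> g)" "trr (e \<circ> h)" using transl_comp g f pP rP by blast+
  moreover have "\<forall>(n, k)\<in>S. corr ((f \<circ> g) n) ((e \<circ> h) k)"
    using corr_comp g f assms(1) by blast
  ultimately show ?thesis unfolding tracked_def by blast
qed

lemma tracked_inv: assumes "\<forall>(n, k)\<in>S. base n k" "g \<in> tracked S" shows "inv g \<in> tracked S"
proof -
  obtain h where g: "trl g" "trr h" "\<forall>(n, k)\<in>S. corr (g n) (h k)" using assms(2) unfolding tracked_def by blast
  have "trl (inv g)" "trr (inv h)" using transl_inv g pP rP by blast+
  moreover have "\<forall>(n, k)\<in>S. corr (inv g n) (inv h k)"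
    using corr_inv g assms(1) by blast
  ultimately show ?thesis unfolding tracked_def by blast
qed

text \<open>A group is not the union of two proper subgroups.\<close>

lemma tracked_union:
  assumes S: "\<forall>(n, k)\<in>S. base n k" and T: "\<forall>(n, k)\<in>T. base n k"
    and cov: "\<And>g. trl g \<Longrightarrow> g \<in> tracked S \<or> g \<in> tracked T"
  shows "(\<forall>g. trl g \<longrightarrow> g \<in> tracked S) \<or> (\<forall>g. trl g \<longrightarrow> g \<in> tracked T)"
proof (rule ccontr)
  assume "\<not> ?thesis"
  then obtain f g where f: "trl f" "f \<notin> tracked S" and g: "trl g" "g \<notin> tracked T" by blast
  have fT: "f \<in> tracked T" and gS: "g \<in> tracked S" using cov f g by blast+
  have "f \<circ> g \<in> tracked S \<or> f \<circ> g \<in> tracked T" using cov[OF transl_comp[OF f(1) g(1) pP]] .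
  then show False
  proof
    assume "f \<circ> g \<in> tracked S"
    then have "(f \<circ> g) \<circ> inv g \<in> tracked S" using tracked_comp[OF S] tracked_inv[OF S gS] by blast
    moreover have "(f \<circ> g) \<circ> inv g = f" using aut_inv_simp(1)[OF transl_aut[OF g(1)]] by (simp add: fun_eq_iff)
    ultimately show False using f by simp
  next
    assume "f \<circ> g \<in> tracked T"
    then have "inv f \<circ> (f \<circ> g) \<in> tracked T" using tracked_comp[OF T] tracked_inv[OF T fT] by blast
    moreover have "inv f \<circ> (f \<circ> g) = g" using aut_inv_simp(2)[OF transl_aut[OF f(1)]] by (simp add: fun_eq_iff)
    ultimately show False using g by simp
  qed
qed

end

section \<open>Frames, and the independence of the chosen line through \<open>p\<close>\<close>

locale ovoid_auto_based = ovoid_auto P B s P' B' a L p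
  for P :: "'p set" and B s P' B' a L p +
  fixes z0 :: 'p
  assumes z0P': "z0 \<in> P'" and z0: "\<not> p \<sim> z0"
begin

lemma z0P: "z0 \<in> P" using z0P' P'_P by blast

lemma ro: "\<not> a p \<sim> a z0" using a_col[OF pP' z0P'] z0 by simp

text \<open>With \<open>z0\<close> as origin, the points opposite \<open>p\<close> are the
  \<open>g z0\<close> for translations \<open>g\<close>. Each line through \<open>p\<close> has
  exactly one point in \<open>C\<close>, so \<open>C\<close> indexes these lines.\<close>

abbreviation "C \<equiv> nbrs B p z0"

lemma C_D: "n \<in> C \<Longrightarrow> p \<sim> n" "n \<in> C \<Longrightarrow> n \<sim> z0" "n \<in> C \<Longrightarrow> n \<noteq> p"
  using nbrs_neq[OF z0] csym unfolding nbrs_def by blast+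

lemma transl_opp: assumes "transl q L g" "q \<in> P" shows "q \<sim> g x \<longleftrightarrow> q \<sim> x"
  using aut_col[OF transl_aut[OF assms(1)], of q x] transl_fixes[OF assms] by simp

lemma over_C: assumes "over n k" "n \<in> C" shows "k \<sim> a z0" "a p \<sim> k" "base n k"
proof -
  show "k \<sim> a z0" using over_Ov[OF assms(1) z0P'] C_D(2)[OF assms(2)] by simp
  show "a p \<sim> k" using over_r[OF assms(1) C_D(1)[OF assms(2)]] .
  show "base n k" unfolding base_def
    using C_D[OF assms(2)] over_A[OF assms(1)] B'_P'[OF L(1)] over_corr[OF assms(1)] by blast
qed

lemma P'_C: assumes "c \<in> C" "c \<in> P'" "c \<notin> L" shows "base c (a c)" "a c \<sim> a z0"
proof -
  show "base c (a c)" unfolding base_def corr_def using C_D[OF assms(1)] assms by blast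
  show "a c \<sim> a z0" using a_col[OF assms(2) z0P'] C_D(2)[OF assms(1)] by simp
qed

text \<open>Both \<open>h (a c)\<close> and \<open>a (g c)\<close> are the projection of
  \<open>h (a z0)\<close> onto the line through \<open>a p\<close> and \<open>a c\<close>, so no
  choice arises inside the subquadrangle.\<close>

lemma corr_P':
  assumes g: "trl g" and h: "trr h" and x: "corr (g z0) (h (a z0))" and c: "c \<in> C" "c \<in> P'" "c \<notin> L"
  shows "corr (g c) (h (a c))"
proof -
  note j = baseD[OF P'_C(1)[OF c]]
  have jB: "join B p c \<in> B'" using line_in_B'[OF j(1-3)] j(4) pP' c by blast
  have ac: "a ` join B p c = join B (a p) (a c)"
  proof -
    have "a ` join B p c \<in> B" using a_line[OF jB] B'_B by blast
    moreover have "a p \<in> a ` join B p c" "a c \<in> a ` join B p c" using j by blast+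
    ultimately show ?thesis using join_eq[of "a ` join B p c" "a p" "a c"] j(9) by simp
  qed
  have gc: "g c \<in> join B p c" using transl_line[OF g j(1-3)] .
  have gcP: "g c \<in> P'" using gc jB B'_P' by blast
  have "g c \<sim> g z0" using aut_col[OF transl_aut[OF g]] C_D(2)[OF c(1)] by simp
  then have "a (g c) \<sim> h (a z0)"
  proof (cases "over (g z0) (h (a z0))")
    case True
    then show ?thesis using over_Ov[OF True gcP] \<open>g c \<sim> g z0\<close> csym by blast
  next
    case False
    then have "g z0 \<in> P'" "h (a z0) = a (g z0)" using x unfolding corr_def by auto
    then show ?thesis using a_col[OF gcP] \<open>g c \<sim> g z0\<close> by simp
  qed
  moreover have "h (a c) \<sim> h (a z0)" using aut_col[OF transl_aut[OF h]] P'_C(2)[OF c] by simp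
  moreover have "h (a c) \<in> join B (a p) (a c)" using transl_line[OF h j(6-8)] .
  moreover have "a (g c) \<in> join B (a p) (a c)" using gc ac by blast
  moreover have "\<not> a p \<sim> h (a z0)" using transl_opp[OF h rP] ro by simp
  ultimately have "h (a c) = a (g c)"
    using proj_eq[of "h (a z0)" "join B (a p) (a c)" "h (a c)" "a (g c)"] colI[OF j(6,7)] j(6) csym
      col_in(2)[of "h (a c)" "h (a z0)"] by blast
  then show ?thesis using gcP unfolding corr_def by blast
qed

text \<open>If \<open>g z0\<close> lies in \<open>P'\<close>, every candidate over
  \<open>g n\<close> is collinear with \<open>a (g z0)\<close>, because the ovoids correspond. Hence
  the candidate on the line through \<open>a p\<close> and \<open>k\<close> is
  \<open>h k\<close>.\<close>

lemma corr_A_P':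
  assumes g: "trl g" and h: "trr h" and x: "g z0 \<in> P'" "h (a z0) = a (g z0)" and n: "n \<in> C" "over n k"
  shows "corr (g n) (h k)"
proof -
  note j = baseD[OF over_C(3)[OF n(2,1)]]
  have gn: "g n \<in> join B p n" "g n \<noteq> p" using transl_minus[OF g pP j(1,2)] j by blast+
  obtain w where w: "w \<in> join B (a p) k" "over (g n) w" using lift_on[OF n(2) C_D(1)[OF n(1)] gn] .
  have "g n \<sim> g z0" using aut_col[OF transl_aut[OF g]] C_D(2)[OF n(1)] by simp
  then have "w \<sim> h (a z0)" using over_Ov[OF w(2) x(1)] x(2) by simp
  moreover have "h k \<sim> h (a z0)" using aut_col[OF transl_aut[OF h]] over_C(1)[OF n(2,1)] by simp
  moreover have "h k \<in> join B (a p) k" using transl_line[OF h j(6-8)] .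
  moreover have "\<not> a p \<sim> h (a z0)" using transl_opp[OF h rP] ro by simp
  ultimately have "h k = w"
    using proj_eq[of "h (a z0)" "join B (a p) k" "h k" w] colI[OF j(6,7)] j(6) csym w(1)
      col_in(2)[of w "h (a z0)"] by blast
  then show ?thesis using over_corr w by simp
qed

text \<open>\<open>g n\<close> and \<open>h k\<close> are the projections of \<open>g z0\<close> and
  \<open>h (a z0)\<close> onto the two chosen lines. This translates the rule for points into a
  condition on pairs of translations.\<close>

lemma follows_iff:
  assumes g: "trl g" and h: "trr h" and x: "over (g z0) (h (a z0))" and n: "n \<in> C" "over n k"
  shows "follows n k (g z0) (h (a z0)) \<longleftrightarrow> corr (g n) (h k)"
proof -
  note j = baseD[OF over_C(3)[OF n(2,1)]]
  have gn: "g n \<in> join B p n" "g n \<noteq> p" using transl_minus[OF g pP j(1,2)] j by blast+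
  have hk: "h k \<in> join B (a p) k" using transl_line[OF h j(6-8)] .
  have c: "g n \<sim> g z0" using aut_col[OF transl_aut[OF g]] C_D(2)[OF n(1)] by simp
  have d: "h k \<sim> h (a z0)" using aut_col[OF transl_aut[OF h]] over_C(1)[OF n(2,1)] by simp
  have gnA: "g n \<in> A" using radial(4)[OF pP' over_A(1)[OF n(2)] C_D(1)[OF n(1)] gn] .
  have ox: "\<not> p \<sim> g z0" "\<not> a p \<sim> h (a z0)" using transl_opp[OF g pP] transl_opp[OF h rP] z0 ro by auto
  show ?thesis
  proof
    assume "follows n k (g z0) (h (a z0))"
    then obtain m m' where m: "m \<in> join B p n" "m \<sim> g z0" "m' \<in> join B (a p) k" "m' \<sim> h (a z0)" "over m m'"
      unfolding follows_def by blast
    have "m = g n" using proj_radial[OF pP' over_A(1)[OF n(2)] C_D(1)[OF n(1)] over_P(1)[OF x] ox(1)] m gn c by metis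
    moreover have "m' = h k"
      using proj_radial[OF rP' over_A(2)[OF n(2)] over_C(2)[OF n(2,1)] over_P(2)[OF x] ox(2)] m hk d by metis
    ultimately show "corr (g n) (h k)" using m over_corr by simp
  next
    assume "corr (g n) (h k)"
    then have "over (g n) (h k)" using gnA unfolding corr_def by blast
    then show "follows n k (g z0) (h (a z0))" unfolding follows_def using x gn hk c d by blast
  qed
qed

text \<open>At least \<open>s\<close> pairs come from the subquadrangle and two from the twins: the
  \<open>s + 2\<close> records that exceed the \<open>s + 1\<close> centres of a triad.\<close>

definition frame :: "'p \<Rightarrow> 'p \<Rightarrow> ('p \<times> 'p) set" where
  "frame n k = {(n, k), (tw n, tw k)} \<union> {(c, a c) | c. c \<in> C \<and> c \<in> P' \<and> c \<notin> L}"

lemma tw_C: assumes "n \<in> C" "n \<in> A" shows "tw n \<in> C"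
proof -
  have "p \<in> Ov n" "z0 \<in> Ov n" using C_D[OF assms(1)] pP' z0P' csym unfolding Ov_iff by blast+
  then have "p \<in> Ov (tw n)" "z0 \<in> Ov (tw n)" using tw(3)[OF assms(2)] by auto
  then show ?thesis using csym unfolding Ov_iff nbrs_def by blast
qed

lemma frame_base: assumes "n \<in> C" "over n k" shows "\<forall>(u, v)\<in>frame n k. base u v"
  using over_C(3)[OF assms(2,1)] over_C(3)[OF over_tw(3)[OF assms(2)] tw_C[OF assms(1) over_A(1)[OF assms(2)]]]
    P'_C(1) unfolding frame_def by blast

text \<open>The partner sends \<open>a z0\<close> to \<open>a (g z0)\<close> if \<open>g z0\<close>
  is in \<open>P'\<close>, and then fits both alternatives. Otherwise it sends \<open>a z0\<close>
  to the candidate dictated by \<open>(n, k)\<close>; the one dictated by \<open>(m, j)\<close> is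
  the same or its twin, and \<open>tw j\<close> corrects the latter.\<close>

lemma frame_cover:
  assumes n: "n \<in> C" "over n k" and m: "m \<in> C" "over m j" and g: "trl g"
  shows "g \<in> tracked (insert (m, j) (frame n k)) \<or> g \<in> tracked (insert (m, tw j) (frame n k))"
proof -
  have Lr: "L \<in> B" "a p \<in> L" using LB by auto
  have gox: "\<not> p \<sim> g z0" using transl_opp[OF g pP] z0 by simp
  have tn: "tw n \<in> C" "over (tw n) (tw k)" using tw_C[OF n(1) over_A(1)[OF n(2)]] over_tw(3)[OF n(2)] by auto
  have goP: "g z0 \<in> P" using aut_in[OF transl_aut[OF g]] z0P by simp
  have aoP: "a z0 \<in> P" using P'_P a_in z0P' by blast
  show ?thesis
  proof (cases "g z0 \<in> P'")
    case True
    have "\<not> a p \<sim> a (g z0)" using a_col[OF pP' True] gox by simp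
    moreover have "a (g z0) \<in> P" using P'_P a_in True by blast
    ultimately obtain h where h: "trr h" "h (a z0) = a (g z0)"
      using transl_trans[OF tp(2) Lr aoP ro] by blast
    have c: "corr (g z0) (h (a z0))" using h True unfolding corr_def by simp
    have "\<forall>(u, v)\<in>insert (m, j) (frame n k). corr (g u) (h v)"
      using corr_P'[OF g h(1) c] corr_A_P'[OF g h(1) True h(2)] n m tn unfolding frame_def by blast
    then show ?thesis using g h(1) unfolding tracked_def by blast
  next
    case False
    then have xA: "g z0 \<in> A" using goP by blast
    obtain z where z: "follows n k (g z0) z" using follows_ex[OF n(2) C_D(1)[OF n(1)] xA gox] .
    note ov = follows_over[OF z]
    have "\<not> a p \<sim> z" using over_not_r[OF ov gox] .
    then obtain h where h: "trr h" "h (a z0) = z" using transl_trans[OF tp(2) Lr aoP ro over_P(2)[OF ov]] by blast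
    have ov': "over (g z0) (h (a z0))" using ov h by simp
    have 1: "corr (g n) (h k)" using follows_iff[OF g h(1) ov' n] z h by simp
    have "follows (tw n) (tw k) (g z0) z" using follows_tw2[OF n(2) C_D(1)[OF n(1)] gox z] .
    then have 2: "corr (g (tw n)) (h (tw k))" using follows_iff[OF g h(1) ov' tn] h by simp
    have fr: "\<forall>(u, v)\<in>frame n k. corr (g u) (h v)"
      using 1 2 corr_P'[OF g h(1) over_corr[OF ov']] unfolding frame_def by blast
    obtain w where w: "follows m j (g z0) w" using follows_ex[OF m(2) C_D(1)[OF m(1)] xA gox] .
    have "w = z \<or> w = tw z" using over_two[OF ov follows_over[OF w]] .
    then have "follows m j (g z0) z \<or> follows m (tw j) (g z0) z"
      using w follows_tw(1)[OF m(2) C_D(1)[OF m(1)] w] tw_tw[OF over_A(2)[OF ov]] by auto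
    then have "corr (g m) (h j) \<or> corr (g m) (h (tw j))"
      using follows_iff[OF g h(1) ov' m] follows_iff[OF g h(1) ov' m(1) over_tw(1)[OF m(2)]] h by simp
    then show ?thesis using fr g h(1) unfolding tracked_def by blast
  qed
qed

text \<open>Of the \<open>s + 1\<close> common neighbours in the subquadrangle at most one lies on
  \<open>L\<close>, namely the projection of \<open>z0\<close>.\<close>

lemma card_frame_P': "s \<le> card {c. c \<in> C \<and> c \<in> P' \<and> c \<notin> L}"
proof -
  let ?K = "{c \<in> C. c \<in> P'}"
  have "?K = nbrs B' p z0"
    unfolding nbrs_def using col_col'[OF pP'] col_col'[OF z0P'] quad.col_in[OF sub] by blast
  moreover have "\<not> col B' p z0" using col'_col z0 by blast
  ultimately have cK: "card ?K = s + 1" using quad.card_nbrs[OF sub pP' z0P'] by simp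
  have oL: "z0 \<notin> L" using z0 colI[OF LB(1) L(2)] by blast
  obtain q where q: "q \<in> L" "z0 \<sim> q" using proj_ex[OF z0P LB(1) oL] by blast
  have "?K - {q} \<subseteq> {c. c \<in> C \<and> c \<in> P' \<and> c \<notin> L}"
    using proj_eq[OF z0P LB(1) oL _ q(1) _ q(2)] C_D csym by blast
  moreover have "finite {c. c \<in> C \<and> c \<in> P' \<and> c \<notin> L}" using fin_nbrs[of p z0] by (rule rev_finite_subset) blast
  ultimately have "card (?K - {q}) \<le> card {c. c \<in> C \<and> c \<in> P' \<and> c \<notin> L}" by (rule card_mono[rotated])
  moreover have "s \<le> card (?K - {q})" using cK by (simp add: card_Diff_singleton_if)
  ultimately show ?thesis by simp
qed

text \<open>Two translates of \<open>a z0\<close> that agree on a frame share \<open>s + 2\<close> neighbours in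
  \<open>(a p)\<^sup>\<bottom>\<close>, one more than a triad has centres.\<close>

lemma frame_unique:
  assumes n: "n \<in> C" "over n k" and g: "trl g" and h: "trr h" and e: "trr e"
    and ch: "\<forall>(u, v)\<in>frame n k. corr (g u) (h v)" and ce: "\<forall>(u, v)\<in>frame n k. corr (g u) (e v)"
  shows "h (a z0) = e (a z0)"
proof (rule ccontr)
  assume ne: "h (a z0) \<noteq> e (a z0)"
  let ?S = "{c. c \<in> C \<and> c \<in> P' \<and> c \<notin> L}" and ?r = "a p" and ?z = "h (a z0)" and ?w = "e (a z0)"
  let ?V = "{k, tw k} \<union> a ` ?S"
  have eq: "h v = e v" if "(u, v) \<in> frame n k" for u v
  proof -
    have "base u v" using frame_base[OF n] that by blast
    note j = baseD[OF this]
    have "h v \<sim> e v" using colI[OF j(6)] transl_line[OF h j(6-8)] transl_line[OF e j(6-8)] by blast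
    then show ?thesis using corr_line_unique ch ce that by blast
  qed
  have tn: "tw n \<in> C" "over (tw n) (tw k)" using tw_C[OF n(1) over_A(1)[OF n(2)]] over_tw(3)[OF n(2)] by auto
  have Vn: "?r \<sim> v \<and> v \<sim> a z0 \<and> h v = e v" if "v \<in> ?V" for v
  proof -
    consider "v = k" | "v = tw k" | c where "c \<in> C" "c \<in> P'" "c \<notin> L" "v = a c" using \<open>v \<in> ?V\<close> by blast
    then show ?thesis
    proof cases
      case 1 then show ?thesis using over_C[OF n(2,1)] eq[of n k] unfolding frame_def by simp
    next
      case 2 then show ?thesis using over_C[OF tn(2,1)] eq[of "tw n" "tw k"] unfolding frame_def by simp
    next
      case 3
      then have "(c, v) \<in> frame n k" unfolding frame_def by blast
      then show ?thesis using P'_C(2)[of c] a_col[OF pP', of c] C_D(1)[of c] 3 eq by simp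
    qed
  qed
  have Vh: "?r \<sim> h v \<and> h v \<sim> ?z \<and> h v \<sim> ?w" if "v \<in> ?V" for v
  proof -
    note v = Vn[OF that]
    have "?r \<sim> h v" using transl_opp[OF h rP, of v] v by blast
    moreover have "h v \<sim> ?z" using aut_col[OF transl_aut[OF h], of v "a z0"] v by blast
    moreover have "e v \<sim> ?w" using aut_col[OF transl_aut[OF e], of v "a z0"] v by blast
    ultimately show ?thesis using v by simp
  qed
  have rz: "\<not> ?r \<sim> ?z" "\<not> ?r \<sim> ?w" using transl_opp[OF h rP] transl_opp[OF e rP] ro by auto
  have aoP: "a z0 \<in> P" using P'_P a_in z0P' by blast
  have zP: "?z \<in> P" "?w \<in> P" using aut_in[OF transl_aut[OF h]] aut_in[OF transl_aut[OF e]] aoP by auto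
  have kA: "k \<in> A" "tw k \<in> A" "k \<noteq> tw k" using over_A[OF n(2)] tw(1,2)[of k] by auto
  \<comment> \<open>If the two were collinear, \<open>h k\<close> and \<open>h (tw k)\<close> would
    be distinct points of their line collinear with \<open>a p\<close>. So the twin pair also
    ensures that there is a triad.\<close>
  have zw: "\<not> ?z \<sim> ?w"
  proof
    assume c: "?z \<sim> ?w"
    note j = join[OF c ne]
    have 1: "h v \<in> join B ?z ?w" if "v \<in> ?V" for v using triangle[OF j ne] Vh[OF that] by blast
    have "?r \<notin> join B ?z ?w" using rz(1) colI[OF j(1) _ j(2)] by blast
    then have "h k = h (tw k)" using proj_eq[OF rP j(1), of "h k" "h (tw k)"] 1 Vh by blast
    then show False using aut_eq[OF transl_aut[OF h]] kA by simp
  qed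
  have "h ` ?V \<subseteq> {u \<in> nbrs B ?r ?z. u \<sim> ?w}" using Vh csym unfolding nbrs_def by blast
  moreover have "finite {u \<in> nbrs B ?r ?z. u \<sim> ?w}" using fin_nbrs by simp
  ultimately have "card (h ` ?V) \<le> card {u \<in> nbrs B ?r ?z. u \<sim> ?w}" by (rule card_mono[rotated])
  then have "card (h ` ?V) \<le> s + 1" unfolding card_centres[OF rP zP rz zw] .
  moreover have "card (h ` ?V) = card ?V"
    by (rule card_image) (rule inj_on_subset[OF aut_bij(2)[OF transl_aut[OF h]] subset_UNIV])
  moreover have "card ?V = 2 + card ?S"
  proof -
    have fS: "finite ?S" using fin_nbrs[of p z0] by (rule rev_finite_subset) blast
    have "a ` ?S \<subseteq> P'" using a_in by (simp add: image_subset_iff)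
    then have "{k, tw k} \<inter> a ` ?S = {}" using kA(1,2) by blast
    then have "card ?V = card {k, tw k} + card (a ` ?S)" using fS by (intro card_Un_disjoint) auto
    moreover have "card (a ` ?S) = card ?S" by (rule card_image) (simp add: inj_on_def a_eq)
    ultimately show ?thesis using kA by simp
  qed
  ultimately show False using card_frame_P' by simp
qed

text \<open>One of the choices \<open>j\<close>, \<open>tw j\<close> provides partners for all
  translations, by \<open>tracked_union\<close>. As translations carry \<open>z0\<close> to every
  point opposite \<open>p\<close>, this compares the two rules everywhere.\<close>

theorem follows_match:
  assumes n: "n \<in> C" "over n k" and m: "m \<in> C" "m \<in> A"
  obtains j where "over m j" "\<And>x z. x \<in> A \<Longrightarrow> \<not> p \<sim> x \<Longrightarrow> follows n k x z \<Longrightarrow> follows m j x z"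
proof -
  have main: "follows m i x z"
    if all: "\<forall>g. trl g \<longrightarrow> g \<in> tracked (insert (m, i) (frame n k))" and mi: "over m i"
      and x: "x \<in> A" "\<not> p \<sim> x" and z: "follows n k x z" for i x z
  proof -
    have xP: "x \<in> P" using x by blast
    note ov = follows_over[OF z]
    obtain g where g: "trl g" "g z0 = x" using transl_trans[OF tp(1) LB(1) L(2) z0P z0 xP x(2)] by blast
    have aoP: "a z0 \<in> P" using P'_P a_in z0P' by blast
    obtain h where h: "trr h" "h (a z0) = z"
      using transl_trans[OF tp(2) LB aoP ro over_P(2)[OF ov] over_not_r[OF ov x(2)]] by blast
    have ov': "over (g z0) (h (a z0))" using ov g h by simp
    have tn: "tw n \<in> C" "over (tw n) (tw k)" using tw_C[OF n(1) over_A(1)[OF n(2)]] over_tw(3)[OF n(2)] by auto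
    have "corr (g n) (h k)" using follows_iff[OF g(1) h(1) ov' n] z g h by simp
    moreover have "follows (tw n) (tw k) x z" using follows_tw2[OF n(2) C_D(1)[OF n(1)] x(2) z] .
    then have "corr (g (tw n)) (h (tw k))" using follows_iff[OF g(1) h(1) ov' tn] g h by simp
    ultimately have ch: "\<forall>(u, v)\<in>frame n k. corr (g u) (h v)"
      using corr_P'[OF g(1) h(1) over_corr[OF ov']] unfolding frame_def by blast
    obtain e where e: "trr e" "\<forall>(u, v)\<in>insert (m, i) (frame n k). corr (g u) (e v)"
      using all g(1) unfolding tracked_def by blast
    \<comment> \<open>The tracked partner \<open>e\<close> agrees with \<open>h\<close> on the
      frame, hence at \<open>a z0\<close>; so its compatibility with \<open>(m, i)\<close> speaks
      about \<open>z\<close>.\<close>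
    have "e (a z0) = z" using frame_unique[OF n g(1) h(1) e(1) ch] e(2) h(2) by simp
    then have "over (g z0) (e (a z0))" using ov g by simp
    moreover have "corr (g m) (e i)" using e by simp
    ultimately show ?thesis using follows_iff[OF g(1) e(1) _ m(1) mi] g \<open>e (a z0) = z\<close> by simp
  qed
  obtain j where j: "over m j" using over_ex[OF m(2)] by blast
  have b: "base m j" "base m (tw j)" using over_C(3) j over_tw(1)[OF j] m by blast+
  have "(\<forall>g. trl g \<longrightarrow> g \<in> tracked (insert (m, j) (frame n k))) \<or>
        (\<forall>g. trl g \<longrightarrow> g \<in> tracked (insert (m, tw j) (frame n k)))"
    by (rule tracked_union) (use b frame_base[OF n] frame_cover[OF n m(1) j] in auto)
  then show ?thesis using main that j over_tw(1)[OF j] by metis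
qed

end

section \<open>The extension\<close>

locale ovoid_auto_framed = ovoid_auto_based P B s P' B' a L p z0
  for P :: "'p set" and B s P' B' a L p z0 +
  fixes n k :: 'p
  assumes nC: "n \<in> C" and nk: "over n k"
begin

lemma pn: "p \<sim> n" using C_D(1)[OF nC] .

text \<open>For \<open>q\<close> collinear with \<open>p\<close>, projection onto the line through
  \<open>p\<close> and \<open>n\<close> says nothing in general. Its image is instead fixed by the
  images of its neighbours opposite \<open>p\<close>.\<close>

definition target :: "'p \<Rightarrow> 'p \<Rightarrow> bool" where
  "target q w \<longleftrightarrow> over q w \<and>
    (if p \<sim> q then \<forall>x\<in>A. \<forall>z. \<not> p \<sim> x \<and> x \<sim> q \<and> follows n k x z \<longrightarrow> z \<sim> w else follows n k q w)"

lemma target_over: "target q w \<Longrightarrow> over q w"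
  unfolding target_def by blast

lemma target_opp: "\<not> p \<sim> q \<Longrightarrow> target q w \<longleftrightarrow> follows n k q w"
  unfolding target_def using follows_over by auto

lemma opp_nbr: assumes "q \<in> A" "p \<sim> q" obtains x where "x \<in> A" "\<not> p \<sim> x" "x \<sim> q"
proof -
  have qP: "q \<in> P" using assms by blast
  obtain m where m: "m \<in> B" "q \<in> m" "m \<noteq> join B p q" using other_line[OF qP] by metis
  obtain x where x: "x \<in> m" "x \<in> A" "x \<noteq> q" using A_nbr[OF assms(1) m(1,2)] .
  have "\<not> p \<sim> x"
  proof
    assume "p \<sim> x"
    then have "p \<in> m" using triangle[OF m(1,2) x(1) x(3)[symmetric] assms(2)] by blast
    then show False using join_eq[OF m(1) _ m(2), of p] m(3) assms(1) pP' by blast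
  qed
  then show ?thesis using that x colI[OF m(1)] m(2) by blast
qed

text \<open>Moves the base pair to the line through \<open>p\<close> and \<open>q\<close> without
  changing the rule. For points \<open>x\<close> projecting to \<open>q\<close> the rule is then
  collinearity with one fixed candidate over \<open>q\<close>.\<close>

lemma near: assumes "q \<in> A" "p \<sim> q"
  obtains m j where "m \<in> C" "over m j" "q \<in> join B p m" "q \<noteq> p"
    "\<And>x z. x \<in> A \<Longrightarrow> \<not> p \<sim> x \<Longrightarrow> follows n k x z \<Longrightarrow> follows m j x z"
proof -
  note jq = radial[OF pP' assms]
  obtain m where m: "m \<in> join B p q" "m \<sim> z0" "m \<in> A" using proj_radial[OF pP' assms z0P z0] by metis
  have mp: "m \<noteq> p" using m pP' by blast
  have mC: "m \<in> C" using colI[OF jq(1,2) m(1)] m(2) csym unfolding nbrs_def by blast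
  have "q \<in> join B p m" using jq(5)[OF m(1) mp] jq(3) by simp
  moreover have "q \<noteq> p" using assms pP' by blast
  moreover obtain j where "over m j" "\<And>x z. x \<in> A \<Longrightarrow> \<not> p \<sim> x \<Longrightarrow> follows n k x z \<Longrightarrow> follows m j x z"
    using follows_match[OF nC nk mC m(3)] by blast
  ultimately show ?thesis using that mC by blast
qed

lemma near_proj: assumes m: "m \<in> C" "over m j" and q: "q \<in> join B p m"
    and x: "\<not> p \<sim> x" "x \<sim> q" and f: "follows m j x z"
  obtains w where "w \<in> join B (a p) j" "over q w" "w \<sim> z"
proof -
  obtain h h' where h: "h \<in> join B p m" "h \<sim> x" "h' \<in> join B (a p) j" "h' \<sim> z" "over h h'"
    using f unfolding follows_def by blast
  have "h = q" using proj_radial[OF pP' over_A(1)[OF m(2)] C_D(1)[OF m(1)] over_P(1)[OF follows_over[OF f]] x(1)]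
      h q x(2) csym by metis
  then show ?thesis using that h by blast
qed

lemma near_same: assumes m: "m \<in> C" "over m j" and w: "w \<in> join B (a p) j" "w' \<in> join B (a p) j" "over q w" "over q w'"
  shows "w = w'"
  using corr_line_unique[OF over_corr[OF w(3)] over_corr[OF w(4)]]
    colI[OF radial(1)[OF rP' over_A(2)[OF m(2)] over_C(2)[OF m(2,1)]] w(1,2)] .

lemma near_target:
  assumes m: "m \<in> C" "over m j" "q \<in> join B p m" "q \<noteq> p"
    and match: "\<And>x z. x \<in> A \<Longrightarrow> \<not> p \<sim> x \<Longrightarrow> follows n k x z \<Longrightarrow> follows m j x z"
    and w: "w \<in> join B (a p) j" "over q w"
  shows "target q w"
proof -
  have pq: "p \<sim> q" using colI[OF radial(1,2)[OF pP' over_A(1)[OF m(2)] C_D(1)[OF m(1)]] m(3)] .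
  have "z \<sim> w" if x: "x \<in> A" "\<not> p \<sim> x" "x \<sim> q" "follows n k x z" for x z
  proof -
    obtain v where v: "v \<in> join B (a p) j" "over q v" "v \<sim> z" using near_proj[OF m(1-3) x(2,3) match[OF x(1,2,4)]] .
    then show ?thesis using near_same[OF m(1,2) w(1) v(1) w(2) v(2)] csym by blast
  qed
  then show ?thesis unfolding target_def using pq w by simp
qed

lemma target_ex: assumes "q \<in> A" shows "\<exists>w. target q w"
proof (cases "p \<sim> q")
  case True
  obtain m j where m: "m \<in> C" "over m j" "q \<in> join B p m" "q \<noteq> p"
    "\<And>x z. x \<in> A \<Longrightarrow> \<not> p \<sim> x \<Longrightarrow> follows n k x z \<Longrightarrow> follows m j x z" using near[OF assms True] by blast
  obtain w where "w \<in> join B (a p) j" "over q w" using lift_on[OF m(2) C_D(1)[OF m(1)] m(3,4)] .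
  then show ?thesis using near_target[OF m] by blast
next
  case False
  then show ?thesis using follows_ex[OF nk pn assms False] target_opp by blast
qed

lemma target_near: assumes "target q w" "p \<sim> q" "x \<in> A" "\<not> p \<sim> x" "x \<sim> q" "follows n k x z" shows "z \<sim> w"
  using assms unfolding target_def by auto

lemma target_unique: assumes w: "target q w" and v: "target q v" shows "w = v"
proof (cases "p \<sim> q")
  case True
  have qA: "q \<in> A" using over_A target_over w by blast
  obtain x where x: "x \<in> A" "\<not> p \<sim> x" "x \<sim> q" using opp_nbr[OF qA True] .
  obtain z where z: "follows n k x z" using follows_ex[OF nk pn x(1,2)] .
  have "z \<sim> w" "z \<sim> v" using target_near[OF _ True x z] w v by blast+
  moreover have "v = w \<or> v = tw w" using over_two target_over w v by blast
  ultimately show ?thesis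
    using col_tw_False[OF over_A(2)[OF target_over[OF w]] over_A(2)[OF follows_over[OF z]]] by blast
next
  case False
  then show ?thesis using follows_unique[OF nk pn False] target_opp w v by blast
qed

definition img :: "'p \<Rightarrow> 'p" where
  "img q = (if q \<in> P' then a q else if q \<in> A then THE w. target q w else q)"

lemma img_A: assumes "q \<in> A" shows "target q (img q)"
proof -
  have "\<exists>!w. target q w" using target_ex[OF assms] target_unique by blast
  then show ?thesis using theI'[of "target q"] assms unfolding img_def by simp
qed

text \<open>The line through distinct \<open>x\<close> and \<open>y\<close> has one point
  \<open>h\<close> collinear with \<open>p\<close>. Outside \<open>P'\<close>, \<open>h\<close>
  supplies a matched base line; inside, the line through \<open>p\<close> and \<open>h\<close> is an
  axis of the subquadrangle whose symmetries can be conjugated.\<close>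

lemma col_opp:
  assumes x: "x \<in> A" "\<not> p \<sim> x" "follows n k x z" and y: "y \<in> A" "\<not> p \<sim> y" "follows n k y w" and xy: "x \<sim> y"
  shows "z \<sim> w"
proof (cases "x = y")
  case True
  then have "z = w" using follows_unique[OF nk pn x(2,3)] y by blast
  then show ?thesis using col_refl over_P(2) follows_over y by blast
next
  case False
  let ?l = "join B x y"
  note l = join[OF xy False]
  have pl: "p \<notin> ?l" using colI[OF l(1) _ l(2)] x(2) by blast
  obtain h where h: "h \<in> ?l" "p \<sim> h" using proj_ex[OF pP l(1) pl] by blast
  have hxy: "h \<sim> x" "h \<sim> y" "x \<sim> h" "y \<sim> h" using colI[OF l(1)] h l by blast+
  show ?thesis
  proof (cases "h \<in> P'")
    case False
    then have hA: "h \<in> A" using h line_sub[OF l(1)] by blast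
    obtain m j where m: "m \<in> C" "over m j" "h \<in> join B p m" "h \<noteq> p"
      "\<And>x z. x \<in> A \<Longrightarrow> \<not> p \<sim> x \<Longrightarrow> follows n k x z \<Longrightarrow> follows m j x z" using near[OF hA h(2)] by blast
    obtain v where v: "v \<in> join B (a p) j" "over h v" "v \<sim> z" using near_proj[OF m(1-3) x(2) hxy(3) m(5)[OF x]] .
    obtain v' where v': "v' \<in> join B (a p) j" "over h v'" "v' \<sim> w" using near_proj[OF m(1-3) y(2) hxy(4) m(5)[OF y]] .
    have vv: "v' = v" using near_same[OF m(1,2) v'(1) v(1) v'(2) v(2)] .
    \<comment> \<open>Having \<open>z\<close> and \<open>w\<close> both collinear with
      \<open>v\<close> is not enough. The point of the line in \<open>P'\<close> gives both joins
      with \<open>v\<close> the second common point \<open>a u\<close>, so they coincide.\<close>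
    obtain u where u: "u \<in> ?l" "u \<in> P'" using line_meets_P'[OF x(1) l(1,2)] by blast
    have ne: "x \<noteq> h" "y \<noteq> h" using h x y by blast+
    have zv: "z \<sim> v" "w \<sim> v" using v v' vv csym by blast+
    have "u \<in> join B x h" "u \<in> join B y h"
      using join_eq[OF l(1,2) h(1) ne(1)] join_eq[OF l(1,3) h(1) ne(2)] u by simp_all
    then have au: "a u \<in> join B z v" "a u \<in> join B w v"
      using over_join[OF follows_over[OF x(3)] v(2) hxy(3) ne(1) zv(1) _ u(2)]
        over_join[OF follows_over[OF y(3)] v(2) hxy(4) ne(2) zv(2) _ u(2)] by blast+
    have zne: "z \<noteq> v" "w \<noteq> v"
      using over_col(2)[OF follows_over[OF x(3)] v(2) hxy(3) ne(1)] over_col(2)[OF follows_over[OF y(3)] v(2) hxy(4) ne(2)] by auto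
    note jz = join[OF zv(1) zne(1)] and jw = join[OF zv(2) zne(2)]
    have "a u \<noteq> v" using a_in u(2) over_A(2)[OF v(2)] by auto
    then have "join B z v = join B w v" using line_eq[OF jz(1) jw(1) au jz(3) jw(3)] by blast
    then show ?thesis using colI[OF jz(1,2)] jw by simp
  next
    case hP: True
    let ?M = "join B p h"
    have ph: "p \<noteq> h" using h pl by blast
    note M = join[OF h(2) ph]
    have MB: "?M \<in> B'" using line_in_B'[OF M ph pP' hP] .
    have off: "x \<notin> ?M" "y \<notin> ?M" using colI[OF M(1,2)] x y by blast+
    then have "?l \<noteq> ?M" using l by blast
    moreover have "axis ?M" using tp(1) M unfolding tpoint_def by blast
    \<comment> \<open>This symmetry keeps the line through \<open>p\<close> and \<open>n\<close> and
      moves \<open>x\<close> to \<open>y\<close>; its conjugate moves \<open>z\<close> to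
      \<open>w\<close> along the line through \<open>z\<close> and \<open>a h\<close>.\<close>
    ultimately obtain \<theta> where th: "symm ?M \<theta>" "\<theta> x = y"
      using axisE[OF _ l(1) _ h(1) M(3) l(2) off(1) l(3) off(2)] by blast
    have pa: "a p \<in> a ` ?M" "a h \<in> a ` ?M" using M by blast+
    have "axis (a ` ?M)" using tp(2) pa B'_B[OF a_line[OF MB]] unfolding tpoint_def by blast
    then obtain \<theta>' where th': "conjug ?M \<theta> \<theta>'" using conjug_ex[OF MB _ th(1)] by blast
    have s': "symm (a ` ?M) \<theta>'" using th' unfolding conjug_def by blast
    obtain m m' where m: "m \<in> join B p n" "m \<sim> x" "m' \<in> join B (a p) k" "m' \<sim> z" "over m m'"
      using x(3) unfolding follows_def by blast
    note jn = radial[OF pP' over_A(1)[OF nk] pn] and jk = radial[OF rP' over_A(2)[OF nk] over_r[OF nk pn]]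
    have "\<theta> m \<in> join B p n" using symm_line[OF th(1) jn(1,2) M(2) m(1)] .
    moreover have "\<theta>' m' \<in> join B (a p) k" using symm_line[OF s' jk(1,2) pa(1) m(3)] .
    moreover have "\<theta> m \<sim> y" using aut_col[OF symm_aut[OF th(1)], of m x] m(2) th(2) by simp
    moreover have "\<theta>' m' \<sim> \<theta>' z" using aut_col[OF symm_aut[OF s'], of m' z] m(4) by simp
    moreover have "over (\<theta> m) (\<theta>' m')" "over y (\<theta>' z)"
      using conjug_over[OF MB th' m(5)] conjug_over[OF MB th' follows_over[OF x(3)]] th(2) by auto
    ultimately have "follows n k y (\<theta>' z)" unfolding follows_def by blast
    then have w: "w = \<theta>' z" using follows_unique[OF nk pn y(2,3)] by blast
    have "z \<sim> a h" using over_Ov[OF follows_over[OF x(3)] hP] hxy(3) by simp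
    moreover have "z \<noteq> a h" using a_in hP over_A(2)[OF follows_over[OF x(3)]] by auto
    ultimately have j: "join B z (a h) \<in> B" "z \<in> join B z (a h)" "a h \<in> join B z (a h)" using join by blast+
    have "\<theta>' z \<in> join B z (a h)" using symm_line[OF s' j(1,3) pa(2) j(2)] .
    then show ?thesis using w colI[OF j(1,2)] by blast
  qed
qed

lemma img_in: "x \<in> P \<Longrightarrow> img x \<in> P" "x \<in> P' \<Longrightarrow> img x = a x" "x \<in> A \<Longrightarrow> over x (img x)"
proof -
  show 1: "x \<in> P' \<Longrightarrow> img x = a x" unfolding img_def by simp
  show 2: "x \<in> A \<Longrightarrow> over x (img x)" using img_A target_over by blast
  show "x \<in> P \<Longrightarrow> img x \<in> P" using 1 2 over_P(2) a_in[of x] P'_P by (cases "x \<in> P'") auto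
qed

lemma img_opp: "x \<in> A \<Longrightarrow> \<not> p \<sim> x \<Longrightarrow> follows n k x (img x)"
  using img_A target_opp by blast

lemma img_col: assumes "x \<sim> y" shows "img x \<sim> img y"
proof -
  have P: "x \<in> P" "y \<in> P" using col_in assms by blast+
  have mixed: "img x \<sim> img u" if "x \<in> A" "u \<in> P'" "x \<sim> u" for x u
    using over_Ov[OF img_in(3)[OF that(1)] that(2)] that img_in(2)[OF that(2)] by simp
  have opp_near: "img x \<sim> img q" if "x \<in> A" "\<not> p \<sim> x" "q \<in> A" "p \<sim> q" "x \<sim> q" for x q
    using target_near[OF img_A[OF that(3)] that(4,1,2,5) img_opp[OF that(1,2)]] .
  consider "x \<in> P'" "y \<in> P'" | "x \<in> A" "y \<in> P'" | "x \<in> P'" "y \<in> A"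
    | "x \<in> A" "y \<in> A" "\<not> p \<sim> x" "\<not> p \<sim> y" | "x \<in> A" "y \<in> A" "\<not> p \<sim> x" "p \<sim> y"
    | "x \<in> A" "y \<in> A" "p \<sim> x" "\<not> p \<sim> y" | "x \<in> A" "y \<in> A" "p \<sim> x" "p \<sim> y" using P by blast
  then show ?thesis
  proof cases
    case 1 then show ?thesis using a_col img_in(2) assms by simp
  next
    case 2 then show ?thesis using mixed assms by blast
  next
    case 3 then show ?thesis using mixed[of y x] assms csym by blast
  next
    case 4 then show ?thesis using col_opp[OF _ _ img_opp _ _ img_opp assms] by blast
  next
    case 5 then show ?thesis using opp_near assms by blast
  next
    case 6 then show ?thesis using opp_near[of y x] assms csym by blast
  next
    case 7
    \<comment> \<open>By the triangle property \<open>x\<close> and \<open>y\<close> lie on one line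
      through \<open>p\<close>, so a single matched base pair governs both images.\<close>
    obtain m j where m: "m \<in> C" "over m j" "x \<in> join B p m" "x \<noteq> p"
      "\<And>x z. x \<in> A \<Longrightarrow> \<not> p \<sim> x \<Longrightarrow> follows n k x z \<Longrightarrow> follows m j x z" using near[OF 7(1,3)] by blast
    note jm = radial[OF pP' over_A(1)[OF m(2)] C_D(1)[OF m(1)]]
    note jj = radial[OF rP' over_A(2)[OF m(2)] over_C(2)[OF m(2,1)]]
    have y: "y \<noteq> p" using 7 pP' by blast
    have "y \<in> join B p m"
    proof (cases "y = x")
      case False
      then show ?thesis using triangle[OF jm(1,2) m(3) m(4)[symmetric], of y] 7 assms csym by blast
    qed (use m in simp)
    obtain v where v: "v \<in> join B (a p) j" "over x v" using lift_on[OF m(2) C_D(1)[OF m(1)] m(3,4)] .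
    obtain w where w: "w \<in> join B (a p) j" "over y w" using lift_on[OF m(2) C_D(1)[OF m(1)] \<open>y \<in> join B p m\<close> y] .
    have "img x = v" using target_unique[OF img_A[OF 7(1)] near_target[OF m v]] .
    moreover have "img y = w" using target_unique[OF img_A[OF 7(2)] near_target[OF m(1,2) \<open>y \<in> join B p m\<close> y m(5) w]] by blast
    ultimately show ?thesis using colI[OF jj(1) v(1) w(1)] by simp
  qed
qed

lemma img_inj: "inj_on img P"
proof (rule inj_onI)
  fix x y assume xy: "x \<in> P" "y \<in> P" "img x = img y"
  have out: "img u \<in> P' \<longleftrightarrow> u \<in> P'" if "u \<in> P" for u
    using img_in(2,3)[of u] over_A(2)[of u "img u"] a_in[of u] that by (cases "u \<in> P'") auto
  show "x = y"
  proof (cases "x \<in> P'")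
    case True
    then have "y \<in> P'" using out xy by metis
    then show ?thesis using True img_in(2) xy(3) a_eq by simp
  next
    case False
    then have A: "x \<in> A" "y \<in> A" using out[OF xy(1)] out[OF xy(2)] xy by auto
    have tw_ne: "img u \<noteq> img (tw u)" if u: "u \<in> A" "\<not> p \<sim> u" for u
    proof
      assume e: "img u = img (tw u)"
      have "\<not> p \<sim> tw u" using p_tw u by simp
      then have "u = tw u" using follows_inj[OF nk pn u(2) img_opp[OF u]] img_opp[of "tw u"] tw(1)[OF u(1)] e by simp
      then show False using tw(2)[OF u(1)] by simp
    qed
    have "y = x \<or> y = tw x" using over_inj[OF img_in(3)[OF A(1)]] img_in(3)[OF A(2)] xy(3) by simp
    moreover have "img x \<noteq> img (tw x)"
    proof (cases "p \<sim> x")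
      case True
      \<comment> \<open>An opposite neighbour separates the twins: the images of \<open>v\<close>
        and \<open>tw v\<close> are twins, so equal images of \<open>x\<close> and
        \<open>tw x\<close> would be collinear with both.\<close>
      obtain v where v: "v \<in> A" "\<not> p \<sim> v" "v \<sim> x" using opp_nbr[OF A(1) True] .
      note tv = tw(1)[OF v(1)]
      have "img (tw v) = tw (img v)"
        using over_two[OF img_in(3)[OF v(1)], of "img (tw v)"] over_tw(2)[OF img_in(3)[OF tv]] tw_tw[OF v(1)]
          tw_ne[OF v(1,2)] by simp
      then have "img x \<noteq> img (tw x)" 
        using img_col[OF v(3)] img_col[OF tw_col[OF v(1) A(1) v(3)]] csym
          col_tw_False[OF over_A(2)[OF img_in(3)[OF v(1)]] over_A(2)[OF img_in(3)[OF A(1)]]] by metis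
      then show ?thesis .
    next
      case False then show ?thesis using tw_ne A by blast
    qed
    ultimately show ?thesis using xy(3) by auto
  qed
qed

lemma img_aut: "aut img"
  unfolding aut_def
proof (intro conjI allI impI)
  have "img ` P \<subseteq> P" using img_in(1) by blast
  then have "img ` P = P" using endo_inj_surj[OF fin _ img_inj] by blast
  then have "bij_betw img P P" using img_inj unfolding bij_betw_def by blast
  moreover have "img x = x" if "x \<notin> P" for x using that P'_P unfolding img_def by auto
  ultimately show "img permutes P" by (rule bij_imp_permutes)
qed (rule img_col)

end

context ovoid_auto
begin

theorem extension: "\<exists>f. aut f \<and> (\<forall>u\<in>P'. f u = a u)"
proof -
  have "card {z \<in> P'. \<not> col B' p z} \<noteq> 0" using quad.card_nonnbrs[OF sub pP'] s2 by simp
  then have "{z \<in> P'. \<not> col B' p z} \<noteq> {}" by (metis card.empty)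
  then obtain z0 where z: "z0 \<in> P'" "\<not> col B' p z0" by blast
  then have z0: "\<not> p \<sim> z0" using col_col'[OF pP'] by simp
  have z0P: "z0 \<in> P" using z P'_P by blast
  have "{c \<in> nbrs B p z0. c \<in> P'} = nbrs B' p z0"
    unfolding nbrs_def using col_col'[OF pP'] col_col'[OF z(1)] quad.col_in[OF sub] by blast
  then have "card {c \<in> nbrs B p z0. c \<in> P'} = s + 1" using quad.card_nbrs[OF sub pP' z(1,2)] by simp
  moreover have "card (nbrs B p z0) = s^2 + 1" using card_nbrs[OF pP z0P z0] .
  moreover have "s < s^2" using s2 by (simp add: power2_eq_square)
  \<comment> \<open>\<open>s + 1 < s^2 + 1\<close>, so some line through \<open>p\<close> leaves the
    subquadrangle and can carry the initial choice.\<close>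
  ultimately have "{c \<in> nbrs B p z0. c \<in> P'} \<noteq> nbrs B p z0" by auto
  then obtain n where n: "n \<in> nbrs B p z0" "n \<notin> P'" by blast
  then obtain k where k: "over n k" using over_ex[of n] nbrs_in by blast
  interpret ovoid_auto_framed P B s P' B' a L p z0 n k
    by unfold_locales (use z z0 n k in auto)
  show ?thesis using img_aut img_in(2) by blast
qed

end

section \<open>The exchange of twins and the number of extensions\<close>

context subquad
begin

definition flip :: "'p \<Rightarrow> 'p" where "flip x = (if x \<in> A then tw x else x)"

lemma flip_flip: "flip (flip x) = x"
proof (cases "x \<in> A")
  case True
  then show ?thesis using tw(1) tw_tw unfolding flip_def by simp
next
  case False
  then have "flip x = x" unfolding flip_def by (rule if_not_P)
  then show ?thesis by simp
qed

lemma flip_in: "flip x \<in> A \<longleftrightarrow> x \<in> A" "flip x \<in> P \<longleftrightarrow> x \<in> P"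
  unfolding flip_def using tw(1)[of x] by auto

lemma flip_aut: "aut flip"
  unfolding aut_def
proof (intro conjI allI impI)
  show "flip permutes P"
  proof (rule bij_imp_permutes)
    show "bij_betw flip P P"
      by (rule bij_betwI[where g = flip]) (use flip_flip flip_in in auto)
  qed (simp add: flip_def)
  fix x y assume xy: "x \<sim> y"
  then have P: "x \<in> P" "y \<in> P" using col_in by blast+
  have mixed: "tw x \<sim> u" if "x \<in> A" "u \<in> P'" "x \<sim> u" for x u
    using tw(3)[OF that(1)] Ov_iff[of u] that by blast
  consider "x \<in> P'" "y \<in> P'" | "x \<in> A" "y \<in> P'" | "x \<in> P'" "y \<in> A" | "x \<in> A" "y \<in> A" using P by blast
  then show "flip x \<sim> flip y"
    by cases (use xy mixed[of x y] mixed[of y x] tw_col[of x y] csym in \<open>auto simp: flip_def\<close>)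
qed

text \<open>Images agree up to a twin, and agreement spreads along lines by
  \<open>col_tw_False\<close>. Any two points that are not twins are linked outside
  \<open>P'\<close>; the twin of the starting point is reached from a second one.\<close>

lemma aut_agree:
  assumes f: "aut f" and g: "aut g" and fP: "\<And>u. u \<in> P' \<Longrightarrow> f u \<in> P'" and e: "\<And>u. u \<in> P' \<Longrightarrow> g u = f u"
    and x: "x \<in> A" "g x = f x"
  shows "g = f"
proof -
  have gP: "\<And>u. u \<in> P' \<Longrightarrow> g u \<in> P'" using fP e by simp
  have two: "g y = f y \<or> g y = tw (f y)" if y: "y \<in> A" for y
  proof -
    have yP: "y \<in> P" using y by blast
    have "Ov (g y) = g ` Ov y" using aut_Ov[OF g gP yP] .
    also have "\<dots> = f ` Ov y" using e Ov_P' by (intro image_cong) auto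
    also have "\<dots> = Ov (f y)" using aut_Ov[OF f fP yP] by simp
    finally show ?thesis using tw_eq[OF aut_A[OF f fP y] aut_A[OF g gP y]] by simp
  qed
  have step: "g z = f z" if y: "y \<in> A" "g y = f y" and z: "z \<in> A" "y \<sim> z" for y z
  proof (rule ccontr)
    assume "g z \<noteq> f z"
    then have "g z = tw (f z)" using two[OF z(1)] by blast
    moreover have "f y \<sim> f z" "f y \<sim> g z" using aut_col[OF f, of y z] aut_col[OF g, of y z] y z by auto
    ultimately show False using col_tw_False[OF aut_A[OF f fP z(1)] aut_A[OF f fP y(1)]] by simp
  qed
  have far: "g z = f z" if y: "y \<in> A" "g y = f y" and z: "z \<in> A" "z \<noteq> tw y" for y z
  proof (cases "y \<sim> z \<or> y = z")
    case True then show ?thesis using step y z by blast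
  next
    case False
    then have nc: "\<not> y \<sim> z" "y \<noteq> z" by auto
    have yzP: "y \<in> P" "z \<in> P" using y z by blast+
    \<comment> \<open>Either \<open>z\<close> is collinear with \<open>tw y\<close> and the ovoids
      touch, or \<open>y\<close>, \<open>tw y\<close>, \<open>z\<close> form a triad. In both cases
      one of the \<open>s^2 + 1\<close> common neighbours of \<open>y\<close> and \<open>z\<close>
      lies outside \<open>P'\<close>.\<close>
    have "card (Ov y \<inter> Ov z) \<le> s + 1"
    proof (cases "tw y \<sim> z")
      case True
      obtain u where "Ov (tw y) \<inter> Ov z = {u}" using Ov_Int_ex[OF tw(1)[OF y(1)] z(1) True] z(2) by blast
      then show ?thesis using tw(3)[OF y(1)] by simp
    next
      case c: False
      have "card {w \<in> nbrs B y (tw y). w \<sim> z} = s + 1"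
        by (rule card_centres) (use yzP tw(1)[OF y(1)] tw_not_col[OF y(1)] nc c in auto)
      moreover have "{w \<in> nbrs B y (tw y). w \<sim> z} = Ov y \<inter> Ov z"
        unfolding nbrs_tw[OF y(1)] using csym unfolding Ov_def by blast
      ultimately show ?thesis by simp
    qed
    moreover have "card (nbrs B y z) = s^2 + 1" using card_nbrs[OF yzP nc(1)] .
    moreover have "s < s^2" using s2 by (simp add: power2_eq_square)
    ultimately have "\<not> nbrs B y z \<subseteq> Ov y \<inter> Ov z" using card_mono[of "Ov y \<inter> Ov z" "nbrs B y z"] fin_Ov by auto
    then obtain w where w: "w \<in> nbrs B y z" "w \<notin> Ov y \<inter> Ov z" by blast
    then have wA: "w \<in> A" "y \<sim> w" "z \<sim> w" using col_in(2) unfolding nbrs_def Ov_def by blast+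
    have "g w = f w" using step[OF y wA(1,2)] .
    then show ?thesis using step[OF wA(1) _ z(1) csym[OF wA(3)]] by blast
  qed
  have "g z = f z" for z
  proof -
    consider "z \<in> P'" | "z \<notin> P" | "z \<in> A" "z \<noteq> tw x" | "z = tw x" by blast
    then show ?thesis
    proof cases
      case 1 then show ?thesis using e by blast
    next
      case 2 then show ?thesis using aut_bij(3)[OF f] aut_bij(3)[OF g] permutes_not_in by metis
    next
      case 3 then show ?thesis using far[OF x] by blast
    next
      case 4
      have xP: "x \<in> P" using x by blast
      obtain l where l: "l \<in> B" "x \<in> l" using line_through[OF xP] by blast
      obtain y where y: "y \<in> l" "y \<in> A" "y \<noteq> x" using A_nbr[OF x(1) l] .
      have "g y = f y" using step[OF x y(2)] colI[OF l y(1)] by blast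
      moreover have "tw x \<noteq> tw y" using tw_inj x y by metis
      ultimately show ?thesis using far[OF y(2), of "tw x"] tw(1)[OF x(1)] 4 by blast
    qed
  qed
  then show ?thesis by blast
qed

theorem card_extensions:
  assumes f: "aut f" and fP: "\<And>u. u \<in> P' \<Longrightarrow> f u \<in> P'" and A: "A \<noteq> {}"
  shows "card {g. aut g \<and> (\<forall>u\<in>P'. g u = f u)} = 2"
proof -
  obtain x where x: "x \<in> A" using A by blast
  let ?h = "flip \<circ> f"
  have h: "aut ?h" using aut_comp[OF flip_aut f] .
  have he: "?h u = f u" if "u \<in> P'" for u using fP[OF that] unfolding flip_def by simp
  have hx: "?h x = tw (f x)" using aut_A[OF f fP x] unfolding flip_def by simp
  have "g = f \<or> g = ?h" if g: "aut g" "\<forall>u\<in>P'. g u = f u" for g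
  proof -
    have xP: "x \<in> P" using x by blast
    have gP: "\<And>u. u \<in> P' \<Longrightarrow> g u \<in> P'" using fP g by simp
    have "Ov (g x) = g ` Ov x" using aut_Ov[OF g(1) gP xP] .
    also have "\<dots> = f ` Ov x" using g Ov_P' by (intro image_cong) auto
    also have "\<dots> = Ov (f x)" using aut_Ov[OF f fP xP] by simp
    finally have "g x = f x \<or> g x = ?h x" using tw_eq[OF aut_A[OF f fP x] aut_A[OF g(1) gP x]] hx by simp
    then show ?thesis
      using aut_agree[OF f g(1) fP _ x] aut_agree[OF h g(1) _ _ x] g he fP by metis
  qed
  then have "{g. aut g \<and> (\<forall>u\<in>P'. g u = f u)} = {f, ?h}" using f h he by auto
  moreover have "f \<noteq> ?h" using hx tw(2)[OF aut_A[OF f fP x]] by metis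
  ultimately show ?thesis by simp
qed

end

section \<open>From geometries to set systems\<close>

text \<open>Automorphisms are undefined off the carrier; \<open>pmap\<close> turns their point maps into permutations of
  the whole type, so that they compose and invert as plain functions.\<close>

definition pmap :: "('p, 'l) geometry \<Rightarrow> ('p \<Rightarrow> 'p) \<times> ('l \<Rightarrow> 'l) \<Rightarrow> 'p \<Rightarrow> 'p" where
  "pmap G \<phi> x = (if x \<in> pts G then fst \<phi> x else x)"

abbreviation lines :: "('p, 'l) geometry \<Rightarrow> 'p set set" where
  "lines G \<equiv> pts_on G ` lns G"

lemma pts_on_iff: "x \<in> pts_on G N \<longleftrightarrow> x \<in> pts G \<and> inc G x N"
  unfolding pts_on_def by simp

lemma gq_line_unique:
  assumes gq: "generalized_quadrangle G s t" and N: "N \<in> lns G" "M \<in> lns G"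
    and x: "x \<in> pts_on G N" "x \<in> pts_on G M" "y \<in> pts_on G N" "y \<in> pts_on G M" "x \<noteq> y"
  shows "N = M"
proof -
  have "\<forall>x \<in> pts G. \<forall>y \<in> pts G. \<forall>M \<in> lns G. \<forall>N \<in> lns G.
      x \<noteq> y \<and> inc G x M \<and> inc G y M \<and> inc G x N \<and> inc G y N \<longrightarrow> M = N"
    using gq unfolding generalized_quadrangle_def by (elim conjE)
  then show ?thesis using N x unfolding pts_on_iff by blast
qed

lemma gq_pts_on_inj:
  assumes gq: "generalized_quadrangle G s t" and N: "N \<in> lns G" "M \<in> lns G" "pts_on G N = pts_on G M"
  shows "N = M"
proof -
  have "card (pts_on G N) = s + 1" "1 \<le> s" using gq N unfolding generalized_quadrangle_def by auto
  then have "\<not> card (pts_on G N) \<le> Suc 0" "finite (pts_on G N)" using card_ge_0_finite by (auto intro: card_ge_0_finite)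
  then obtain x y where "x \<in> pts_on G N" "y \<in> pts_on G N" "x \<noteq> y" using card_le_Suc0_iff_eq by metis
  moreover from this have "x \<in> pts_on G M" "y \<in> pts_on G M" using N by auto
  ultimately show ?thesis using gq_line_unique[OF gq N(1,2)] by blast
qed

lemma gq_proj_ex:
  assumes gq: "generalized_quadrangle G s t" and x: "x \<in> pts G" "N \<in> lns G" "\<not> inc G x N"
  shows "\<exists>y M. y \<in> pts G \<and> M \<in> lns G \<and> inc G x M \<and> inc G y M \<and> inc G y N"
proof -
  have "\<exists>!(y, M). y \<in> pts G \<and> M \<in> lns G \<and> inc G x M \<and> inc G y M \<and> inc G y N"
    using gq x unfolding generalized_quadrangle_def by blast
  then show ?thesis by auto
qed

lemma gq_proj_unique:
  assumes gq: "generalized_quadrangle G s t" and x: "x \<in> pts G" "N \<in> lns G" "\<not> inc G x N"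
    and y: "y \<in> pts G" "M \<in> lns G" "inc G x M" "inc G y M" "inc G y N"
    and z: "z \<in> pts G" "K \<in> lns G" "inc G x K" "inc G z K" "inc G z N"
  shows "y = z"
proof -
  have "\<exists>!(y, M). y \<in> pts G \<and> M \<in> lns G \<and> inc G x M \<and> inc G y M \<and> inc G y N"
    using gq x unfolding generalized_quadrangle_def by blast
  then have "(y, M) = (z, K)" using y z by (elim ex1E) (metis (mono_tags, lifting) case_prodI)
  then show ?thesis by simp
qed

text \<open>Positive cardinalities make lines and pencils finite, and every point is on a line
  meeting a fixed line.\<close>

lemma gq_finite: assumes gq: "generalized_quadrangle G s t" shows "finite (pts G)"
proof -
  obtain N where N: "N \<in> lns G" using gq unfolding generalized_quadrangle_def by blast
  have fl: "finite (pts_on G M)" if "M \<in> lns G" for M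
    using gq that card_ge_0_finite[of "pts_on G M"] unfolding generalized_quadrangle_def by simp
  have ft: "finite (lns_through G y)" if "y \<in> pts G" for y
    using gq that card_ge_0_finite[of "lns_through G y"] unfolding generalized_quadrangle_def by simp
  have "pts G \<subseteq> pts_on G N \<union> (\<Union>y\<in>pts_on G N. \<Union>M\<in>lns_through G y. pts_on G M)"
  proof
    fix x assume x: "x \<in> pts G"
    show "x \<in> pts_on G N \<union> (\<Union>y\<in>pts_on G N. \<Union>M\<in>lns_through G y. pts_on G M)"
      using gq_proj_ex[OF gq x N] x unfolding pts_on_def lns_through_def by blast
  qed
  moreover have "finite (pts_on G N \<union> (\<Union>y\<in>pts_on G N. \<Union>M\<in>lns_through G y. pts_on G M))"
    using fl[OF N] ft fl by (auto simp: pts_on_iff lns_through_def)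
  ultimately show ?thesis using finite_subset by blast
qed

lemma gq_quad:
  assumes gq: "generalized_quadrangle G s t" and st: "2 \<le> s" "2 \<le> t"
  shows "quad (pts G) (lines G) s t"
proof
  show "finite (pts G)" using gq_finite[OF gq] .
  show "2 \<le> s" "2 \<le> t" by fact+
  show "lines G \<noteq> {}" using gq unfolding generalized_quadrangle_def by blast
  fix l assume l: "l \<in> lines G"
  then obtain N where N: "N \<in> lns G" "l = pts_on G N" by blast
  show "l \<subseteq> pts G" using N unfolding pts_on_def by blast
  show "card l = s + 1" using gq N unfolding generalized_quadrangle_def by blast
  show "\<exists>y\<in>l. col (lines G) x y" if x: "x \<in> pts G" "x \<notin> l" for x
    using gq_proj_ex[OF gq x(1) N(1)] x N(2) unfolding col_def by (auto simp: pts_on_iff)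
  show "y = z" if h: "x \<in> pts G" "x \<notin> l" "y \<in> l" "z \<in> l" "col (lines G) x y" "col (lines G) x z" for x y z
  proof -
    obtain M K where "M \<in> lns G" "x \<in> pts_on G M" "y \<in> pts_on G M" "K \<in> lns G" "x \<in> pts_on G K" "z \<in> pts_on G K"
      using h(5,6) unfolding col_def by blast
    then show ?thesis using gq_proj_unique[OF gq h(1) N(1), of y M z K] h N(2) by (simp add: pts_on_iff)
  qed
  show "l = m" if m: "m \<in> lines G" "x \<in> l" "x \<in> m" "y \<in> l" "y \<in> m" "x \<noteq> y" for m x y
  proof -
    obtain M where M: "M \<in> lns G" "m = pts_on G M" using m(1) by blast
    then show ?thesis using gq_line_unique[OF gq N(1) M(1)] m N(2) by blast
  qed
next
  fix x assume x: "x \<in> pts G"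
  have "{l \<in> lines G. x \<in> l} = pts_on G ` lns_through G x"
    unfolding lns_through_def using x by (auto simp: pts_on_iff)
  moreover have "inj_on (pts_on G) (lns_through G x)"
    using gq_pts_on_inj[OF gq] unfolding inj_on_def lns_through_def by blast
  ultimately have "card {l \<in> lines G. x \<in> l} = card (lns_through G x)" using card_image by metis
  then show "card {l \<in> lines G. x \<in> l} = t + 1" using gq x unfolding generalized_quadrangle_def by simp
qed

section \<open>Automorphisms of a geometry as permutations of its points\<close>

locale gq =
  fixes G :: "('p, 'l) geometry" and s t :: nat
  assumes gq: "generalized_quadrangle G s t" and st: "2 \<le> s" "2 \<le> t"
begin

sublocale quad "pts G" "lines G" s t
  using gq_quad[OF gq st] .

lemma lines_eq: "N \<in> lns G \<Longrightarrow> M \<in> lns G \<Longrightarrow> pts_on G N = pts_on G M \<Longrightarrow> N = M"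
  using gq_pts_on_inj[OF gq] .

lemma auto_bij: assumes "\<phi> \<in> automorphisms G"
  shows "bij_betw (pmap G \<phi>) (pts G) (pts G)"
proof -
  have "bij_betw (fst \<phi>) (pts G) (pts G)" using assms unfolding automorphisms_def by simp
  then show ?thesis by (rule bij_betw_cong[THEN iffD1, rotated]) (simp add: pmap_def)
qed

lemma auto_snd: "\<phi> \<in> automorphisms G \<Longrightarrow> N \<in> lns G \<Longrightarrow> snd \<phi> N \<in> lns G"
  unfolding automorphisms_def bij_betw_def by blast

lemma auto_line: assumes "\<phi> \<in> automorphisms G" "N \<in> lns G"
  shows "pts_on G (snd \<phi> N) = pmap G \<phi> ` pts_on G N"
proof -
  have i: "inc G (fst \<phi> x) (snd \<phi> N) \<longleftrightarrow> inc G x N" if "x \<in> pts G" for x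
    using assms that unfolding automorphisms_def by blast
  show ?thesis
  proof (intro equalityI subsetI)
    fix y assume y: "y \<in> pts_on G (snd \<phi> N)"
    then have "y \<in> pmap G \<phi> ` pts G" using auto_bij[OF assms(1)] unfolding bij_betw_def pts_on_def by blast
    then obtain x where x: "x \<in> pts G" "y = fst \<phi> x" unfolding pmap_def by auto
    then have "x \<in> pts_on G N" using i y by (simp add: pts_on_iff)
    then show "y \<in> pmap G \<phi> ` pts_on G N" using x unfolding pmap_def by auto
  next
    fix y assume "y \<in> pmap G \<phi> ` pts_on G N"
    then obtain x where x: "x \<in> pts_on G N" "y = fst \<phi> x" unfolding pmap_def by (auto simp: pts_on_iff)
    moreover have "y \<in> pts G" using x auto_bij[OF assms(1)] unfolding bij_betw_def pmap_def pts_on_def by auto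
    ultimately show "y \<in> pts_on G (snd \<phi> N)" using i by (simp add: pts_on_iff)
  qed
qed

lemma auto_aut: assumes "\<phi> \<in> automorphisms G" shows "aut (pmap G \<phi>)"
  unfolding aut_def
proof (intro conjI allI impI)
  show "pmap G \<phi> permutes pts G" by (rule bij_imp_permutes[OF auto_bij[OF assms]]) (simp add: pmap_def)
  fix x y assume "adj x y"
  then obtain N where N: "N \<in> lns G" "x \<in> pts_on G N" "y \<in> pts_on G N" unfolding col_def by blast
  have "pts_on G (snd \<phi> N) \<in> lines G" using auto_snd[OF assms N(1)] by blast
  then show "adj (pmap G \<phi> x) (pmap G \<phi> y)" using colI auto_line[OF assms N(1)] N by blast
qed

lemma auto_eqI: assumes "\<phi> \<in> automorphisms G" "\<psi> \<in> automorphisms G" "pmap G \<phi> = pmap G \<psi>" shows "\<phi> = \<psi>"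
proof (rule prod_eqI)
  show "fst \<phi> = fst \<psi>"
  proof (rule extensionalityI)
    show "fst \<phi> \<in> extensional (pts G)" "fst \<psi> \<in> extensional (pts G)" using assms unfolding automorphisms_def by auto
    show "fst \<phi> x = fst \<psi> x" if "x \<in> pts G" for x using fun_cong[OF assms(3), of x] that unfolding pmap_def by simp
  qed
  show "snd \<phi> = snd \<psi>"
  proof (rule extensionalityI)
    show "snd \<phi> \<in> extensional (lns G)" "snd \<psi> \<in> extensional (lns G)" using assms unfolding automorphisms_def by auto
    show "snd \<phi> N = snd \<psi> N" if "N \<in> lns G" for N
      using lines_eq auto_snd auto_line assms that by simp
  qed
qed

lemma aut_auto: assumes f: "aut f" obtains \<phi> where "\<phi> \<in> automorphisms G" "pmap G \<phi> = f"
proof -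
  have "\<exists>M. M \<in> lns G \<and> pts_on G M = f ` pts_on G N" if "N \<in> lns G" for N
    using aut_line[OF f, of "pts_on G N"] that by auto
  then obtain F where F: "\<And>N. N \<in> lns G \<Longrightarrow> F N \<in> lns G \<and> pts_on G (F N) = f ` pts_on G N" by metis
  let ?\<phi> = "(restrict f (pts G), restrict F (lns G))"
  have inj: "inj_on F (lns G)"
  proof (rule inj_onI)
    fix N M assume N: "N \<in> lns G" "M \<in> lns G" "F N = F M"
    then have "f ` pts_on G N = f ` pts_on G M" using F by metis
    then have "pts_on G N = pts_on G M" using inj_image_eq_iff[OF aut_bij(2)[OF f]] by blast
    then show "N = M" using lines_eq N by blast
  qed
  have "finite (lns G)"
    using finite_imageD[OF finB] lines_eq unfolding inj_on_def by blast
  then have "F ` lns G = lns G" using endo_inj_surj[OF _ _ inj] F by blast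
  then have bF: "bij_betw (restrict F (lns G)) (lns G) (lns G)"
    using inj by (simp add: bij_betw_def inj_on_restrict_eq)
  have bf: "bij_betw (restrict f (pts G)) (pts G) (pts G)"
    using permutes_imp_bij[OF aut_bij(3)[OF f]] by (simp add: bij_betw_def inj_on_restrict_eq)
  have i: "inc G (f x) (F N) \<longleftrightarrow> inc G x N" if "x \<in> pts G" "N \<in> lns G" for x N
  proof -
    have "inc G (f x) (F N) \<longleftrightarrow> f x \<in> pts_on G (F N)" using aut_in[OF f] that by (simp add: pts_on_iff)
    also have "\<dots> \<longleftrightarrow> x \<in> pts_on G N" using F that aut_eq[OF f] by auto
    finally show ?thesis using that by (simp add: pts_on_iff)
  qed
  have "?\<phi> \<in> automorphisms G" unfolding automorphisms_def using bF bf i by simp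
  moreover have "pmap G ?\<phi> = f"
    using permutes_not_in[OF aut_bij(3)[OF f]] by (auto simp: pmap_def fun_eq_iff)
  ultimately show ?thesis using that by blast
qed

lemma symmetries_symm: assumes "M \<in> lns G" "\<phi> \<in> symmetries G M" shows "symm (pts_on G M) (pmap G \<phi>)"
  unfolding symm_def
proof (intro conjI ballI impI)
  have au: "\<phi> \<in> automorphisms G" using assms unfolding symmetries_def by blast
  then show "aut (pmap G \<phi>)" using auto_aut by blast
  fix l x assume l: "l \<in> lines G" "l \<inter> pts_on G M \<noteq> {}" "x \<in> l"
  then obtain N where N: "N \<in> lns G" "l = pts_on G N" by blast
  have "concurrent G M N" using l N unfolding concurrent_def by (auto simp: pts_on_iff)
  then have "snd \<phi> N = N" using assms N unfolding symmetries_def by blast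
  then show "pmap G \<phi> x \<in> l" using auto_line[OF au N(1)] N l by auto
qed

text \<open>Evaluation at \<open>x\<close> is injective on the symmetries, so \<open>s\<close> of
  them reach all \<open>s\<close> points of \<open>l\<close> off \<open>M\<close>.\<close>

lemma axis_of_symmetry_axis: assumes "axis_of_symmetry G s M" shows "axis (pts_on G M)"
  unfolding axis_def
proof (intro conjI ballI impI)
  let ?M = "pts_on G M"
  have M: "M \<in> lns G" "card (symmetries G M) = s" using assms unfolding axis_of_symmetry_def by auto
  show MB: "?M \<in> lines G" using M by blast
  fix l x y assume l: "l \<in> lines G" "l \<noteq> ?M" "l \<inter> ?M \<noteq> {}" "x \<in> l - ?M" "y \<in> l - ?M"
  obtain u where u: "u \<in> l" "u \<in> ?M" using l by blast
  have lu: "l - ?M = l - {u}" using line_eq[OF l(1) MB] l u by blast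
  have xP: "x \<in> pts G" using l line_sub by blast
  let ?e = "\<lambda>\<phi>. pmap G \<phi> x"
  have "inj_on ?e (symmetries G M)"
  proof (rule inj_onI)
    fix \<phi> \<psi> assume p: "\<phi> \<in> symmetries G M" "\<psi> \<in> symmetries G M" "?e \<phi> = ?e \<psi>"
    have "pmap G \<phi> = pmap G \<psi>"
      using symm_agree[OF MB symmetries_symm[OF M(1) p(1)] symmetries_symm[OF M(1) p(2)] xP _ p(3)] l by blast
    then show "\<phi> = \<psi>" using auto_eqI p unfolding symmetries_def by blast
  qed
  then have c: "card (?e ` symmetries G M) = s" using card_image M by metis
  have "?e ` symmetries G M \<subseteq> l - ?M"
  proof
    fix v assume "v \<in> ?e ` symmetries G M"
    then obtain \<phi> where p: "\<phi> \<in> symmetries G M" "v = ?e \<phi>" by blast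
    note sm = symmetries_symm[OF M(1) p(1)]
    show "v \<in> l - ?M" using symm_line[OF sm l(1) u] symm_off[OF sm MB] l p by blast
  qed
  moreover have "finite (l - ?M)" "card (l - ?M) = s" unfolding lu using card_line_minus[OF l(1) u(1)] fin_line[OF l(1)] by auto
  ultimately have "?e ` symmetries G M = l - ?M" using card_subset_eq c by metis
  then obtain \<phi> where "\<phi> \<in> symmetries G M" "y = ?e \<phi>" using l(5) by blast
  then show "\<exists>\<theta>. symm ?M \<theta> \<and> \<theta> x = y" using symmetries_symm[OF M(1)] by blast
qed

lemma translation_tpoint: assumes "translation_point G s x" shows "tpoint x"
  using assms axis_of_symmetry_axis unfolding translation_point_def tpoint_def lns_through_def
  by (auto simp: pts_on_iff)

end

locale gq_pair =
  fixes S S' :: "('p, 'l) geometry" and s :: nat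
  assumes thick: "thick_gq S s (s^2)" and subq: "subquadrangle S' S s s"
    and doubly: "Ov \<in> subtended_ovoids S S' \<Longrightarrow> doubly_subtended S S' Ov"
begin

sublocale gq S s "s^2"
  using thick unfolding thick_gq_def by unfold_locales auto

lemma gq': "gq S' s s"
  using subq s2 unfolding subquadrangle_def by (intro gq.intro) auto

lemma pts_sub: "pts S' \<subseteq> pts S" and lns_sub: "lns S' \<subseteq> lns S"
  using subq unfolding subquadrangle_def by auto

lemma inc_eq: "x \<in> pts S' \<Longrightarrow> N \<in> lns S' \<Longrightarrow> inc S' x N \<longleftrightarrow> inc S x N"
  using subq unfolding subquadrangle_def by blast

text \<open>Both quadrangles have \<open>s + 1\<close> points on a line, so no line of
  \<open>S'\<close> gains points in \<open>S\<close>.\<close>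

lemma pts_on_eq: assumes "N \<in> lns S'" shows "pts_on S' N = pts_on S N"
proof (rule card_subset_eq)
  have N: "pts_on S N \<in> lines S" using assms lns_sub by blast
  show "finite (pts_on S N)" using fin_line[OF N] .
  show "pts_on S' N \<subseteq> pts_on S N" using inc_eq[OF _ assms] pts_sub unfolding pts_on_def by blast
  have "card (pts_on S' N) = s + 1" using subq assms unfolding subquadrangle_def generalized_quadrangle_def by blast
  then show "card (pts_on S' N) = card (pts_on S N)" using line_card[OF N] by simp
qed

lemma lines_sub: "lines S' \<subseteq> lines S"
  using pts_on_eq lns_sub by auto

lemma col_collinear: "x \<in> pts S \<Longrightarrow> y \<in> pts S \<Longrightarrow> col (lines S) x y \<longleftrightarrow> collinear S x y"
  unfolding col_def collinear_def by (auto simp: pts_on_iff)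

lemma subtended_eq: "x \<in> pts S \<Longrightarrow> subtended S S' x = {u \<in> pts S'. col (lines S) x u}"
  using pts_sub col_collinear unfolding subtended_def perp_def by auto

sublocale subquad "pts S" "lines S" s "pts S'" "lines S'"
proof (intro subquad.intro subquad_axioms.intro)
  show "quad_sq (pts S) (lines S) s" by (rule quad_sq.intro) (rule quad_axioms)
  show "quad (pts S') (lines S') s s" using gq_quad[OF gq.gq[OF gq'] s2 s2] .
  show "pts S' \<subseteq> pts S" "lines S' \<subseteq> lines S" by (rule pts_sub lines_sub)+
  fix x assume x: "x \<in> pts S - pts S'"
  then have "subtended S S' x \<in> subtended_ovoids S S'" unfolding subtended_ovoids_def by blast
  then have "card {y \<in> pts S - pts S'. subtended S S' y = subtended S S' x} = 2"
    using doubly unfolding doubly_subtended_def by blast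
  moreover have "{y \<in> pts S - pts S'. subtended S S' y = subtended S S' x} =
    {y \<in> pts S - pts S'. {u \<in> pts S'. col (lines S) y u} = {u \<in> pts S'. col (lines S) x u}}"
    using x by (intro Collect_cong conj_cong refl) (simp add: subtended_eq)
  ultimately show "card {y \<in> pts S - pts S'. {u \<in> pts S'. col (lines S) y u} = {u \<in> pts S'. col (lines S) x u}} = 2"
    by simp
qed

lemma subtended_Ov: "x \<in> pts S \<Longrightarrow> subtended S S' x = Ov x"
  unfolding Ov_def by (rule subtended_eq)

lemma subtended_ovoids_Ov: "subtended_ovoids S S' = Ov ` A"
  unfolding subtended_ovoids_def by (intro image_cong refl) (simp add: subtended_Ov)

lemma rosette_Ov: "rosette S S' N = Ov ` (pts_on S N - pts S')"
  unfolding rosette_def by (intro image_cong refl) (simp add: subtended_Ov pts_on_iff)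

lemma A_line: assumes "x \<in> A" "x \<in> pts_on S N" "N \<in> lns S" shows "N \<in> lns S - lns S'"
  using assms B'_P'[of "pts_on S' N"] pts_on_eq by auto

lemma A_line_pt: assumes "N \<in> lns S - lns S'" obtains x where "x \<in> A" "x \<in> pts_on S N"
proof -
  have N: "pts_on S N \<in> lines S" using assms by blast
  have "\<not> pts_on S N \<subseteq> pts S'"
  proof
    assume "pts_on S N \<subseteq> pts S'"
    then obtain M where "M \<in> lns S'" "pts_on S N = pts_on S' M" using line_sub_B'[OF N] by blast
    then have "N = M" using lines_eq[of N M] pts_on_eq lns_sub assms by auto
    then show False using \<open>M \<in> lns S'\<close> assms by blast
  qed
  then show ?thesis using that line_sub[OF N] by blast
qed

lemma geom_A_simps: "pts (geom_A S S') = A" "lns (geom_A S S') = lns S - lns S'" "inc (geom_A S S') = inc S"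
  "pts_on (geom_A S S') N = pts_on S N - pts S'"
  unfolding geom_A_def pts_on_def by auto

lemma pts_on_E: assumes "R \<in> lns (geom_E S S')" shows "pts_on (geom_E S S') R = R"
proof -
  obtain K where K: "R = rosette S S' K" using assms unfolding geom_E_def by auto
  have "R \<subseteq> Ov ` A" unfolding K rosette_Ov by (auto simp: pts_on_iff)
  then show ?thesis unfolding pts_on_def geom_E_def subtended_ovoids_Ov by auto
qed

lemma tw_line:
  assumes "l \<in> lines S" "m \<in> lines S" "x \<in> A" "y \<in> A" "x \<in> l" "y \<in> l" "x \<noteq> y" "tw x \<in> m" "tw y \<in> m"
  shows "Ov ` (l - pts S') \<subseteq> Ov ` (m - pts S')"
proof
  fix X assume "X \<in> Ov ` (l - pts S')"
  then obtain z where z: "z \<in> l" "z \<in> A" "X = Ov z" using line_sub[OF assms(1)] by blast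
  have "adj z x" "adj z y" using colI[OF assms(1) z(1)] assms by blast+
  then have "adj (tw z) (tw x)" "adj (tw z) (tw y)" using tw_col z assms by blast+
  moreover have "tw x \<noteq> tw y" using tw_inj assms by blast
  ultimately have "tw z \<in> m" using triangle[OF assms(2,8,9)] by blast
  then show "X \<in> Ov ` (m - pts S')" using tw(1,3)[OF z(2)] z(3) by blast
qed

text \<open>Two lines carrying the same two ovoids are equal or twins of each other: in a mixed
  match one point would be collinear with both members of a twin pair.\<close>

lemma pair_cases:
  assumes l: "l \<in> lines S" "m \<in> lines S" and x: "x \<in> A" "y \<in> A" "x \<in> l" "y \<in> l" "x \<noteq> y"
    and v: "v \<in> A" "w \<in> A" "v \<in> m" "w \<in> m" "Ov v = Ov x" "Ov w = Ov y"
  shows "m = l \<or> v = tw x \<and> w = tw y"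
proof -
  have xy: "adj x y" "adj v w" using colI l x v by blast+
  have "v = x \<or> v = tw x" "w = y \<or> w = tw y" using tw_eq x v by blast+
  moreover have "\<not> (v = x \<and> w = tw y)" using col_tw_False[of y x] xy x by blast
  moreover have "\<not> (v = tw x \<and> w = y)" using col_tw_False[of x y] xy x csym by blast
  moreover have "m = l" if "v = x" "w = y" using line_eq[OF l(2,1), of x y] x v that by blast
  ultimately show ?thesis by blast
qed

text \<open>Equal or twin lines have the same rosette, so two ovoids lie in at most one
  rosette.\<close>

lemma rosette_eq:
  assumes N: "N \<in> lns S" "K \<in> lns S" and X: "X \<in> rosette S S' N" "X \<in> rosette S S' K"
    and Y: "Y \<in> rosette S S' N" "Y \<in> rosette S S' K" "X \<noteq> Y"
  shows "rosette S S' N = rosette S S' K"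
proof -
  let ?l = "pts_on S N" and ?m = "pts_on S K"
  have lm: "?l \<in> lines S" "?m \<in> lines S" using N by auto
  obtain x y where x: "x \<in> ?l" "x \<in> A" "X = Ov x" "y \<in> ?l" "y \<in> A" "Y = Ov y"
    using X(1) Y(1) line_sub[OF lm(1)] unfolding rosette_Ov by blast
  obtain v w where v: "v \<in> ?m" "v \<in> A" "X = Ov v" "w \<in> ?m" "w \<in> A" "Y = Ov w"
    using X(2) Y(2) line_sub[OF lm(2)] unfolding rosette_Ov by blast
  have "x \<noteq> y" "v \<noteq> w" using x v Y(3) by auto
  then have "?m = ?l \<or> v = tw x \<and> w = tw y" using pair_cases[OF lm x(2,5,1,4) _ v(2,5,1,4)] x v by simp
  then show ?thesis
  proof
    assume "?m = ?l" then show ?thesis unfolding rosette_Ov by simp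
  next
    assume t: "v = tw x \<and> w = tw y"
    have "tw v \<in> ?l" "tw w \<in> ?l" using t tw_tw x by simp_all
    then show ?thesis unfolding rosette_Ov
      using tw_line[OF lm x(2,5,1,4) \<open>x \<noteq> y\<close>] tw_line[OF lm(2,1) v(2,5,1,4) \<open>v \<noteq> w\<close>] t v by blast
  qed
qed

end

section \<open>Fibres of the cover and the induced automorphism\<close>

locale gq_pair_cover = gq_pair S S' s for S S' :: "('p, 'l) geometry" and s +
  fixes \<gamma> :: "('p \<Rightarrow> 'p set) \<times> ('l \<Rightarrow> 'p set set)"
  assumes cov: "cover (geom_A S S') (geom_E S S') \<gamma>"
begin

lemma cover_pts: assumes "x \<in> A" shows "\<exists>z\<in>A. fst \<gamma> x = Ov z"
proof -
  have "fst \<gamma> ` A \<subseteq> subtended_ovoids S S'"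
    using cov unfolding cover_def morphism_def geom_A_def geom_E_def by simp
  then show ?thesis using assms unfolding subtended_ovoids_Ov by blast
qed

lemma cover_lns: assumes "N \<in> lns S - lns S'" shows "\<exists>K\<in>lns S - lns S'. snd \<gamma> N = rosette S S' K"
proof -
  have "snd \<gamma> ` (lns S - lns S') \<subseteq> rosette S S' ` (lns S - lns S')"
    using cov unfolding cover_def morphism_def geom_A_def geom_E_def by simp
  then show ?thesis using assms by blast
qed

lemma cover_line: assumes "N \<in> lns S - lns S'"
  shows "bij_betw (fst \<gamma>) (pts_on S N - pts S') (snd \<gamma> N)"
proof -
  have "snd \<gamma> N \<in> lns (geom_E S S')"
    using cov assms unfolding cover_def morphism_def geom_A_def by auto
  moreover have "bij_betw (fst \<gamma>) (pts_on (geom_A S S') N) (pts_on (geom_E S S') (snd \<gamma> N))"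
    using cov assms geom_A_simps unfolding cover_def by blast
  ultimately show ?thesis using geom_A_simps(4) pts_on_E by metis
qed

lemma cover_through: assumes "x \<in> A" "N \<in> lns S" "M \<in> lns S" "x \<in> pts_on S N" "x \<in> pts_on S M" "snd \<gamma> N = snd \<gamma> M"
  shows "N = M"
proof -
  have "inj_on (snd \<gamma>) (lns_through (geom_A S S') x)"
    using cov assms geom_A_simps(1) unfolding cover_def bij_betw_def by blast
  moreover have "N \<in> lns_through (geom_A S S') x" "M \<in> lns_through (geom_A S S') x"
    using A_line[OF assms(1,4,2)] A_line[OF assms(1,5,3)] assms unfolding lns_through_def geom_A_def by (auto simp: pts_on_iff)
  ultimately show ?thesis using assms unfolding inj_on_def by blast
qed

lemma cover_inj_line: assumes "x \<in> A" "y \<in> A" "col (lines S) x y" "fst \<gamma> x = fst \<gamma> y" shows "x = y"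
proof -
  obtain N where N: "N \<in> lns S" "x \<in> pts_on S N" "y \<in> pts_on S N" using assms unfolding col_def by blast
  have "inj_on (fst \<gamma>) (pts_on S N - pts S')" using cover_line[OF A_line[OF assms(1) N(2,1)]] unfolding bij_betw_def by blast
  then show ?thesis using assms N unfolding inj_on_def by blast
qed

text \<open>Points with the same image have no common neighbour outside the subquadrangle, by local
  injectivity of the cover; hence all their common neighbours form one subtended ovoid.\<close>

lemma cover_fibre: assumes x: "x \<in> A" "y \<in> A" "fst \<gamma> x = fst \<gamma> y" shows "y = x \<or> y = tw x"
proof (cases "x = y")
  case False
  then have nc: "\<not> col (lines S) x y" using cover_inj_line x by blast
  have xyP: "x \<in> pts S" "y \<in> pts S" using x by blast+
  have sub: "nbrs (lines S) x y \<subseteq> pts S'"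
  proof (rule ccontr)
    assume "\<not> ?thesis"
    then obtain z where z: "z \<in> A" "col (lines S) x z" "col (lines S) y z" using col_in(2) unfolding nbrs_def by blast
    obtain N where N: "N \<in> lns S" "x \<in> pts_on S N" "z \<in> pts_on S N" using z unfolding col_def by blast
    obtain M where M: "M \<in> lns S" "y \<in> pts_on S M" "z \<in> pts_on S M" using z unfolding col_def by blast
    have NA: "N \<in> lns S - lns S'" "M \<in> lns S - lns S'" using A_line[OF z(1)] N M by blast+
    have "x \<noteq> z" using z nc csym by blast
    then have ne: "fst \<gamma> x \<noteq> fst \<gamma> z" using cover_inj_line x z by blast
    have im: "fst \<gamma> x \<in> snd \<gamma> N" "fst \<gamma> z \<in> snd \<gamma> N" "fst \<gamma> y \<in> snd \<gamma> M" "fst \<gamma> z \<in> snd \<gamma> M"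
      using bij_betwE[OF cover_line[OF NA(1)]] bij_betwE[OF cover_line[OF NA(2)]] x(1,2) z(1) N M by blast+
    obtain K K' where K: "K \<in> lns S" "snd \<gamma> N = rosette S S' K" "K' \<in> lns S" "snd \<gamma> M = rosette S S' K'"
      using cover_lns NA by blast
    \<comment> \<open>Both images contain the distinct ovoids
      \<open>fst \<gamma> x = fst \<gamma> y\<close> and \<open>fst \<gamma> z\<close>; injectivity
      on the lines through \<open>z\<close> then yields \<open>N = M\<close>.\<close>
    have "snd \<gamma> N = snd \<gamma> M" using rosette_eq[OF K(1,3) _ _ _ _ ne] im K x(3) by simp
    then have "N = M" using cover_through[OF z(1) N(1) M(1) N(3) M(3)] by blast
    then have "col (lines S) x y" using colI[of "pts_on S N"] N M by blast
    then show False using nc by blast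
  qed
  have "nbrs (lines S) x y \<subseteq> Ov x" "nbrs (lines S) x y \<subseteq> Ov y" using sub unfolding nbrs_def Ov_def by blast+
  moreover have "card (nbrs (lines S) x y) = card (Ov x)" "card (nbrs (lines S) x y) = card (Ov y)"
    using card_nbrs[OF xyP nc] card_Ov x by auto
  ultimately have "nbrs (lines S) x y = Ov x" "nbrs (lines S) x y = Ov y" using card_subset_eq[OF fin_Ov] by blast+
  then show ?thesis using tw_eq[OF x(1,2)] by simp
qed simp

text \<open>Applying \<open>cover_fibre\<close> at two points shows that lines in a fibre are equal
  or twins, and twins see the same points of \<open>P'\<close>. This gives the common point
  \<open>u\<close> in the description of the induced automorphism.\<close>

lemma cover_fibre_line:
  assumes N: "N \<in> lns S - lns S'" "K \<in> lns S - lns S'" "snd \<gamma> N = snd \<gamma> K"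
    and u: "u \<in> pts S'" "u \<in> pts_on S N"
  shows "u \<in> pts_on S K"
proof -
  let ?l = "pts_on S N" and ?m = "pts_on S K"
  have lm: "?l \<in> lines S" "?m \<in> lines S" using N by auto
  obtain v where v: "v \<in> A" "v \<in> ?m" using A_line_pt[OF N(2)] .
  obtain w where w: "w \<in> A" "w \<in> ?m" "w \<noteq> v" using A_nbr[OF v(1) lm(2) v(2)] by metis
  have surj: "\<exists>x\<in>A. x \<in> ?l \<and> Ov v = Ov x \<and> fst \<gamma> x = fst \<gamma> v" if v: "v \<in> A" "v \<in> ?m" for v
  proof -
    have "fst \<gamma> v \<in> snd \<gamma> N" using cover_line[OF N(2)] v N(3) unfolding bij_betw_def by auto
    then have "fst \<gamma> v \<in> fst \<gamma> ` (?l - pts S')" using cover_line[OF N(1)] unfolding bij_betw_def by simp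
    then obtain x where x: "x \<in> ?l - pts S'" "fst \<gamma> x = fst \<gamma> v" by auto
    then have xA: "x \<in> A" using line_sub[OF lm(1)] by blast
    then have "v = x \<or> v = tw x" using cover_fibre x v by blast
    then have "Ov v = Ov x" using tw(3)[OF xA] by auto
    then show ?thesis using x xA by blast
  qed
  obtain x where x: "x \<in> A" "x \<in> ?l" "Ov v = Ov x" "fst \<gamma> x = fst \<gamma> v" using surj[OF v] by blast
  obtain y where y: "y \<in> A" "y \<in> ?l" "Ov w = Ov y" "fst \<gamma> y = fst \<gamma> w" using surj[OF w(1,2)] by blast
  have "fst \<gamma> v \<noteq> fst \<gamma> w" using cover_inj_line[OF v(1) w(1) colI[OF lm(2) v(2) w(2)]] w(3) by blast
  then have xy: "x \<noteq> y" using x y by metis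
  from pair_cases[OF lm x(1) y(1) x(2) y(2) xy v(1) w(1) v(2) w(2) x(3) y(3)] show ?thesis
  proof
    assume "?m = ?l" then show ?thesis using u by simp
  next
    assume t: "v = tw x \<and> w = tw y"
    have "u \<in> Ov x" "u \<in> Ov y" using colI[OF lm(1)] x y u unfolding Ov_def by blast+
    then have "u \<in> Ov v" "u \<in> Ov w" using x y by auto
    then have "col (lines S) u v" "col (lines S) u w" using csym unfolding Ov_def by blast+
    then show ?thesis using triangle[OF lm(2) v(2) w(2) w(3)[symmetric]] by blast
  qed
qed

text \<open>Each \<open>u\<close> in the ovoid of \<open>x\<close> lies on a line \<open>N\<close>
  through \<open>x\<close>, and \<open>fst \<alpha> u\<close> is the point common to all ovoids of
  \<open>snd \<gamma> N\<close>, among them \<open>fst \<gamma> x\<close>. Equal cardinality turns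
  inclusion into equality.\<close>

lemma induced_image:
  assumes ind: "induced_automorphism S S' \<gamma> \<alpha>" and x: "x \<in> A"
  shows "fst \<gamma> x = fst \<alpha> ` Ov x"
proof -
  have au: "\<alpha> \<in> automorphisms S'" using ind unfolding induced_automorphism_def by blast
  obtain z where z: "z \<in> A" "fst \<gamma> x = Ov z" using cover_pts[OF x] by blast
  have "fst \<alpha> ` Ov x \<subseteq> Ov z"
  proof
    fix v' assume "v' \<in> fst \<alpha> ` Ov x"
    then obtain u where u: "u \<in> pts S'" "col (lines S) x u" "v' = fst \<alpha> u" unfolding Ov_def by blast
    obtain N where N: "N \<in> lns S" "x \<in> pts_on S N" "u \<in> pts_on S N" using u unfolding col_def by blast
    have NA: "N \<in> lns S - lns S'" using A_line[OF x N(2,1)] .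
    obtain K where K: "K \<in> lns S - lns S'" "snd \<gamma> N = rosette S S' K" using cover_lns[OF NA] by blast
    have KB: "pts_on S K \<in> lines S" using K by blast
    obtain k where k: "k \<in> A" "k \<in> pts_on S K" using A_line_pt[OF K(1)] .
    obtain v where v: "v \<in> pts_on S K" "v \<in> pts S'" using line_meets_P'[OF k(1) KB k(2)] by blast
    have all: "v \<in> X" if "X \<in> snd \<gamma> N" for X
      using that K(2) colI[OF KB _ v(1)] v(2) unfolding rosette_Ov Ov_def by auto
    have "inc S u M" if "M \<in> lns (geom_A S S')" "snd \<gamma> M = snd \<gamma> N" for M
      using cover_fibre_line[OF NA, of M u] that u N geom_A_simps(2) by (simp add: pts_on_iff)
    moreover have "snd \<gamma> N \<in> lns (geom_E S S')" using K unfolding geom_E_def by auto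
    ultimately have "fst \<alpha> u = v" using ind all u(1) v(2) unfolding induced_automorphism_def by blast
    moreover have "fst \<gamma> x \<in> snd \<gamma> N" using cover_line[OF NA] x N unfolding bij_betw_def by auto
    ultimately show "v' \<in> Ov z" using all u z by auto
  qed
  moreover have "inj_on (fst \<alpha>) (Ov x)"
    by (rule inj_on_subset[OF _ Ov_P']) (use au in \<open>simp add: automorphisms_def bij_betw_def\<close>)
  then have "card (fst \<alpha> ` Ov x) = card (Ov z)" using card_image[of "fst \<alpha>" "Ov x"] card_Ov[OF x] card_Ov[OF z(1)] by simp
  ultimately show ?thesis using card_subset_eq[OF fin_Ov] z by metis
qed

end

theorem theorem6p1:
  fixes S S' :: "('p, 'l) geometry"
    and s :: nat
    and L :: 'l
    and \<gamma> :: "('p \<Rightarrow> 'p set) \<times> ('l \<Rightarrow> 'p set set)"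
    and \<alpha> :: "('p \<Rightarrow> 'p) \<times> ('l \<Rightarrow> 'l)"
  assumes "thick_gq S s (s ^ 2)"
    and "L \<in> lns S"
    and "\<forall>x \<in> pts_on S L. translation_point S s x"
    and "subquadrangle S' S s s"
    and "L \<in> lns S'"
    and "\<forall>Ov \<in> subtended_ovoids S S'. doubly_subtended S S' Ov"
    and "two_cover (geom_A S S') (geom_E S S') \<gamma>"
    and "induced_automorphism S S' \<gamma> \<alpha>"
    and "snd \<alpha> L = L"
  shows "card (extensions S S' \<alpha>) = 2"
proof -
  interpret gq_pair_cover S S' s \<gamma>
    using assms unfolding two_cover_def by unfold_locales auto
  define a where "a = pmap S' \<alpha>"
  have au: "\<alpha> \<in> automorphisms S'" using assms unfolding induced_automorphism_def by blast
  have aut_a: "quad.aut (pts S') (lines S') a" unfolding a_def using gq.auto_aut[OF gq' au] .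
  have a_P': "a u = fst \<alpha> u" if "u \<in> pts S'" for u using that unfolding a_def pmap_def by simp
  have alpha_line: "a ` pts_on S' N = pts_on S' (snd \<alpha> N)" if "N \<in> lns S'" for N
    using gq.auto_line[OF gq' au that] unfolding a_def by simp
  let ?L = "pts_on S' L"
  have LL: "?L = pts_on S L" using pts_on_eq assms(5) .
  have LB: "?L \<in> lines S'" using assms(5) by blast
  \<comment> \<open>Any point of \<open>L\<close> will do, as its image is again on \<open>L\<close>
    and hence a translation point.\<close>
  obtain p where p: "p \<in> ?L" using quad.line_two[OF sub LB] by blast
  have aL: "a ` ?L = ?L" using alpha_line[OF assms(5)] assms(9) by simp
  have tp: "tpoint x" if "x \<in> ?L" for x using translation_tpoint assms(3) LL that by simp
  interpret ovoid_auto "pts S" "lines S" s "pts S'" "lines S'" a ?L p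
  proof
    show "quad.aut (pts S') (lines S') a" by (rule aut_a)
    show "\<exists>z\<in>A. Ov z = a ` Ov x" if "x \<in> A" for x
    proof -
      have "a ` Ov x = fst \<alpha> ` Ov x" using a_P' Ov_P' by (intro image_cong) auto
      then show ?thesis using induced_image[OF assms(8) that] cover_pts[OF that] by auto
    qed
    show "?L \<in> lines S'" "p \<in> ?L" "a ` ?L = ?L" by fact+
    show "tpoint p" "tpoint (a p)" using tp p aL by blast+
  qed
  obtain f where f: "aut f" "\<forall>u\<in>pts S'. f u = a u" using extension by blast
  have "A \<noteq> {}"
  proof
    assume "A = {}"
    have "lines S \<subseteq> lines S'"
    proof
      fix l assume l: "l \<in> lines S"
      then have "l \<subseteq> pts S'" using line_sub[OF l] \<open>A = {}\<close> by blast
      then show "l \<in> lines S'" using line_sub_B'[OF l] by blast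
    qed
    then have "lines S = lines S'" using lines_sub by blast
    \<comment> \<open>Otherwise the lines through \<open>p\<close> would be counted once in each
      quadrangle, with different results.\<close>
    then have "s^2 + 1 = s + 1" using pt_card[OF pP] quad.pt_card[OF sub pP'] by simp
    then show False using s2 by (simp add: power2_eq_square)
  qed
  moreover have "f u \<in> pts S'" if "u \<in> pts S'" for u using that f a_in by simp
  ultimately have two: "card {g. aut g \<and> (\<forall>u\<in>pts S'. g u = f u)} = 2" using card_extensions[OF f(1)] by blast
  have "bij_betw (pmap S) (extensions S S' \<alpha>) {g. aut g \<and> (\<forall>u\<in>pts S'. g u = f u)}"
  proof (rule bij_betw_imageI)
    show "inj_on (pmap S) (extensions S S' \<alpha>)"
      using auto_eqI unfolding inj_on_def extensions_def by blast
    show "pmap S ` extensions S S' \<alpha> = {g. aut g \<and> (\<forall>u\<in>pts S'. g u = f u)}"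
    proof (intro equalityI subsetI)
      fix g assume "g \<in> pmap S ` extensions S S' \<alpha>"
      then obtain \<beta> where b: "\<beta> \<in> automorphisms S" "restrict (fst \<beta>) (pts S') = fst \<alpha>" "g = pmap S \<beta>"
        unfolding extensions_def by auto
      have "g u = f u" if u: "u \<in> pts S'" for u
      proof -
        have "g u = fst \<beta> u" using b u pts_sub unfolding pmap_def by auto
        also have "\<dots> = fst \<alpha> u" using fun_cong[OF b(2), of u] u by simp
        finally show ?thesis using f u a_P' by simp
      qed
      then show "g \<in> {g. aut g \<and> (\<forall>u\<in>pts S'. g u = f u)}" using auto_aut b by blast
    next
      fix g assume "g \<in> {g. aut g \<and> (\<forall>u\<in>pts S'. g u = f u)}"
      then have g: "aut g" "\<And>u. u \<in> pts S' \<Longrightarrow> g u = a u" using f by auto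
      obtain \<beta> where b: "\<beta> \<in> automorphisms S" "pmap S \<beta> = g" using aut_auto[OF g(1)] .
      have "restrict (fst \<beta>) (pts S') = fst \<alpha>"
      proof (rule extensionalityI)
        show "fst \<alpha> \<in> extensional (pts S')" using au unfolding automorphisms_def by blast
        fix u assume u: "u \<in> pts S'"
        then have "fst \<beta> u = g u" using b(2) pts_sub unfolding pmap_def by auto
        then show "restrict (fst \<beta>) (pts S') u = fst \<alpha> u" using u g a_P' by simp
      qed simp
      moreover have "restrict (snd \<beta>) (lns S') = snd \<alpha>"
      proof (rule extensionalityI)
        show "snd \<alpha> \<in> extensional (lns S')" using au unfolding automorphisms_def by blast
        fix N assume N: "N \<in> lns S'"
        have sN: "snd \<alpha> N \<in> lns S'" using gq.auto_snd[OF gq' au N] .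
        have NS: "N \<in> lns S" using N lns_sub by blast
        have "pts_on S (snd \<beta> N) = g ` pts_on S' N" using auto_line[OF b(1) NS] b(2) pts_on_eq[OF N] by simp
        also have "\<dots> = a ` pts_on S' N" using g(2) by (intro image_cong) (auto simp: pts_on_iff)
        also have "\<dots> = pts_on S (snd \<alpha> N)" using alpha_line[OF N] pts_on_eq[OF sN] by simp
        finally have "snd \<beta> N = snd \<alpha> N" using lines_eq[OF auto_snd[OF b(1) NS]] sN lns_sub by blast
        then show "restrict (snd \<beta>) (lns S') N = snd \<alpha> N" using N by simp
      qed simp
      ultimately have "\<beta> \<in> extensions S S' \<alpha>" using b(1) unfolding extensions_def by simp
      then show "g \<in> pmap S ` extensions S S' \<alpha>" using b(2) by blast
    qed
  qed
  from bij_betw_same_card[OF this] show ?thesis using two by (rule trans)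
qed

end
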